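(* Let $$L_1=\tfrac12\langle F^{\mu\nu}\,|\,i[A_\mu,A_\nu]\rangle,\qquad Q_1^\mu=\langle F^{\mu\nu}\,|\,i[w,A_\nu]\rangle$$ be the Yang–Mills $L$-$Q$ pair. Then the second-order condition $$2\,\mathfrak S_{xx'}\,O_{Q_1(x)}(L_1(x'))=\delta_cL_2(x)\cdot i\delta_{xx'}-i\,\mathfrak S_{xx'}\,\partial^x_\mu Q_2^\mu(x;x')$$ is solved by $$L_2=-\tfrac12(1+c_F)\,\langle i[A^\mu,A^\nu]\,|\,i[A_\mu,A_\nu]\rangle,$$ $$Q_2^\mu(x;x')=-2(1+c_F)\,\langle i[A^\mu,A^\nu]\,|\,i[w,A_\nu]\rangle\cdot\delta_{xx'}-2\,\langle i[F^{\mu\nu},A_\nu](x)\,|\,w_2(x,x')\rangle,$$ where $w_2(x,x'):=i[w(x'),A_\nu(x')]\cdot I^\nu\delta_{xx'}$.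
   Context: Lie algebra: a simple non-abelian Lie algebra with generators $\xi_a$, $[\xi_a,\xi_b]=if_{abc}\xi_c$, $f_{abc}$ real and totally antisymmetric; symmetric inner product $\langle\xi_a|\xi_b\rangle=\delta_{ab}$, invariant: $\langle i[X,Z]|Y\rangle=\langle X|i[Z,Y]\rangle$. Fields are Lie-algebra valued, $X=X^a\xi_a$; products of field components are Wick products (so bosonic components commute), and $[\cdot,\cdot]$, $\langle\cdot|\cdot\rangle$ refer only to the Lie algebra. Fields on Minkowski space (metric $\eta$): $F_{\mu\nu}=-F_{\nu\mu}$, the string-localized potential $A_\mu=A_\mu(c)$, and $w$, satisfying $\partial^\mu F_{\mu\nu}=0$, $\partial_\mu A_\nu-\partial_\nu A_\mu=F_{\mu\nu}$, $\partial^\mu A_\mu=0$. Here $c(e)$ is a smearing function of total weight 1 on spacelike unit vectors, $(I^\nu f)(x)=\int d\sigma(e)\,c(e)e^\nu\int_0^\infty ds\,f(x+se)$ (so $\partial_\nu I^\nu=-1$), and $A_\mu=I^\nu F_{\mu\nu}$. The string variation $\delta_c$ is a derivation on Wick polynomials with $\delta_cA_\mu=\partial_\mu w$ and $\delta_cF_{\mu\nu}=0$. Notation: $\delta_{xx'}=\delta(x-x')$; $I$ (resp. $I'$) denotes string integration with respect to $x$ (resp. $x'$); $\partial$ acts on $x$ and $\partial\delta_{xx'}=-\partial'\delta_{xx'}$; $T^{[\kappa}S^{\lambda]}=T^\kappa S^\lambda-T^\lambda S^\kappa$; $\mathfrak S_{xx'}$ is the average over permutations of $x,x'$. Obstruction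 map (tree level): for Wick polynomials $Y^\mu$, $X$, $O_{Y(x)}(X(x'))$ is the sum over all ways of replacing one linear field factor $\varphi$ in $Y^\mu(x)$ and one linear field factor $\chi$ in $X(x')$ by the two-point obstruction $O_\mu(\varphi(x),\chi(x'))$. The two-point obstructions are (times $\delta_{ab}$ in Lie-algebra indices), with a renormalization constant $c_F\in\mathbb R$: $O_\mu(F^{\mu\nu},F'^{\kappa\lambda})=-(1+c_F)\eta^{\nu[\kappa}\partial^{\lambda]}i\delta_{xx'}$; $O_\mu(F^{\mu\nu},A'^\kappa)=-(\eta^{\nu\kappa}-I'^\nu\partial^\kappa)i\delta_{xx'}$; $O_\mu(A_\nu,\cdot)-O_\nu(A_\mu,\cdot)$ equals $-c_F\delta_\mu^{[\kappa}\delta_\nu^{\lambda]}i\delta_{xx'}$ for $F'^{\kappa\lambda}$ and $0$ for $A'^\kappa$; $O_\mu(w,\cdot)=0$. (In $O_{Q_1}$ only this antisymmetrized part of $O_\mu(A_\nu,\cdot)$ enters.) *)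

theory Defs
  imports "HOL-Analysis.Analysis" "HOL-Library.Poly_Mapping"
begin

text \<open>
  The complex span of the generators \<open>\<xi>\<^sub>a\<close> is identified with \<open>complex^'a\<close>, and
  \<open>[\<xi>\<^sub>a,\<xi>\<^sub>b] = \<i> f\<^sub>a\<^sub>b\<^sub>c \<xi>\<^sub>c\<close>. The inner product is the bilinear one with
  \<open>\<langle>\<xi>\<^sub>a|\<xi>\<^sub>b\<rangle> = \<delta>\<^sub>a\<^sub>b\<close>; its invariance is the total antisymmetry of \<open>f\<close>.
  Simplicity is that of the complex span; since \<open>f\<close> is real and totally antisymmetric (compact real
  form), this agrees with simplicity of the real span of the \<open>\<i>\<xi>\<^sub>a\<close>.
\<close>

definition lie_bracket ::
  "('a::finite \<Rightarrow> 'a \<Rightarrow> 'a \<Rightarrow> real) \<Rightarrow> complex^'a \<Rightarrow> complex^'a \<Rightarrow> complex^'a" where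
  "lie_bracket f X Y = (\<chi> c. \<Sum>a\<in>UNIV. \<Sum>b\<in>UNIV. \<i> * of_real (f a b c) * X$a * Y$b)"

definition simple_lie_algebra :: "('a::finite \<Rightarrow> 'a \<Rightarrow> 'a \<Rightarrow> real) \<Rightarrow> bool" where
  "simple_lie_algebra f \<longleftrightarrow>
     (\<forall>a b c. f b a c = - f a b c) \<and> (\<forall>a b c. f a c b = - f a b c) \<and>
     (\<forall>X Y Z. lie_bracket f X (lie_bracket f Y Z) + lie_bracket f Y (lie_bracket f Z X)
              + lie_bracket f Z (lie_bracket f X Y) = 0) \<and>
     (\<exists>X Y. lie_bracket f X Y \<noteq> 0) \<and>
     (\<forall>S. vec.subspace S \<and> (\<forall>X. \<forall>Y\<in>S. lie_bracket f X Y \<in> S) \<longrightarrow> S = {0} \<or> S = UNIV)"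

text \<open>
  Lorentz indices are elements of the type \<open>4\<close>, with \<open>0\<close> the time direction. The signature is
  \<open>(+,-,-,-)\<close>; \<open>\<eta>\<close> serves for both index positions.
\<close>

type_synonym pt = "real^4"

definition mink :: "4 \<Rightarrow> 4 \<Rightarrow> real" ("\<eta>") where
  "\<eta> \<mu> \<nu> = (if \<mu> = \<nu> then if \<mu> = 0 then 1 else - 1 else 0)"

text \<open>
  Linear field symbols: \<open>FieldF \<mu> \<nu> a\<close> is \<open>F\<^sup>\<mu>\<^sup>\<nu>\<^sup>a\<close> and \<open>FieldA \<mu> a\<close> is \<open>A\<^sup>\<mu>\<^sup>a\<close>
  (upper Lorentz indices), while \<open>Deriv \<mu>\<close> is \<open>\<partial>\<^sub>\<mu>\<close> (lower index).
\<close>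

datatype 'a fld = FieldF 4 4 'a | FieldA 4 'a | FieldW 'a | Deriv 4 "'a fld"

text \<open>
  A Wick monomial is the multiset of its linear factors. \<open>'a wick\<close> contains the Wick polynomials
  at one unspecified point, \<open>'a nwick\<close> the Wick products of fields at several points. Both are
  free commutative algebras; the linear field relations are imposed in \<open>wick_functional\<close>.
\<close>

type_synonym 'a wick = "'a fld multiset \<Rightarrow>\<^sub>0 complex"
type_synonym 'a nwick = "('a fld \<times> pt) multiset \<Rightarrow>\<^sub>0 complex"

definition const :: "complex \<Rightarrow> 'm multiset \<Rightarrow>\<^sub>0 complex" where
  "const z = Poly_Mapping.single {#} z"

definition wick_mono :: "'m multiset \<Rightarrow> 'm multiset \<Rightarrow>\<^sub>0 complex" where
  "wick_mono M = Poly_Mapping.single M 1"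

definition var :: "'m \<Rightarrow> 'm multiset \<Rightarrow>\<^sub>0 complex" where
  "var \<phi> = wick_mono {#\<phi>#}"

definition wick_at :: "'a wick \<Rightarrow> pt \<Rightarrow> 'a nwick" where
  "wick_at P x = (\<Sum>M\<in>Poly_Mapping.keys P.
     const (Poly_Mapping.lookup P M) * wick_mono (image_mset (\<lambda>\<phi>. (\<phi>, x)) M))"

definition wick_deriv :: "4 \<Rightarrow> 'a wick \<Rightarrow> 'a wick" where
  "wick_deriv \<mu> P = (\<Sum>M\<in>Poly_Mapping.keys P.
     const (Poly_Mapping.lookup P M) * (\<Sum>\<phi>\<in>#M. wick_mono (M - {#\<phi>#} + {#Deriv \<mu> \<phi>#})))"

definition F_up :: "4 \<Rightarrow> 4 \<Rightarrow> 'a \<Rightarrow> 'a wick" where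
  "F_up \<mu> \<nu> a = var (FieldF \<mu> \<nu> a)"

definition F_dn :: "4 \<Rightarrow> 4 \<Rightarrow> 'a \<Rightarrow> 'a wick" where
  "F_dn \<mu> \<nu> a = (\<Sum>\<rho>\<in>UNIV. \<Sum>\<tau>\<in>UNIV. const (of_real (\<eta> \<mu> \<rho> * \<eta> \<nu> \<tau>)) * F_up \<rho> \<tau> a)"

definition A_up :: "4 \<Rightarrow> 'a \<Rightarrow> 'a wick" where
  "A_up \<mu> a = var (FieldA \<mu> a)"

definition A_dn :: "4 \<Rightarrow> 'a \<Rightarrow> 'a wick" where
  "A_dn \<mu> a = (\<Sum>\<rho>\<in>UNIV. const (of_real (\<eta> \<mu> \<rho>)) * A_up \<rho> a)"

definition w_field :: "'a \<Rightarrow> 'a wick" where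
  "w_field a = var (FieldW a)"

text \<open>
  Lie-algebra valued Wick polynomials \<open>X = X\<^sup>a \<xi>\<^sub>a\<close> are given by their components;
  \<open>icomm f X Y\<close> is \<open>\<i>[X,Y]\<close> and \<open>inn X Y\<close> is \<open>\<langle>X|Y\<rangle>\<close>.
\<close>

definition comm :: "('a::finite \<Rightarrow> 'a \<Rightarrow> 'a \<Rightarrow> real) \<Rightarrow> ('a \<Rightarrow> 'a wick) \<Rightarrow> ('a \<Rightarrow> 'a wick) \<Rightarrow> 'a \<Rightarrow> 'a wick" where
  "comm f X Y c = (\<Sum>a\<in>UNIV. \<Sum>b\<in>UNIV. const (\<i> * of_real (f a b c)) * X a * Y b)"

definition icomm :: "('a::finite \<Rightarrow> 'a \<Rightarrow> 'a \<Rightarrow> real) \<Rightarrow> ('a \<Rightarrow> 'a wick) \<Rightarrow> ('a \<Rightarrow> 'a wick) \<Rightarrow> 'a \<Rightarrow> 'a wick" where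
  "icomm f X Y c = const \<i> * comm f X Y c"

definition inn :: "('a::finite \<Rightarrow> 'a wick) \<Rightarrow> ('a \<Rightarrow> 'a wick) \<Rightarrow> 'a wick" where
  "inn X Y = (\<Sum>a\<in>UNIV. X a * Y a)"

definition string_variation :: "('a wick \<Rightarrow> 'a wick) \<Rightarrow> bool" where
  "string_variation \<delta> \<longleftrightarrow>
     (\<forall>P Q. \<delta> (P + Q) = \<delta> P + \<delta> Q) \<and> (\<forall>z P. \<delta> (const z * P) = const z * \<delta> P) \<and>
     (\<forall>P Q. \<delta> (P * Q) = \<delta> P * Q + P * \<delta> Q) \<and>
     (\<forall>\<mu> a. \<delta> (A_dn \<mu> a) = wick_deriv \<mu> (w_field a)) \<and>
     (\<forall>\<mu> \<nu> a. \<delta> (F_dn \<mu> \<nu> a) = 0)"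

primrec dderiv :: "'a list \<Rightarrow> ('a::real_normed_vector \<Rightarrow> 'b::real_normed_vector) \<Rightarrow> 'a \<Rightarrow> 'b" where
  "dderiv [] g = g"
| "dderiv (v # vs) g = (\<lambda>x. frechet_derivative (dderiv vs g) (at x) v)"

definition smooth_fun :: "('a::real_normed_vector \<Rightarrow> 'b::real_normed_vector) \<Rightarrow> bool" where
  "smooth_fun g \<longleftrightarrow> (\<forall>vs x. dderiv vs g differentiable (at x))"

definition test_fun :: "(pt \<times> pt \<Rightarrow> complex) \<Rightarrow> bool" where
  "test_fun \<phi> \<longleftrightarrow> smooth_fun \<phi> \<and> (\<exists>K. compact K \<and> (\<forall>p. p \<notin> K \<longrightarrow> \<phi> p = 0))"

type_synonym bidist = "(pt \<times> pt \<Rightarrow> complex) \<Rightarrow> complex"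

definition distribution :: "bidist \<Rightarrow> bool" where
  "distribution T \<longleftrightarrow>
     (\<forall>\<phi> \<psi>. test_fun \<phi> \<and> test_fun \<psi> \<longrightarrow> T (\<lambda>p. \<phi> p + \<psi> p) = T \<phi> + T \<psi>) \<and>
     (\<forall>z \<phi>. test_fun \<phi> \<longrightarrow> T (\<lambda>p. z * \<phi> p) = z * T \<phi>) \<and>
     (\<forall>\<phi> \<psi> K. (\<forall>n::nat. test_fun (\<phi> n)) \<and> test_fun \<psi> \<and> compact K \<and> (\<forall>n. \<forall>p. p \<notin> K \<longrightarrow> \<phi> n p = 0) \<and>
        (\<forall>vs. uniform_limit UNIV (\<lambda>n. dderiv vs (\<phi> n)) (dderiv vs \<psi>) sequentially)
        \<longrightarrow> (\<lambda>n. T (\<phi> n)) \<longlonglongrightarrow> T \<psi>)"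

text \<open>Points of \<open>pt \<times> pt\<close> are \<open>(x, x')\<close>; \<open>dist_deriv \<mu>\<close> is \<open>\<partial>\<^sub>\<mu>\<close> with respect to \<open>x\<close>.\<close>

definition delta :: bidist where
  "delta \<phi> = (LINT x|lborel. \<phi> (x, x))"

definition dist_deriv :: "4 \<Rightarrow> bidist \<Rightarrow> bidist" where
  "dist_deriv \<mu> T \<phi> = - T (dderiv [(axis \<mu> 1, 0)] \<phi>)"

definition dist_deriv_up :: "4 \<Rightarrow> bidist \<Rightarrow> bidist" where
  "dist_deriv_up \<mu> T \<phi> = (\<Sum>\<rho>\<in>UNIV. of_real (\<eta> \<mu> \<rho>) * dist_deriv \<rho> T \<phi>)"

definition symm :: "bidist \<Rightarrow> bidist" where
  "symm T \<phi> = (T \<phi> + T (\<phi> \<circ> prod.swap)) / 2"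

definition spacelike_unit :: "pt set" where
  "spacelike_unit = {e. (\<Sum>\<mu>\<in>UNIV. \<Sum>\<nu>\<in>UNIV. \<eta> \<mu> \<nu> * e$\<mu> * e$\<nu>) = - 1}"

text \<open>
  \<open>\<sigma>\<close> may be any measure on the spacelike unit vectors that is finite on compact sets, such as
  the Lorentz invariant one.
\<close>

definition smearing :: "pt measure \<Rightarrow> (pt \<Rightarrow> real) \<Rightarrow> bool" where
  "smearing \<sigma> c \<longleftrightarrow>
     sets \<sigma> = sets borel \<and> (\<forall>K. compact K \<longrightarrow> emeasure \<sigma> K < \<infinity>) \<and>
     emeasure \<sigma> (- spacelike_unit) = 0 \<and>
     continuous_on UNIV c \<and> (\<exists>K. compact K \<and> (\<forall>e. e \<notin> K \<longrightarrow> c e = 0)) \<and>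
     (LINT e|\<sigma>. c e) = 1"

definition string_integrable :: "pt measure \<Rightarrow> (pt \<Rightarrow> real) \<Rightarrow> 4 \<Rightarrow> (pt \<Rightarrow> complex) \<Rightarrow> pt \<Rightarrow> bool" where
  "string_integrable \<sigma> c \<nu> g x \<longleftrightarrow>
     integrable (\<sigma> \<Otimes>\<^sub>M lborel) (\<lambda>(e, s). indicator {0..} s *\<^sub>R (c e * e$\<nu>) *\<^sub>R g (x + s *\<^sub>R e))"

definition string_int :: "pt measure \<Rightarrow> (pt \<Rightarrow> real) \<Rightarrow> 4 \<Rightarrow> (pt \<Rightarrow> complex) \<Rightarrow> pt \<Rightarrow> complex" where
  "string_int \<sigma> c \<nu> g x =
     (LINT e|\<sigma>. (c e * e$\<nu>) *\<^sub>R (LINT s:{0..}|lborel. g (x + s *\<^sub>R e)))"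

text \<open>
  The transposes of \<open>string_int\<close>: translating a distribution by \<open>s e\<close> translates the
  test function by \<open>- s e\<close>.
\<close>

definition string_dist :: "pt measure \<Rightarrow> (pt \<Rightarrow> real) \<Rightarrow> 4 \<Rightarrow> bidist \<Rightarrow> bidist" where
  "string_dist \<sigma> c \<nu> T \<phi> =
     (LINT e|\<sigma>. (c e * e$\<nu>) *\<^sub>R (LINT s:{0..}|lborel. T (\<lambda>(x, x'). \<phi> (x - s *\<^sub>R e, x'))))"

definition string_dist' :: "pt measure \<Rightarrow> (pt \<Rightarrow> real) \<Rightarrow> 4 \<Rightarrow> bidist \<Rightarrow> bidist" where
  "string_dist' \<sigma> c \<nu> T \<phi> =
     (LINT e|\<sigma>. (c e * e$\<nu>) *\<^sub>R (LINT s:{0..}|lborel. T (\<lambda>(x, x'). \<phi> (x, x' - s *\<^sub>R e))))"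

text \<open>
  Operator identities between Wick products are tested on their matrix elements. \<open>\<omega>\<close> is
  such a matrix element: a linear functional on Wick products at arbitrary points, smooth in the
  points and vanishing on the linear field relations, in the presence of any other factors \<open>R\<close>.
  It is not assumed to be multiplicative; evaluation at a classical solution is the special case in
  which it is.
\<close>

definition field_relations :: "'a wick set" where
  "field_relations =
     {F_dn \<mu> \<nu> a + F_dn \<nu> \<mu> a |\<mu> \<nu> a. True} \<union>
     {\<Sum>\<mu>\<in>UNIV. \<Sum>\<rho>\<in>UNIV. const (of_real (\<eta> \<mu> \<rho>)) * wick_deriv \<rho> (F_dn \<mu> \<nu> a) |\<nu> a. True} \<union>
     {wick_deriv \<mu> (A_dn \<nu> a) - wick_deriv \<nu> (A_dn \<mu> a) - F_dn \<mu> \<nu> a |\<mu> \<nu> a. True} \<union>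
     {\<Sum>\<mu>\<in>UNIV. \<Sum>\<rho>\<in>UNIV. const (of_real (\<eta> \<mu> \<rho>)) * wick_deriv \<rho> (A_dn \<mu> a) |a. True}"

definition wick_functional :: "pt measure \<Rightarrow> (pt \<Rightarrow> real) \<Rightarrow> ('a nwick \<Rightarrow> complex) \<Rightarrow> bool" where
  "wick_functional \<sigma> c \<omega> \<longleftrightarrow>
     (\<forall>P Q. \<omega> (P + Q) = \<omega> P + \<omega> Q) \<and> (\<forall>z P. \<omega> (const z * P) = z * \<omega> P) \<and>
     (\<forall>R P Q. smooth_fun (\<lambda>(x, x'). \<omega> (R * wick_at P x * wick_at Q x'))) \<and>
     (\<forall>R P \<mu> x. \<omega> (R * wick_at (wick_deriv \<mu> P) x) = dderiv [axis \<mu> 1] (\<lambda>y. \<omega> (R * wick_at P y)) x) \<and>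
     (\<forall>R x. \<forall>P\<in>field_relations. \<omega> (R * wick_at P x) = 0) \<and>
     (\<forall>R \<mu> a x. (\<forall>\<nu>. string_integrable \<sigma> c \<nu> (\<lambda>y. \<omega> (R * wick_at (F_dn \<mu> \<nu> a) y)) x) \<and>
        \<omega> (R * wick_at (A_dn \<mu> a) x) =
          (\<Sum>\<nu>\<in>UNIV. string_int \<sigma> c \<nu> (\<lambda>y. \<omega> (R * wick_at (F_dn \<mu> \<nu> a) y)) x))"

text \<open>
  Matrix elements of Wick-polynomial valued distributions in \<open>(x, x')\<close>. They are applied to test
  functions with values in the Wick algebra, which makes them a module over bilocal Wick
  polynomials; \<open>smear\<close> is the restriction to scalar test functions.
\<close>

type_synonym 'a wdist = "(pt \<times> pt \<Rightarrow> 'a nwick) \<Rightarrow> complex"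

definition wlift :: "('a nwick \<Rightarrow> complex) \<Rightarrow> bidist \<Rightarrow> 'a wdist" where
  "wlift \<omega> T \<Phi> = T (\<lambda>p. \<omega> (\<Phi> p))"

definition wmul :: "(pt \<Rightarrow> pt \<Rightarrow> 'a nwick) \<Rightarrow> 'a wdist \<Rightarrow> 'a wdist" where
  "wmul P V \<Phi> = V (\<lambda>(x, x'). P x x' * \<Phi> (x, x'))"

definition smear :: "'a wdist \<Rightarrow> bidist" where
  "smear V \<phi> = V (\<lambda>p. const (\<phi> p))"

definition two_point_obstruction ::
  "pt measure \<Rightarrow> (pt \<Rightarrow> real) \<Rightarrow> real \<Rightarrow> (4 \<Rightarrow> 'a fld \<Rightarrow> 'a fld \<Rightarrow> bidist) \<Rightarrow> bool" where
  "two_point_obstruction \<sigma> c c_F Ob \<longleftrightarrow>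
     (\<forall>\<mu> \<psi> \<theta>. distribution (Ob \<mu> \<psi> \<theta>)) \<and>
     (\<forall>\<phi>. test_fun \<phi> \<longrightarrow>
       (\<forall>\<nu> \<kappa> \<tau> a b. (\<Sum>\<mu>\<in>UNIV. Ob \<mu> (FieldF \<mu> \<nu> a) (FieldF \<kappa> \<tau> b) \<phi>) =
          of_bool (a = b) * (- (1 + of_real c_F)) *
            (of_real (\<eta> \<nu> \<kappa>) * \<i> * dist_deriv_up \<tau> delta \<phi> - of_real (\<eta> \<nu> \<tau>) * \<i> * dist_deriv_up \<kappa> delta \<phi>)) \<and>
       (\<forall>\<nu> \<kappa> a b. (\<Sum>\<mu>\<in>UNIV. Ob \<mu> (FieldF \<mu> \<nu> a) (FieldA \<kappa> b) \<phi>) =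
          - of_bool (a = b) *
            (of_real (\<eta> \<nu> \<kappa>) * \<i> * delta \<phi> - \<i> * string_dist' \<sigma> c \<nu> (dist_deriv_up \<kappa> delta) \<phi>)) \<and>
       (\<forall>\<mu> \<nu> \<kappa> \<tau> a b.
          (\<Sum>\<rho>\<in>UNIV. of_real (\<eta> \<nu> \<rho>) * Ob \<mu> (FieldA \<rho> a) (FieldF \<kappa> \<tau> b) \<phi>)
          - (\<Sum>\<rho>\<in>UNIV. of_real (\<eta> \<mu> \<rho>) * Ob \<nu> (FieldA \<rho> a) (FieldF \<kappa> \<tau> b) \<phi>) =
          of_bool (a = b) * (- of_real c_F) *
            (of_bool (\<mu> = \<kappa>) * of_bool (\<nu> = \<tau>) - of_bool (\<mu> = \<tau>) * of_bool (\<nu> = \<kappa>)) * \<i> * delta \<phi>) \<and>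
       (\<forall>\<mu> \<nu> \<kappa> a b.
          (\<Sum>\<rho>\<in>UNIV. of_real (\<eta> \<nu> \<rho>) * Ob \<mu> (FieldA \<rho> a) (FieldA \<kappa> b) \<phi>)
          - (\<Sum>\<rho>\<in>UNIV. of_real (\<eta> \<mu> \<rho>) * Ob \<nu> (FieldA \<rho> a) (FieldA \<kappa> b) \<phi>) = 0) \<and>
       (\<forall>\<mu> a \<theta>. Ob \<mu> (FieldW a) \<theta> \<phi> = 0))"

definition obstruction ::
  "('a nwick \<Rightarrow> complex) \<Rightarrow> (4 \<Rightarrow> 'a fld \<Rightarrow> 'a fld \<Rightarrow> bidist) \<Rightarrow> (4 \<Rightarrow> 'a wick) \<Rightarrow> 'a wick \<Rightarrow> 'a wdist" where
  "obstruction \<omega> Ob Y X \<Phi> =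
     (\<Sum>\<mu>\<in>UNIV. \<Sum>M\<in>Poly_Mapping.keys (Y \<mu>). \<Sum>N\<in>Poly_Mapping.keys X.
        Poly_Mapping.lookup (Y \<mu>) M * Poly_Mapping.lookup X N *
        (\<Sum>\<psi>\<in>#M. \<Sum>\<theta>\<in>#N.
           wmul (\<lambda>x x'. wick_at (wick_mono (M - {#\<psi>#})) x * wick_at (wick_mono (N - {#\<theta>#})) x')
             (wlift \<omega> (Ob \<mu> \<psi> \<theta>)) \<Phi>))"

definition L1 :: "('a::finite \<Rightarrow> 'a \<Rightarrow> 'a \<Rightarrow> real) \<Rightarrow> 'a wick" where
  "L1 f = const (1/2) * (\<Sum>\<mu>\<in>UNIV. \<Sum>\<nu>\<in>UNIV. inn (F_up \<mu> \<nu>) (icomm f (A_dn \<mu>) (A_dn \<nu>)))"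

definition Q1 :: "('a::finite \<Rightarrow> 'a \<Rightarrow> 'a \<Rightarrow> real) \<Rightarrow> 4 \<Rightarrow> 'a wick" where
  "Q1 f \<mu> = (\<Sum>\<nu>\<in>UNIV. inn (F_up \<mu> \<nu>) (icomm f w_field (A_dn \<nu>)))"

definition L2 :: "('a::finite \<Rightarrow> 'a \<Rightarrow> 'a \<Rightarrow> real) \<Rightarrow> real \<Rightarrow> 'a wick" where
  "L2 f c_F = const (- (1/2) * (1 + of_real c_F)) *
     (\<Sum>\<mu>\<in>UNIV. \<Sum>\<nu>\<in>UNIV. inn (icomm f (A_up \<mu>) (A_up \<nu>)) (icomm f (A_dn \<mu>) (A_dn \<nu>)))"

definition w2 ::
  "pt measure \<Rightarrow> (pt \<Rightarrow> real) \<Rightarrow> ('a::finite \<Rightarrow> 'a \<Rightarrow> 'a \<Rightarrow> real) \<Rightarrow> ('a nwick \<Rightarrow> complex) \<Rightarrow> 'a \<Rightarrow> 'a wdist" where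
  "w2 \<sigma> c f \<omega> a \<Phi> = (\<Sum>\<nu>\<in>UNIV.
     wmul (\<lambda>x x'. wick_at (icomm f w_field (A_dn \<nu>) a) x') (wlift \<omega> (string_dist \<sigma> c \<nu> delta)) \<Phi>)"

definition Q2 ::
  "pt measure \<Rightarrow> (pt \<Rightarrow> real) \<Rightarrow> ('a::finite \<Rightarrow> 'a \<Rightarrow> 'a \<Rightarrow> real) \<Rightarrow> real \<Rightarrow> ('a nwick \<Rightarrow> complex) \<Rightarrow> 4 \<Rightarrow> 'a wdist" where
  "Q2 \<sigma> c f c_F \<omega> \<mu> \<Phi> =
     - 2 * (1 + of_real c_F) *
       wmul (\<lambda>x x'. wick_at (\<Sum>\<nu>\<in>UNIV. inn (icomm f (A_up \<mu>) (A_up \<nu>)) (icomm f w_field (A_dn \<nu>))) x)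
         (wlift \<omega> delta) \<Phi>
     - 2 * (\<Sum>a\<in>UNIV.
         wmul (\<lambda>x x'. wick_at (\<Sum>\<nu>\<in>UNIV. icomm f (F_up \<mu> \<nu>) (A_dn \<nu>) a) x) (w2 \<sigma> c f \<omega> a) \<Phi>)"

end

theory Submission
  imports Defs
begin

text \<open>
  Both sides are evaluated on a test function. On the left each contraction becomes a two-point
  obstruction applied to a correlation \<open>\<omega>(P(x) Q(x'))\<close> weighted by the test function. Symmetrization and
  integration by parts along the diagonal turn the derivative of \<open>\<delta>\<close> in the \<open>FF\<close> contraction
  into a difference of derivatives of the two factors. The remaining local terms match
  \<open>\<delta>\<^sub>c L\<^sub>2\<close> and the divergence of the local part of \<open>Q\<^sub>2\<close> modulo the field
  relations: by the Jacobi identity and \<open>\<partial>\<^sub>\<mu>A\<^sub>\<nu> - \<partial>\<^sub>\<nu>A\<^sub>\<mu> = F\<^sub>\<mu>\<^sub>\<nu>\<close>, the coefficients \<open>- (1 + c\<^sub>F)\<close>, \<open>c\<^sub>F\<close> and \<open>1\<close>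
  of \<open>\<langle>\<i>[w,F\<^sup>\<mu>\<^sup>\<nu>]|\<i>[A\<^sub>\<mu>,A\<^sub>\<nu>]\<rangle>\<close> from the \<open>FF\<close>, \<open>AF\<close> and \<open>FA\<close> contractions cancel. The string term
  of the \<open>FA\<close> contraction is the string term of \<open>\<partial>Q\<^sub>2\<close> with \<open>x\<close> and \<open>x'\<close> exchanged, because
  \<open>\<i>[F\<^sup>\<mu>\<^sup>\<nu>,A\<^sub>\<nu>]\<close> is conserved.
\<close>

section \<open>Wick polynomials\<close>

text \<open>The Wick algebra is free and a matrix element need not be multiplicative, so a field
  relation cannot simply be substituted. The local algebra is therefore done modulo an ideal
  containing the relations, realized by the polynomials that the matrix element annihilates next to
  every spectator factor. Symmetrization is essential: a single derivative of \<delta> leaves a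
  derivative of the test function, but the two orders together give its total derivative along the
  diagonal, which integrates away. This also explains the factor 2 in the local part of
  \<open>Q2\<close>: the symmetrized x-derivative of P(x) times \<delta> is only half of the
  derivative of P times \<delta>. For the first slot A only the antisymmetrized obstruction is
  known. Hence sums over two Lorentz indices are repeatedly added to themselves with the indices
  exchanged. The analytic obstacle is the linearity of the smeared string integral on test
  functions, which needs integrability. It holds because spacelike unit vectors have Euclidean
  length at least 1, so strings leave every compact support after a uniformly bounded parameter,
  while \<open>c\<close> cuts off the directions.\<close>

lemma const_add: "const (a + b) = const a + const b"
  by (simp add: const_def single_add)

lemma const_mult: "const (a * b) = const a * const b"
  by (simp add: const_def mult_single)

lemma const_0 [simp]: "const 0 = 0"
  by (simp add: const_def)

lemma const_1 [simp]: "const 1 = 1"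
  by (simp add: const_def flip: single_one)

lemma const_minus: "const (- a) = - const a"
  by (simp add: const_def single_uminus)

lemma const_diff: "const (a - b) = const a - const b"
  by (simp add: const_def single_diff)

lemma const_numeral: "const (numeral n) = numeral n"
  by (simp add: const_def flip: single_numeral)

lemma const_sum: "const (\<Sum>i\<in>I. h i) = (\<Sum>i\<in>I. const (h i))"
  by (induction I rule: infinite_finite_induct) (auto simp: const_add)

lemma const_times_mono: "const z * wick_mono M = Poly_Mapping.single M z"
  by (simp add: const_def wick_mono_def mult_single)

lemma wick_mono_mult: "wick_mono (M + N) = wick_mono M * wick_mono N"
  by (simp add: wick_mono_def mult_single)

lemma wick_mono_empty [simp]: "wick_mono {#} = 1"
  by (simp add: wick_mono_def flip: single_one)

lemma wick_mono_add_mset: "wick_mono (add_mset a M) = var a * wick_mono M"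
  by (simp add: var_def wick_mono_mult flip: add_mset_add_single union_commute)
    (metis add_mset_add_single union_commute wick_mono_mult)

lemma wick_expand: "P = (\<Sum>M\<in>Poly_Mapping.keys P. const (Poly_Mapping.lookup P M) * wick_mono M)"
proof (rule poly_mapping_eqI)
  fix N
  show "Poly_Mapping.lookup P N =
    Poly_Mapping.lookup (\<Sum>M\<in>Poly_Mapping.keys P. const (Poly_Mapping.lookup P M) * wick_mono M) N"
    by (simp add: const_times_mono lookup_sum lookup_single when_def in_keys_iff)
qed

text \<open>Additive statements on the free algebra need checking only on scaled monomials. The
  scalar sits in the base case because \<open>p\<close> is not assumed to be closed under
  scalars.\<close>

lemma wick_induct [case_names mono add]:
  assumes "\<And>z M. p (const z * wick_mono M)" and "\<And>P Q. p P \<Longrightarrow> p Q \<Longrightarrow> p (P + Q)"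
  shows "p P"
proof -
  have "p (\<Sum>M\<in>K. const (Poly_Mapping.lookup P M) * wick_mono M)" if "finite K" for K
    using that
  proof induction
    case empty
    show ?case using assms(1)[of 0] by simp
  qed (simp add: assms)
  then show ?thesis
    by (subst wick_expand) simp
qed

text \<open>Coefficients may cancel, so the support of \<open>P + Q\<close> can be smaller than the
  union of the supports. All three sums are extended to that union, where \<open>s 0 M = 0\<close>
  makes the new terms vanish. This yields additivity of every operation defined by a sum over
  monomials.\<close>

lemma keys_sum_add:
  fixes s :: "complex \<Rightarrow> 'm multiset \<Rightarrow> 'b::comm_monoid_add"
  assumes "\<And>M. s 0 M = 0" and "\<And>a b M. s (a + b) M = s a M + s b M"
  shows "(\<Sum>M\<in>Poly_Mapping.keys (P + Q). s (Poly_Mapping.lookup (P + Q) M) M) =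
    (\<Sum>M\<in>Poly_Mapping.keys P. s (Poly_Mapping.lookup P M) M) +
    (\<Sum>M\<in>Poly_Mapping.keys Q. s (Poly_Mapping.lookup Q M) M)"
proof -
  have *: "(\<Sum>M\<in>Poly_Mapping.keys R. s (Poly_Mapping.lookup R M) M) =
    (\<Sum>M\<in>K. s (Poly_Mapping.lookup R M) M)"
    if "finite K" "Poly_Mapping.keys R \<subseteq> K" for R :: "'m multiset \<Rightarrow>\<^sub>0 complex" and K
    using that by (intro sum.mono_neutral_left) (auto simp: assms in_keys_iff)
  let ?K = "Poly_Mapping.keys P \<union> Poly_Mapping.keys Q"
  show ?thesis
    by (subst (1 2 3) *[of ?K])
      (auto simp: lookup_add assms sum.distrib dest: subsetD[OF Poly_Mapping.keys_add])
qed

lemma keys_sum_mono: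
  assumes "\<And>M. s 0 M = (0 :: 'b::comm_monoid_add)"
  shows "(\<Sum>N\<in>Poly_Mapping.keys (const z * wick_mono M). s (Poly_Mapping.lookup (const z * wick_mono M) N) N)
    = s z M"
  by (auto simp: const_times_mono assms)

lemma wick_at_add: "wick_at (P + Q) x = wick_at P x + wick_at Q x"
  unfolding wick_at_def by (rule keys_sum_add) (auto simp: const_add algebra_simps)

lemma wick_at_const_mono: "wick_at (const z * wick_mono M) x = const z * wick_mono (image_mset (\<lambda>\<phi>. (\<phi>, x)) M)"
  unfolding wick_at_def by (rule keys_sum_mono) auto

lemma wick_at_mult: "wick_at (P * Q) x = wick_at P x * wick_at Q x"
proof (induction P rule: wick_induct)
  case (mono z M)
  show ?case
  proof (induction Q rule: wick_induct)
    case (mono y N)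
    have "const z * wick_mono M * (const y * wick_mono N) = const (z * y) * wick_mono (M + N)"
      by (simp add: const_mult wick_mono_mult mult_ac)
    then show ?case
      by (simp only: wick_at_const_mono) (simp add: const_mult wick_mono_mult mult_ac)
  qed (simp add: distrib_left wick_at_add)
qed (simp add: distrib_right wick_at_add)

lemma wick_at_const: "wick_at (const z) x = const z"
  using wick_at_const_mono[of z "{#}" x] by simp

lemma wick_at_0 [simp]: "wick_at 0 x = 0"
  using wick_at_const[of 0 x] by simp

lemma wick_at_1 [simp]: "wick_at 1 x = 1"
  using wick_at_const[of 1 x] by simp

lemma wick_deriv_add: "wick_deriv \<mu> (P + Q) = wick_deriv \<mu> P + wick_deriv \<mu> Q"
  unfolding wick_deriv_def by (rule keys_sum_add) (auto simp: const_add algebra_simps)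

lemma wick_deriv_const_mono:
  "wick_deriv \<mu> (const z * wick_mono M) =
     const z * (\<Sum>\<phi>\<in>#M. wick_mono (M - {#\<phi>#} + {#Deriv \<mu> \<phi>#}))"
  unfolding wick_deriv_def by (rule keys_sum_mono) auto

text \<open>The factors of \<open>M + N\<close>, counted with multiplicity, are those of
  \<open>M\<close> and those of \<open>N\<close>; differentiating one of the former leaves
  \<open>wick_mono N\<close> as a common factor, and conversely.\<close>

lemma wick_deriv_mult: "wick_deriv \<mu> (P * Q) = wick_deriv \<mu> P * Q + P * wick_deriv \<mu> Q"
proof (induction P rule: wick_induct)
  case (mono z M)
  show ?case
  proof (induction Q rule: wick_induct)
    case (mono y N)
    have eq: "const z * wick_mono M * (const y * wick_mono N) = const (z * y) * wick_mono (M + N)"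
      by (simp add: const_mult wick_mono_mult mult_ac)
    have "(\<Sum>\<phi>\<in>#M. wick_mono (M + N - {#\<phi>#} + {#Deriv \<mu> \<phi>#})) =
      (\<Sum>\<phi>\<in>#M. wick_mono (M - {#\<phi>#} + {#Deriv \<mu> \<phi>#})) * wick_mono N"
      unfolding sum_mset_distrib_right
      by (intro arg_cong[of _ _ sum_mset] image_mset_cong)
        (auto dest!: multi_member_split simp flip: wick_mono_mult)
    moreover have "(\<Sum>\<phi>\<in>#N. wick_mono (M + N - {#\<phi>#} + {#Deriv \<mu> \<phi>#})) =
      wick_mono M * (\<Sum>\<phi>\<in>#N. wick_mono (N - {#\<phi>#} + {#Deriv \<mu> \<phi>#}))"
      unfolding sum_mset_distrib_left
      by (intro arg_cong[of _ _ sum_mset] image_mset_cong)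
        (auto dest!: multi_member_split simp flip: wick_mono_mult)
    ultimately show ?case
      by (simp add: eq wick_deriv_const_mono) (simp add: const_mult algebra_simps)
  qed (simp add: distrib_left wick_deriv_add)
qed (simp add: distrib_right wick_deriv_add)

lemma wick_deriv_const [simp]: "wick_deriv \<mu> (const z) = 0"
  using wick_deriv_const_mono[of \<mu> z "{#}"] by simp

section \<open>Smooth functions and test functions\<close>

lemma dderiv_append: "dderiv (vs @ ws) g = dderiv vs (dderiv ws g)"
  by (induction vs) auto

lemma smooth_fun_dderiv: "smooth_fun g \<Longrightarrow> smooth_fun (dderiv ws g)"
  unfolding smooth_fun_def by (simp flip: dderiv_append)

lemma smooth_fun_differentiable: "smooth_fun g \<Longrightarrow> g differentiable (at x)"
  unfolding smooth_fun_def using dderiv.simps(1) by metis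

lemma smooth_fun_has_derivative:
  "smooth_fun g \<Longrightarrow> (g has_derivative frechet_derivative g (at x)) (at x)"
  using smooth_fun_differentiable frechet_derivative_works by blast

lemma smooth_fun_continuous: "smooth_fun g \<Longrightarrow> continuous_on S g"
  by (meson smooth_fun_differentiable differentiable_imp_continuous_within continuous_at_imp_continuous_on)

lemma dderiv1: "(g has_derivative D) (at x) \<Longrightarrow> dderiv [v] g x = D v"
  using frechet_derivative_at by fastforce

text \<open>Induction on the list of directions keeps every iterated derivative inside the class
  \<open>p\<close>. Smoothness thus reduces to finding a class of differentiable functions that is
  stable under one directional derivative.\<close>

lemma smooth_fun_coinduct:
  assumes "p g" and "\<And>h x. p h \<Longrightarrow> h differentiable (at x)" and "\<And>h v. p h \<Longrightarrow> p (dderiv [v] h)"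
  shows "smooth_fun g"
proof -
  have "p (dderiv vs g)" for vs
    by (induction vs) (use assms(1,3) in auto)
  then show ?thesis
    unfolding smooth_fun_def using assms(2) by blast
qed

lemma dderiv1_add:
  "smooth_fun g \<Longrightarrow> smooth_fun h \<Longrightarrow> dderiv [v] (\<lambda>x. g x + h x) = (\<lambda>x. dderiv [v] g x + dderiv [v] h x)"
  by (intro ext dderiv1[OF has_derivative_add, THEN trans]) (simp_all add: smooth_fun_has_derivative)

lemma dderiv1_mult:
  fixes g h :: "'a::real_normed_vector \<Rightarrow> complex"
  shows "smooth_fun g \<Longrightarrow> smooth_fun h \<Longrightarrow>
    dderiv [v] (\<lambda>x. g x * h x) = (\<lambda>x. dderiv [v] g x * h x + g x * dderiv [v] h x)"
  by (rule ext, rule dderiv1[THEN trans], rule has_derivative_mult;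
      (rule smooth_fun_has_derivative)?) auto

text \<open>By the Leibniz rule, products of smooth functions are not stable under derivatives, but
  finite sums of such products are. This is the class to which \<open>smooth_fun_coinduct\<close> is
  applied.\<close>

inductive sum_of_smooth_products :: "('a::real_normed_vector \<Rightarrow> complex) \<Rightarrow> bool" where
  prod: "smooth_fun g \<Longrightarrow> smooth_fun h \<Longrightarrow> sum_of_smooth_products (\<lambda>x. g x * h x)"
| sum: "sum_of_smooth_products g \<Longrightarrow> sum_of_smooth_products h \<Longrightarrow> sum_of_smooth_products (\<lambda>x. g x + h x)"

lemma sum_of_smooth_products_smooth:
  assumes "sum_of_smooth_products g" shows "smooth_fun g"
proof (rule smooth_fun_coinduct[where p = sum_of_smooth_products, OF assms])
  have *: "(\<forall>x. h differentiable (at x)) \<and> (\<forall>v. sum_of_smooth_products (dderiv [v] h))"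
    if "sum_of_smooth_products h" for h :: "'a \<Rightarrow> complex"
    using that
  proof induction
    case (prod g h)
    have "sum_of_smooth_products (dderiv [v] (\<lambda>x. g x * h x))" for v
      unfolding dderiv1_mult[OF prod]
      by (intro sum_of_smooth_products.intros prod smooth_fun_dderiv)
    then show ?case
      using prod by (blast intro: differentiable_mult smooth_fun_differentiable)
  next
    case (sum g h)
    have "dderiv [v] (\<lambda>x. g x + h x) = (\<lambda>x. dderiv [v] g x + dderiv [v] h x)" for v
      using sum by (intro ext dderiv1[THEN trans] has_derivative_add) (auto simp: frechet_derivative_works)
    then show ?case
      using sum by (auto intro!: sum_of_smooth_products.intros differentiable_add)
  qed
  show "h differentiable (at x)" "sum_of_smooth_products (dderiv [v] h)"
    if "sum_of_smooth_products h" for h :: "'a \<Rightarrow> complex" and x v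
    using *[OF that] by auto
qed

lemma smooth_fun_mult:
  fixes g h :: "'a::real_normed_vector \<Rightarrow> complex"
  shows "smooth_fun g \<Longrightarrow> smooth_fun h \<Longrightarrow> smooth_fun (\<lambda>x. g x * h x)"
  by (rule sum_of_smooth_products_smooth[OF sum_of_smooth_products.prod])

lemma smooth_fun_const: "smooth_fun (\<lambda>x. k)"
proof (rule smooth_fun_coinduct[where p = "\<lambda>g. \<exists>k. g = (\<lambda>x. k)"])
  show "\<exists>k. dderiv [v] h = (\<lambda>x. k)" if "\<exists>k. h = (\<lambda>x. k)" for h :: "'a \<Rightarrow> 'b" and v
    using that by auto
qed auto

text \<open>Each summand is a product with the constant 1, so the class of sums of products covers
  this case too.\<close>

lemma smooth_fun_add:
  fixes g h :: "'a::real_normed_vector \<Rightarrow> complex"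
  assumes "smooth_fun g" "smooth_fun h"
  shows "smooth_fun (\<lambda>x. g x + h x)"
proof -
  have "sum_of_smooth_products g" "sum_of_smooth_products h"
    using sum_of_smooth_products.prod[OF assms(1) smooth_fun_const[of 1]]
      sum_of_smooth_products.prod[OF assms(2) smooth_fun_const[of 1]] by simp_all
  then show ?thesis
    by (intro sum_of_smooth_products_smooth[OF sum_of_smooth_products.sum])
qed

lemma dderiv1_linear:
  fixes g :: "'b::real_normed_vector \<Rightarrow> 'c::real_normed_vector" and l :: "'a::real_normed_vector \<Rightarrow> 'b"
  assumes "smooth_fun g" "bounded_linear l"
  shows "dderiv [v] (\<lambda>x. g (l x)) = (\<lambda>x. dderiv [l v] g (l x))"
proof
  fix x
  have "((\<lambda>x. g (l x)) has_derivative (\<lambda>y. frechet_derivative g (at (l x)) (l y))) (at x)"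
    by (rule has_derivative_compose[OF bounded_linear_imp_has_derivative[OF assms(2)]
          smooth_fun_has_derivative[OF assms(1)]])
  from dderiv1[OF this] show "dderiv [v] (\<lambda>x. g (l x)) x = dderiv [l v] g (l x)"
    by simp
qed

text \<open>The stable class consists of all \<open>g\<close> after \<open>l\<close> with
  \<open>g\<close> smooth: differentiating along \<open>v\<close> replaces \<open>g\<close> by its
  derivative along \<open>l v\<close>.\<close>

lemma smooth_fun_linear:
  fixes g :: "'b::real_normed_vector \<Rightarrow> 'c::real_normed_vector" and l :: "'a::real_normed_vector \<Rightarrow> 'b"
  assumes "smooth_fun g" "bounded_linear l"
  shows "smooth_fun (\<lambda>x. g (l x))"
proof (rule smooth_fun_coinduct[where p = "\<lambda>h. \<exists>g. smooth_fun g \<and> h = (\<lambda>x. g (l x))"])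
  show "h differentiable (at x)" if "\<exists>g. smooth_fun g \<and> h = (\<lambda>x. g (l x))" for h :: "'a \<Rightarrow> 'c" and x
  proof -
    from that obtain g where "smooth_fun g" "h = (\<lambda>x. g (l x))" by blast
    then show ?thesis
      using differentiable_chain_at[of l x g] smooth_fun_differentiable[of g]
        bounded_linear_imp_differentiable[OF assms(2)] by (auto simp: o_def)
  qed
  show "\<exists>g. smooth_fun g \<and> dderiv [v] h = (\<lambda>x. g (l x))"
    if hyp: "\<exists>g. smooth_fun g \<and> h = (\<lambda>x. g (l x))" for h :: "'a \<Rightarrow> 'c" and v
  proof -
    from hyp obtain g where "smooth_fun g" "h = (\<lambda>x. g (l x))" by blast
    then show ?thesis
      using dderiv1_linear[OF _ assms(2)] smooth_fun_dderiv by blast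
  qed
qed (use assms in blast)

lemma bounded_linear_swap: "bounded_linear (prod.swap :: 'a::real_normed_vector \<times> 'b::real_normed_vector \<Rightarrow> _)"
  unfolding prod.swap_def by (intro bounded_linear_Pair bounded_linear_fst bounded_linear_snd)

lemma test_fun_mult:
  assumes "test_fun \<phi>" "smooth_fun h" shows "test_fun (\<lambda>p. \<phi> p * h p)"
  using assms unfolding test_fun_def by (auto intro!: smooth_fun_mult)

lemma test_fun_add:
  assumes "test_fun \<phi>" "test_fun \<psi>" shows "test_fun (\<lambda>p. \<phi> p + \<psi> p)"
proof -
  obtain K L where "compact K" "\<forall>p. p \<notin> K \<longrightarrow> \<phi> p = 0" "compact L" "\<forall>p. p \<notin> L \<longrightarrow> \<psi> p = 0"
    using assms unfolding test_fun_def by metis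
  then have "compact (K \<union> L)" "\<forall>p. p \<notin> K \<union> L \<longrightarrow> \<phi> p + \<psi> p = 0"
    by auto
  moreover have "smooth_fun (\<lambda>p. \<phi> p + \<psi> p)"
    using assms unfolding test_fun_def by (simp add: smooth_fun_add)
  ultimately show ?thesis
    unfolding test_fun_def by blast
qed

lemma test_fun_swap:
  assumes "test_fun \<phi>" shows "test_fun (\<lambda>p. \<phi> (prod.swap p))"
proof -
  obtain K where "compact K" "\<forall>p. p \<notin> K \<longrightarrow> \<phi> p = 0" "smooth_fun \<phi>"
    using assms unfolding test_fun_def by metis
  moreover have "compact (prod.swap ` K)"
    using \<open>compact K\<close> by (intro compact_continuous_image continuous_on_swap)
  moreover have "\<phi> (prod.swap p) = 0" if "p \<notin> prod.swap ` K" for p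
    using calculation(2) that by (metis image_eqI swap_swap)
  moreover have "smooth_fun (\<lambda>p. \<phi> (prod.swap p))"
    using \<open>smooth_fun \<phi>\<close> by (rule smooth_fun_linear[OF _ bounded_linear_swap])
  ultimately show ?thesis
    unfolding test_fun_def by blast
qed

lemma test_fun_dderiv:
  assumes "test_fun \<phi>" shows "test_fun (dderiv [v] \<phi>)"
proof -
  obtain K where K: "compact K" "\<forall>p. p \<notin> K \<longrightarrow> \<phi> p = 0" "smooth_fun \<phi>"
    using assms unfolding test_fun_def by metis
  have "dderiv [v] \<phi> p = 0" if "p \<notin> K" for p
  proof -
    \<comment> \<open>A compact set is closed, so \<phi> vanishes on a whole neighbourhood of
      \<open>p\<close> and not only at \<open>p\<close>.\<close>
    have "open (- K)" using K(1) by (simp add: compact_imp_closed open_Compl)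
    have "((\<lambda>p. 0) has_derivative (\<lambda>h. 0)) (at p)" by simp
    then have "(\<phi> has_derivative (\<lambda>h. 0)) (at p)"
      by (rule has_derivative_transform_within_open[OF _ \<open>open (- K)\<close>]) (use that K in auto)
    from dderiv1[OF this] show ?thesis .
  qed
  with K show ?thesis
    unfolding test_fun_def using smooth_fun_dderiv by blast
qed

text \<open>Separate bounds on the two arguments are the form used on the shifted diagonal of points
  \<open>(x - z, x)\<close>.\<close>

lemma test_fun_bounded_support:
  assumes "test_fun \<phi>"
  obtains r m where "r \<ge> 0" "m \<ge> 0" "\<And>x y. \<phi> (x, y) \<noteq> 0 \<Longrightarrow> norm x \<le> r \<and> norm y \<le> r"
    "\<And>p. norm (\<phi> p) \<le> m"
proof -
  obtain K where K: "compact K" "\<forall>p. p \<notin> K \<longrightarrow> \<phi> p = 0" "smooth_fun \<phi>"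
    using assms unfolding test_fun_def by metis
  obtain r where r: "\<forall>p\<in>K. norm p \<le> r"
    using compact_imp_bounded[OF K(1)] bounded_iff by blast
  have "compact (\<phi> ` K)"
    using K by (intro compact_continuous_image smooth_fun_continuous)
  then obtain m where m: "\<forall>p\<in>K. norm (\<phi> p) \<le> m"
    using compact_imp_bounded bounded_iff by (metis imageI)
  show ?thesis
  proof (rule that[of "max r 0" "max m 0"])
    show "norm x \<le> max r 0 \<and> norm y \<le> max r 0" if "\<phi> (x, y) \<noteq> 0" for x y
      using that K(2) r norm_fst_le[of x y] norm_snd_le[of y x] by (meson order_trans max.coboundedI1)
    show "norm (\<phi> p) \<le> max m 0" for p
      using K(2) m by (cases "p \<in> K") (simp_all add: le_max_iff_disj del: split_paired_All)
  qed auto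
qed

section \<open>Integration by parts\<close>

lemma lborel_integral_translate:
  fixes u :: "'a::euclidean_space \<Rightarrow> 'b::euclidean_space"
  assumes "u \<in> borel_measurable borel"
  shows "(LINT x|lborel. u (x + z)) = (LINT x|lborel. u x)"
proof -
  have "(LINT x|lborel. u x) = (LINT x|distr lborel borel ((+) z). u x)"
    by (simp add: lborel_distr_plus)
  also have "\<dots> = (LINT x|lborel. u (z + x))"
    by (rule integral_distr) (use assms in auto)
  finally show ?thesis by (simp add: add.commute)
qed

lemma integrable_continuous_bounded_support:
  fixes u :: "'a::euclidean_space \<Rightarrow> 'b::euclidean_space"
  assumes "continuous_on UNIV u" and "\<And>x. u x \<noteq> 0 \<Longrightarrow> norm x \<le> r"
  shows "integrable lborel u"
proof -
  have "integrable lborel (\<lambda>x. indicator (cball 0 r) x *\<^sub>R u x)"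
    by (rule borel_integrable_compact) (use continuous_on_subset[OF assms(1)] in auto)
  moreover have "(\<lambda>x. indicator (cball 0 r) x *\<^sub>R u x) = u"
    using assms(2) by (force simp: indicator_def)
  ultimately show ?thesis by simp
qed

text \<open>By translation invariance all difference quotients integrate to zero.\<close>

lemma integral_directional_derivative_0:
  fixes u :: "'a::euclidean_space \<Rightarrow> complex"
  assumes u: "\<And>x. (u has_derivative u' x) (at x)" and bnd: "\<And>x. norm (u' x v) \<le> m"
    and supp: "\<And>x. u x \<noteq> 0 \<Longrightarrow> norm x \<le> r" and meas: "(\<lambda>x. u' x v) \<in> borel_measurable borel"
  shows "(LINT x|lborel. u' x v) = 0"
proof -
  have cont: "continuous_on UNIV u"
    by (meson u has_derivative_continuous continuous_at_imp_continuous_on)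
  have int_u: "integrable lborel u"
    by (rule integrable_continuous_bounded_support[OF cont supp])
  have line: "((\<lambda>t. u (x + t *\<^sub>R v)) has_vector_derivative u' (x + t *\<^sub>R v) v) (at t)" for x t
  proof -
    have "((\<lambda>t. x + t *\<^sub>R v) has_derivative (\<lambda>t. t *\<^sub>R v)) (at t)"
      by (auto intro!: derivative_eq_intros)
    from has_derivative_compose[OF this u] show ?thesis
      by (simp add: has_vector_derivative_def linear_cmul[OF has_derivative_linear[OF u]])
  qed
  define q where "q n x = real (Suc n) *\<^sub>R (u (x + inverse (real (Suc n)) *\<^sub>R v) - u x)" for n x
  have "(\<lambda>n. LINT x|lborel. q n x) \<longlonglongrightarrow> (LINT x|lborel. u' x v)"
  \<comment> \<open>The step lengths are at most 1, so the quotients vanish outside the ball of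
    radius \<open>r + norm v\<close>; inside it the mean value inequality along the segment bounds
    them by \<open>m\<close>.\<close>
  proof (rule integral_dominated_convergence[where w = "\<lambda>x. indicator (cball 0 (r + norm v)) x * m"])
    show "integrable lborel (\<lambda>x. indicator (cball 0 (r + norm v)) x * m)"
      by (intro integrable_mult_left impI integrable_real_indicator) (auto simp: emeasure_lborel_cball_finite[unfolded infinity_ennreal_def])
    show "AE x in lborel. (\<lambda>n. q n x) \<longlonglongrightarrow> u' x v"
    proof (rule AE_I2)
      fix x
      have "((\<lambda>t. norm (u (x + t *\<^sub>R v) - u x - t *\<^sub>R u' x v) / norm t) \<longlongrightarrow> 0) (at 0)"
        using line[of x 0] unfolding has_vector_derivative_def has_derivative_iff_norm by simp
      then have "((\<lambda>t. norm ((u (x + t *\<^sub>R v) - u x) /\<^sub>R t - u' x v)) \<longlongrightarrow> 0) (at 0)"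
      proof (rule Lim_transform_eventually)
        have "norm (d - t *\<^sub>R e) / norm t = norm (d /\<^sub>R t - e)" if "t \<noteq> 0" for d e :: complex and t :: real
        proof -
          have "d /\<^sub>R t - e = (d - t *\<^sub>R e) /\<^sub>R t"
            using that by (simp add: scaleR_diff_right)
          then show ?thesis
            by (simp add: divide_inverse)
        qed
        then show "\<forall>\<^sub>F t in at 0. norm (u (x + t *\<^sub>R v) - u x - t *\<^sub>R u' x v) / norm t =
            norm ((u (x + t *\<^sub>R v) - u x) /\<^sub>R t - u' x v)"
          by (simp add: eventually_at_filter)
      qed
      then have "((\<lambda>t. (u (x + t *\<^sub>R v) - u x) /\<^sub>R t) \<longlongrightarrow> u' x v) (at 0)"
        using Lim_null tendsto_norm_zero_iff by blast
      moreover have "filterlim (\<lambda>n. inverse (real (Suc n))) (at 0) sequentially"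
        using LIMSEQ_inverse_real_of_nat by (simp add: filterlim_at)
      ultimately show "(\<lambda>n. q n x) \<longlonglongrightarrow> u' x v"
        unfolding q_def by (auto dest: filterlim_compose)
    qed
    show "AE x in lborel. norm (q n x) \<le> indicator (cball 0 (r + norm v)) x * m" for n
    proof (rule AE_I2)
      fix x
      let ?t = "inverse (real (Suc n))"
      have "norm (u (x + ?t *\<^sub>R v) - u (x + 0 *\<^sub>R v)) \<le> m * norm (?t - 0)"
      proof (rule differentiable_bound[where S = UNIV and f' = "\<lambda>t h. h *\<^sub>R u' (x + t *\<^sub>R v) v"])
        show "onorm (\<lambda>h. h *\<^sub>R u' (x + t *\<^sub>R v) v) \<le> m" for t
          by (rule onorm_le) (simp add: mult.commute[of m] mult_left_mono bnd)
      qed (use line in \<open>auto simp: has_vector_derivative_def\<close>)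
      then have "norm (q n x) \<le> m"
        unfolding q_def norm_scaleR by (simp add: divide_simps mult.commute del: of_nat_Suc)
      moreover have "q n x = 0" if "norm x > r + norm v"
      proof -
        have "norm (?t *\<^sub>R v) \<le> norm v" by (simp add: field_simps mult_left_le)
        moreover have "norm x \<le> norm (x + ?t *\<^sub>R v) + norm (?t *\<^sub>R v)"
          using norm_triangle_ineq4[of "x + ?t *\<^sub>R v" "?t *\<^sub>R v"] by simp
        ultimately have "norm (x + ?t *\<^sub>R v) > r" "norm x > r"
          using that norm_ge_zero[of v] by linarith+
        then show ?thesis
          unfolding q_def using supp by (metis diff_self not_le scale_zero_right)
      qed
      ultimately show "norm (q n x) \<le> indicator (cball 0 (r + norm v)) x * m"
        by (cases "norm x > r + norm v") auto
    qed
    show "q n \<in> borel_measurable lborel" for n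
      unfolding q_def using borel_measurable_continuous_onI[OF cont] by measurable
  qed (use meas in simp)
  moreover have "(LINT x|lborel. q n x) = 0" for n
  proof -
    have "integrable lborel (\<lambda>x. u (x + z))" for z
      by (rule integrable_continuous_bounded_support[where r = "r + norm z"])
        (use supp norm_triangle_ineq4[of "_ + z" z] in
          \<open>auto intro!: continuous_intros continuous_on_compose2[OF cont] order_trans[OF norm_triangle_ineq4[of "_ + z" z, simplified]]\<close>)
    then show ?thesis
      unfolding q_def using lborel_integral_translate[OF borel_measurable_continuous_onI[OF cont]] int_u
      by simp
  qed
  ultimately show ?thesis
    by (simp add: LIMSEQ_const_iff)
qed

section \<open>Distributions on the diagonal and along strings\<close>

lemma test_fun_smooth: "test_fun \<phi> \<Longrightarrow> smooth_fun \<phi>"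
  by (simp add: test_fun_def)

lemma integrable_test_fun_diagonal:
  assumes "test_fun \<phi>" shows "integrable lborel (\<lambda>x. \<phi> (x - z, x))"
proof -
  obtain r where "\<And>x y. \<phi> (x, y) \<noteq> 0 \<Longrightarrow> norm x \<le> r \<and> norm y \<le> r"
    using test_fun_bounded_support[OF assms] by metis
  then show ?thesis
    by (intro integrable_continuous_bounded_support[where r = r] continuous_intros
        continuous_on_compose2[OF smooth_fun_continuous[OF test_fun_smooth[OF assms], of UNIV]]) auto
qed

lemma delta_add: "test_fun \<phi> \<Longrightarrow> test_fun \<psi> \<Longrightarrow> delta (\<lambda>p. \<phi> p + \<psi> p) = delta \<phi> + delta \<psi>"
  using integrable_test_fun_diagonal[of _ 0] by (simp add: delta_def)

lemma delta_cmult: "delta (\<lambda>p. z * \<phi> p) = z * delta \<phi>"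
  by (simp add: delta_def)

text \<open>The sum of the two partial derivatives is the derivative along \<open>(v, v)\<close>,
  that is, the derivative along \<open>v\<close> of the restriction of \<psi> to the shifted
  diagonal. That restriction has bounded support.\<close>

lemma integral_diagonal_deriv_0:
  assumes "test_fun \<psi>"
  shows "(LINT x|lborel. dderiv [(v, 0)] \<psi> (x - z, x) + dderiv [(0, v)] \<psi> (x - z, x)) = 0"
proof -
  obtain r where r: "\<And>x y. \<psi> (x, y) \<noteq> 0 \<Longrightarrow> norm x \<le> r \<and> norm y \<le> r"
    using test_fun_bounded_support[OF assms] by metis
  obtain m where m: "\<And>p. norm (dderiv [(v, v)] \<psi> p) \<le> m"
    using test_fun_bounded_support[OF test_fun_dderiv[OF assms]] by metis
  have D: "(\<psi> has_derivative frechet_derivative \<psi> (at p)) (at p)" for p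
    using smooth_fun_has_derivative test_fun_smooth assms by blast
  have "((\<lambda>x. \<psi> (x - z, x)) has_derivative (\<lambda>h. frechet_derivative \<psi> (at (x - z, x)) (h, h))) (at x)" for x
    by (rule has_derivative_compose[OF _ D]) (auto intro!: derivative_eq_intros)
  then have "(LINT x|lborel. frechet_derivative \<psi> (at (x - z, x)) (v, v)) = 0"
  proof (rule integral_directional_derivative_0)
    show "norm (frechet_derivative \<psi> (at (x - z, x)) (v, v)) \<le> m" for x
      using m[of "(x - z, x)"] by simp
    have "continuous_on UNIV (dderiv [(v, v)] \<psi>)"
      by (intro smooth_fun_continuous test_fun_smooth test_fun_dderiv assms)
    then have "continuous_on UNIV (\<lambda>x. dderiv [(v, v)] \<psi> (x - z, x))"
      by (rule continuous_on_compose2) (auto intro!: continuous_intros)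
    then show "(\<lambda>x. frechet_derivative \<psi> (at (x - z, x)) (v, v)) \<in> borel_measurable borel"
      by (intro borel_measurable_continuous_onI) simp
  qed (use r in blast)
  moreover have "frechet_derivative \<psi> (at p) (v, v) = dderiv [(v, 0)] \<psi> p + dderiv [(0, v)] \<psi> p" for p
    using linear_add[OF has_derivative_linear[OF D], of p "(v, 0)" "(0, v)"] by simp
  ultimately show ?thesis by simp
qed

lemma integral_diagonal_deriv_swap:
  assumes "test_fun \<psi>"
  shows "(LINT x|lborel. dderiv [(0, v)] \<psi> (x - z, x)) = - (LINT x|lborel. dderiv [(v, 0)] \<psi> (x - z, x))"
  using integral_diagonal_deriv_0[OF assms, of v z] integrable_test_fun_diagonal[OF test_fun_dderiv[OF assms]]
  by (simp add: add_eq_0_iff del: dderiv.simps)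

lemma dderiv1_swap:
  assumes "smooth_fun \<phi>"
  shows "dderiv [v] (\<lambda>p. \<phi> (prod.swap p)) = (\<lambda>p. dderiv [prod.swap v] \<phi> (prod.swap p))"
  by (rule dderiv1_linear[OF assms bounded_linear_swap])

lemma dderiv1_translate:
  assumes "smooth_fun \<phi>"
  shows "dderiv [v] (\<lambda>p. \<phi> (p - q)) = (\<lambda>p. dderiv [v] \<phi> (p - q))"
proof
  fix p
  have "((\<lambda>p. \<phi> (p - q)) has_derivative (\<lambda>h. frechet_derivative \<phi> (at (p - q)) h)) (at p)"
    by (rule has_derivative_compose[OF _ smooth_fun_has_derivative[OF assms]])
      (auto intro!: derivative_eq_intros)
  from dderiv1[OF this] show "dderiv [v] (\<lambda>p. \<phi> (p - q)) p = dderiv [v] \<phi> (p - q)" by simp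
qed

text \<open>Integration by parts moves a derivative of \<open>\<delta>\<close> between the two points.\<close>

lemma string_dist'_deriv_delta:
  assumes "test_fun \<phi>"
  shows "string_dist' \<sigma> c \<nu> (dist_deriv \<kappa> delta) \<phi> =
    string_dist \<sigma> c \<nu> delta (dderiv [(axis \<kappa> 1, 0)] (\<lambda>p. \<phi> (prod.swap p)))"
proof -
  have "dist_deriv \<kappa> delta (\<lambda>(x, x'). \<phi> (x, x' - z)) =
    delta (\<lambda>(x, x'). dderiv [(axis \<kappa> 1, 0)] (\<lambda>p. \<phi> (prod.swap p)) (x - z, x'))" for z
  proof -
    let ?\<psi> = "\<lambda>p. \<phi> (prod.swap p)"
    have "dderiv [(axis \<kappa> 1, 0)] (\<lambda>(x, x'). \<phi> (x, x' - z)) (x, x) = dderiv [(0, axis \<kappa> 1)] ?\<psi> (x - z, x)" for x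
      using dderiv1_translate[OF test_fun_smooth[OF assms], of "(axis \<kappa> 1, 0)" "(0, z)"]
        dderiv1_swap[OF test_fun_smooth[OF assms], of "(0, axis \<kappa> 1)"]
      by (simp add: case_prod_unfold minus_prod_def del: dderiv.simps)
    \<comment> \<open>The minus sign in the definition of \<open>dist_deriv\<close> cancels the one
      from moving the derivative to the other argument.\<close>
    then show ?thesis
      using integral_diagonal_deriv_swap[OF test_fun_swap[OF assms], of "axis \<kappa> 1" z]
      by (simp add: dist_deriv_def delta_def del: dderiv.simps)
  qed
  then show ?thesis
    unfolding string_dist'_def string_dist_def by simp
qed

lemma sum_eq_single:
  assumes "\<And>j. j \<noteq> i \<Longrightarrow> h j = 0" shows "(\<Sum>j\<in>(UNIV :: 'i::finite set). h j) = h i"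
  by (subst sum.remove[of _ i]) (auto simp: assms)

lemma mink_off_diagonal: "\<mu> \<noteq> \<nu> \<Longrightarrow> \<eta> \<mu> \<nu> = 0"
  by (simp add: mink_def)

lemma string_dist'_deriv_up:
  "string_dist' \<sigma> c \<nu> (dist_deriv_up \<kappa> T) \<phi> = of_real (\<eta> \<kappa> \<kappa>) * string_dist' \<sigma> c \<nu> (dist_deriv \<kappa> T) \<phi>"
proof -
  have *: "dist_deriv_up \<kappa> T = (\<lambda>\<phi>. of_real (\<eta> \<kappa> \<kappa>) * dist_deriv \<kappa> T \<phi>)"
    unfolding dist_deriv_up_def by (intro ext sum_eq_single) (simp add: mink_off_diagonal)
  show ?thesis
    unfolding string_dist'_def * by (simp add: set_lebesgue_integral_def flip: mult_scaleR_right)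
qed

text \<open>The pairing of \<phi> with the delta function of x + z - x'. At
  \<open>z = s *\<^sub>R e\<close> it is the integrand of the string integral of \<delta>.\<close>

definition shifted_delta :: "(pt \<times> pt \<Rightarrow> complex) \<Rightarrow> pt \<Rightarrow> complex" where
  "shifted_delta \<phi> z = (LINT x|lborel. \<phi> (x - z, x))"

lemma string_dist_delta:
  "string_dist \<sigma> c \<nu> delta \<phi> = (LINT e|\<sigma>. (c e * e$\<nu>) *\<^sub>R (LINT s:{0..}|lborel. shifted_delta \<phi> (s *\<^sub>R e)))"
  by (simp add: string_dist_def delta_def shifted_delta_def)

lemma string_dist_delta_cmult: "string_dist \<sigma> c \<nu> delta (\<lambda>p. z * \<phi> p) = z * string_dist \<sigma> c \<nu> delta \<phi>"
  by (simp add: string_dist_delta shifted_delta_def set_lebesgue_integral_def flip: mult_scaleR_right)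

lemma shifted_delta_add:
  "test_fun \<phi> \<Longrightarrow> test_fun \<psi> \<Longrightarrow> shifted_delta (\<lambda>p. \<phi> p + \<psi> p) z = shifted_delta \<phi> z + shifted_delta \<psi> z"
  using integrable_test_fun_diagonal by (simp add: shifted_delta_def)

text \<open>If \<open>z\<close> is longer than \<open>2 * r\<close>, then \<open>x\<close> and
  \<open>x - z\<close> cannot both lie in the ball of radius \<open>r\<close>, so the integrand
  vanishes. The uniform bound is the supremum of \<phi> times the volume of that ball.\<close>

lemma shifted_delta_bound:
  assumes "test_fun \<phi>"
  obtains r m where "r \<ge> 0" "m \<ge> 0" "\<And>z. shifted_delta \<phi> z \<noteq> 0 \<Longrightarrow> norm z \<le> r" "\<And>z. norm (shifted_delta \<phi> z) \<le> m"
proof -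
  obtain r m where r: "r \<ge> 0" "m \<ge> 0" "\<And>x y. \<phi> (x, y) \<noteq> 0 \<Longrightarrow> norm x \<le> r \<and> norm y \<le> r"
    "\<And>p. norm (\<phi> p) \<le> m"
    using test_fun_bounded_support[OF assms] by metis
  show ?thesis
  proof (rule that[of "2 * r" "m * measure lborel (cball (0::pt) r)"])
    show "norm z \<le> 2 * r" if nz: "shifted_delta \<phi> z \<noteq> 0" for z
    proof (rule ccontr)
      assume "\<not> norm z \<le> 2 * r"
      then have "\<phi> (x - z, x) = 0" for x
        using r(3)[of "x - z" x] norm_triangle_ineq4[of x "x - z"] by force
      with nz show False by (simp add: shifted_delta_def)
    qed
    have int: "integrable lborel (\<lambda>x. indicator (cball (0::pt) r) x * m)"
      by (intro integrable_mult_left impI integrable_real_indicator)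
        (auto simp: emeasure_lborel_cball_finite[unfolded infinity_ennreal_def])
    show "norm (shifted_delta \<phi> z) \<le> m * measure lborel (cball (0::pt) r)" for z
    proof -
      have "norm (shifted_delta \<phi> z) \<le> (LINT x|lborel. indicator (cball (0::pt) r) x * m)"
        unfolding shifted_delta_def
      proof (rule Bochner_Integration.integral_norm_bound_integral[OF integrable_test_fun_diagonal[OF assms] int])
        show "norm (\<phi> (x - z, x)) \<le> indicator (cball 0 r) x * m" for x
          using r(4)[of "(x - z, x)"] r(3)[of "x - z" x] by (cases "norm x \<le> r") auto
      qed
      then show ?thesis by (simp add: mult.commute)
    qed
  qed (use r in auto)
qed

lemma measurable_shifted_delta:
  assumes "test_fun \<phi>" shows "shifted_delta \<phi> \<in> borel_measurable borel"
proof -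
  have "(\<lambda>(z, x). \<phi> (x - z, x)) \<in> borel_measurable borel"
    unfolding case_prod_unfold
    by (intro borel_measurable_continuous_onI
        continuous_on_compose2[OF smooth_fun_continuous[OF test_fun_smooth[OF assms], of UNIV]] continuous_intros) auto
  then have "(\<lambda>(z, x). \<phi> (x - z, x)) \<in> borel_measurable (borel \<Otimes>\<^sub>M lborel)"
    by (simp only: borel_prod[symmetric] measurable_cong_sets[OF sets_pair_measure_cong[OF refl sets_lborel] refl])
  then show ?thesis
    unfolding shifted_delta_def by (rule lborel.borel_measurable_lebesgue_integral)
qed

text \<open>The squared Euclidean norm dominates minus the Minkowski square, which equals 1 here. So
  the parameter \<open>s\<close> never exceeds the Euclidean length of \<open>s *\<^sub>R e\<close>,
  uniformly in the unbounded set of directions.\<close>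

lemma spacelike_unit_norm: "e \<in> spacelike_unit \<Longrightarrow> norm e \<ge> 1"
proof -
  assume "e \<in> spacelike_unit"
  then have "(\<Sum>\<mu>\<in>UNIV. \<eta> \<mu> \<mu> * (e$\<mu>)^2) = - 1"
    by (simp add: spacelike_unit_def mink_def if_distrib[of "\<lambda>x. x * _"] power2_eq_square mult.assoc cong: if_cong)
  moreover have "(\<Sum>\<mu>\<in>UNIV. - \<eta> \<mu> \<mu> * (e$\<mu>)^2) \<le> (\<Sum>\<mu>\<in>UNIV. (e$\<mu>)^2)"
    by (intro sum_mono) (auto simp: mink_def)
  ultimately have "1 \<le> norm e ^ 2"
    by (simp add: norm_vec_def L2_set_def sum_negf sum_nonneg)
  then show ?thesis
    by (simp add: abs_le_square_iff[of 1 "norm e", simplified, symmetric])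
qed

lemma closed_spacelike_unit: "closed spacelike_unit"
  unfolding spacelike_unit_def by (intro closed_Collect_eq continuous_intros)

text \<open>Additivity needs integrability at two levels. Along a ray the integrand is bounded with
  bounded support in \<open>s\<close>; over the directions the ray integrals are uniformly bounded
  and weighted by a continuous \<open>c\<close> with compact support, on which \<sigma> is
  finite.\<close>

lemma string_dist_delta_add:
  assumes \<sigma>: "smearing \<sigma> c" and "test_fun \<phi>" "test_fun \<psi>"
  shows "string_dist \<sigma> c \<nu> delta (\<lambda>p. \<phi> p + \<psi> p) = string_dist \<sigma> c \<nu> delta \<phi> + string_dist \<sigma> c \<nu> delta \<psi>"
proof -
  have sets_\<sigma>: "sets \<sigma> = sets borel"
    using \<sigma> by (simp add: smearing_def)
  have spacelike: "AE e in \<sigma>. e \<in> spacelike_unit"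
    using \<sigma> closed_spacelike_unit
    by (intro AE_I[of _ _ "- spacelike_unit"]) (auto simp: smearing_def intro: borel_closed borel_open)
  define ray where "ray \<phi> e = (LINT s:{0..}|lborel. shifted_delta \<phi> (s *\<^sub>R e))" for \<phi> and e :: pt
  have ray_integrable: "set_integrable lborel {0..} (\<lambda>s. shifted_delta \<phi> (s *\<^sub>R e))"
    and ray_bound: "norm (ray \<phi> e) \<le> m * r"
    if \<phi>: "test_fun \<phi>" "e \<in> spacelike_unit" and b: "r \<ge> 0" "m \<ge> 0"
      "\<And>z. shifted_delta \<phi> z \<noteq> 0 \<Longrightarrow> norm z \<le> r" "\<And>z. norm (shifted_delta \<phi> z) \<le> m" for \<phi> e r m
  proof -
    \<comment> \<open>For \<open>s > r\<close> the point \<open>s *\<^sub>R e\<close> has length at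
      least \<open>s\<close>, because \<open>e\<close> has length at least 1, and so lies outside
      the support of \<open>shifted_delta\<close>.\<close>
    have bound: "norm (indicator {0..} s *\<^sub>R shifted_delta \<phi> (s *\<^sub>R e)) \<le> indicator {0..r} s * m" for s
    proof (cases "0 \<le> s \<and> s \<le> r")
      case False
      have "s * 1 \<le> s * norm e" if "s \<ge> 0"
        using that spacelike_unit_norm[OF \<phi>(2)] by (intro mult_left_mono)
      with False have "shifted_delta \<phi> (s *\<^sub>R e) = 0" if "s \<ge> 0"
        using b(3)[of "s *\<^sub>R e"] that by fastforce
      with False show ?thesis
        by (cases "s \<ge> 0") auto
    qed (use b(4)[of "s *\<^sub>R e"] in auto)
    have int: "integrable lborel (\<lambda>s. indicator {0..r} s * m)"
      using b(1) by (intro integrable_mult_left impI integrable_real_indicator) auto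
    have meas: "(\<lambda>s. indicator {0..} s *\<^sub>R shifted_delta \<phi> (s *\<^sub>R e)) \<in> borel_measurable lborel"
      using measurable_shifted_delta[OF \<phi>(1)] by measurable
    have int': "integrable lborel (\<lambda>s. indicator {0..} s *\<^sub>R shifted_delta \<phi> (s *\<^sub>R e))"
      by (intro Bochner_Integration.integrable_bound[OF int meas] AE_I2 order_trans[OF bound]) simp
    then show "set_integrable lborel {0..} (\<lambda>s. shifted_delta \<phi> (s *\<^sub>R e))"
      by (simp add: set_integrable_def)
    have "norm (ray \<phi> e) \<le> (LINT s|lborel. indicator {0..r} s * m)"
      unfolding ray_def set_lebesgue_integral_def
      by (rule Bochner_Integration.integral_norm_bound_integral[OF int' int bound])
    then show "norm (ray \<phi> e) \<le> m * r"
      using b(1) by (simp add: mult.commute)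
  qed
  have int: "integrable \<sigma> (\<lambda>e. (c e * e$\<nu>) *\<^sub>R ray \<phi> e)" if \<phi>: "test_fun \<phi>" for \<phi>
  proof -
    obtain r m where b: "r \<ge> 0" "m \<ge> 0" "\<And>z. shifted_delta \<phi> z \<noteq> 0 \<Longrightarrow> norm z \<le> r"
      "\<And>z. norm (shifted_delta \<phi> z) \<le> m"
      using shifted_delta_bound[OF \<phi>] by metis
    obtain K where K: "compact K" "\<And>e. e \<notin> K \<Longrightarrow> c e = 0" "emeasure \<sigma> K < \<infinity>" "continuous_on UNIV c"
      using \<sigma> unfolding smearing_def by metis
    have cont: "continuous_on UNIV (\<lambda>e. c e * e$\<nu>)"
      using K(4) by (intro continuous_intros)
    have "compact ((\<lambda>e. c e * e$\<nu>) ` K)"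
      using K(1) cont by (intro compact_continuous_image) (auto intro: continuous_on_subset)
    then obtain B where "\<forall>y\<in>(\<lambda>e. c e * e$\<nu>) ` K. norm y \<le> B"
      using compact_imp_bounded bounded_iff by blast
    then have B: "\<bar>c e * e$\<nu>\<bar> \<le> B" if "e \<in> K" for e
      using that by auto
    have "(\<lambda>(e, s). indicator {0..} s *\<^sub>R shifted_delta \<phi> (s *\<^sub>R e)) \<in> borel_measurable (borel \<Otimes>\<^sub>M lborel)"
      using measurable_shifted_delta[OF \<phi>] unfolding case_prod_unfold by measurable
    then have "ray \<phi> \<in> borel_measurable borel"
      unfolding ray_def set_lebesgue_integral_def by (rule lborel.borel_measurable_lebesgue_integral)
    then have meas: "(\<lambda>e. (c e * e$\<nu>) *\<^sub>R ray \<phi> e) \<in> borel_measurable \<sigma>"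
      using borel_measurable_continuous_onI[OF cont]
      by (simp add: measurable_cong_sets[OF sets_\<sigma> refl])
    show ?thesis
    \<comment> \<open>\<open>B\<close> bounds the weight \<open>c e * e$\<nu>\<close> on the compact
      \<open>K\<close>, and \<open>m * r\<close> bounds the ray integral for spacelike unit
      directions.\<close>
    proof (rule integrableI_bounded_set[where A = K and B = "B * (m * r)"])
      show "K \<in> sets \<sigma>"
        using K(1) sets_\<sigma> by (simp add: borel_compact)
      show "AE e in \<sigma>. e \<in> K \<longrightarrow> norm ((c e * e$\<nu>) *\<^sub>R ray \<phi> e) \<le> B * (m * r)"
        using spacelike
      proof eventually_elim
        case (elim e)
        show ?case
          unfolding norm_scaleR real_norm_def using ray_bound[OF \<phi> elim b] order_trans[OF abs_ge_zero B]
          by (intro impI mult_mono B norm_ge_zero) auto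
      qed
    qed (use meas K in auto)
  qed
  have ray_add: "ray (\<lambda>p. \<phi> p + \<psi> p) e = ray \<phi> e + ray \<psi> e" if "e \<in> spacelike_unit" for e
  proof -
    have "set_integrable lborel {0..} (\<lambda>s. shifted_delta \<phi> (s *\<^sub>R e))" if "test_fun \<phi>" for \<phi>
      using shifted_delta_bound[OF that] ray_integrable[OF that \<open>e \<in> spacelike_unit\<close>] by metis
    then show ?thesis
      unfolding ray_def using assms by (simp add: shifted_delta_add set_integral_add)
  qed
  \<comment> \<open>Rays are controlled only for spacelike unit directions, so the integrands agree
    only almost everywhere.\<close>
  have "AE e in \<sigma>. (c e * e$\<nu>) *\<^sub>R ray (\<lambda>p. \<phi> p + \<psi> p) e = (c e * e$\<nu>) *\<^sub>R ray \<phi> e + (c e * e$\<nu>) *\<^sub>R ray \<psi> e"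
    using spacelike by eventually_elim (simp only: ray_add scaleR_add_right)
  then have "(LINT e|\<sigma>. (c e * e$\<nu>) *\<^sub>R ray (\<lambda>p. \<phi> p + \<psi> p) e) =
    (LINT e|\<sigma>. (c e * e$\<nu>) *\<^sub>R ray \<phi> e + (c e * e$\<nu>) *\<^sub>R ray \<psi> e)"
    using int assms by (intro integral_cong_AE borel_measurable_integrable Bochner_Integration.integrable_add) (auto intro: test_fun_add)
  then show ?thesis
    unfolding string_dist_delta ray_def[symmetric]
    using int assms by simp
qed

section \<open>The Lie algebra\<close>

text \<open>The factor \<open>\<i>\<close> in \<open>icomm\<close> and the one in the structure
  constants multiply to -1, which leaves real coefficients.\<close>

lemma icomm_expand: "icomm f X Y c = (\<Sum>a\<in>UNIV. \<Sum>b\<in>UNIV. const (- of_real (f a b c)) * (X a * Y b))"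
proof -
  have "const \<i> * (const (\<i> * of_real (f a b c)) * X a * Y b) = const (- of_real (f a b c)) * (X a * Y b)" for a b
  proof -
    have "const \<i> * (const (\<i> * of_real (f a b c)) * X a * Y b) = const (\<i> * (\<i> * of_real (f a b c))) * (X a * Y b)"
      unfolding const_mult by (simp only: mult.assoc)
    then show ?thesis by (simp flip: mult.assoc)
  qed
  then show ?thesis
    by (simp add: icomm_def comm_def sum_distrib_left)
qed

lemma icomm_add_left: "icomm f (\<lambda>a. X a + X' a) Y c = icomm f X Y c + icomm f X' Y c"
  by (simp add: icomm_expand distrib_left distrib_right sum.distrib)

lemma icomm_add_right: "icomm f X (\<lambda>a. Y a + Y' a) c = icomm f X Y c + icomm f X Y' c"
  by (simp add: icomm_expand distrib_left distrib_right sum.distrib)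

lemma icomm_mult_left: "icomm f (\<lambda>a. P * X a) Y c = P * icomm f X Y c"
  by (simp add: icomm_expand sum_distrib_left mult_ac)

lemma icomm_mult_right: "icomm f X (\<lambda>a. P * Y a) c = P * icomm f X Y c"
  by (simp add: icomm_expand sum_distrib_left mult_ac)

lemma icomm_minus_left: "icomm f (\<lambda>a. - X a) Y c = - icomm f X Y c"
  using icomm_mult_left[of f "- 1" X Y c] by simp

lemma icomm_minus_right: "icomm f X (\<lambda>a. - Y a) c = - icomm f X Y c"
  using icomm_mult_right[of f X "- 1" Y c] by simp

lemma icomm_diff_right: "icomm f X (\<lambda>a. Y a - Y' a) c = icomm f X Y c - icomm f X Y' c"
  using icomm_add_right[of f X Y "\<lambda>a. - Y' a" c] by (simp add: icomm_minus_right)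

lemma icomm_sum_left: "icomm f (\<lambda>a. \<Sum>i\<in>I. X i a) Y c = (\<Sum>i\<in>I. icomm f (X i) Y c)"
proof (induction I rule: infinite_finite_induct)
  case (insert i I)
  then show ?case by (simp add: icomm_add_left)
qed (simp_all add: icomm_expand)

lemma icomm_sum_right: "icomm f X (\<lambda>a. \<Sum>i\<in>I. Y i a) c = (\<Sum>i\<in>I. icomm f X (Y i) c)"
proof (induction I rule: infinite_finite_induct)
  case (insert i I)
  then show ?case by (simp add: icomm_add_right)
qed (simp_all add: icomm_expand)

lemma inn_commute: "inn X Y = inn Y X"
  by (simp add: inn_def mult.commute)

lemma inn_add_right: "inn X (\<lambda>a. Y a + Y' a) = inn X Y + inn X Y'"
  by (simp add: inn_def distrib_left sum.distrib)

lemma inn_add_left: "inn (\<lambda>a. X a + X' a) Y = inn X Y + inn X' Y"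
  by (simp add: inn_def distrib_right sum.distrib)

lemma inn_mult_right: "inn X (\<lambda>a. P * Y a) = P * inn X Y"
  by (simp add: inn_def sum_distrib_left mult_ac)

lemma inn_mult_left: "inn (\<lambda>a. P * X a) Y = P * inn X Y"
  by (simp add: inn_def sum_distrib_left mult_ac)

lemma inn_minus_right: "inn X (\<lambda>a. - Y a) = - inn X Y"
  using inn_mult_right[of X "- 1" Y] by simp

lemma inn_minus_left: "inn (\<lambda>a. - X a) Y = - inn X Y"
  using inn_mult_left[of "- 1" X Y] by simp

lemma inn_diff_left: "inn (\<lambda>a. X a - X' a) Y = inn X Y - inn X' Y"
  by (simp add: inn_def left_diff_distrib sum_subtractf)

lemma inn_sum_right: "inn X (\<lambda>a. \<Sum>i\<in>I. Y i a) = (\<Sum>i\<in>I. inn X (Y i))"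
proof (induction I rule: infinite_finite_induct)
  case (insert i I)
  then show ?case by (simp add: inn_add_right)
qed (simp_all add: inn_def)

lemma sum_rotate:
  "(\<Sum>b\<in>B. \<Sum>c\<in>C. \<Sum>a\<in>A. g a b c) = (\<Sum>a\<in>A. \<Sum>b\<in>B. \<Sum>c\<in>C. g a b c)"
proof -
  have "(\<Sum>b\<in>B. \<Sum>c\<in>C. \<Sum>a\<in>A. g a b c) = (\<Sum>b\<in>B. \<Sum>a\<in>A. \<Sum>c\<in>C. g a b c)"
    by (intro sum.cong refl sum.swap)
  then show ?thesis
    using sum.swap[of "\<lambda>b a. \<Sum>c\<in>C. g a b c" A B] by simp
qed

locale lie_structure =
  fixes f :: "'a::finite \<Rightarrow> 'a \<Rightarrow> 'a \<Rightarrow> real"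
  assumes simple: "simple_lie_algebra f"
begin

lemma f_swap12: "f b a c = - f a b c"
  using simple[unfolded simple_lie_algebra_def, THEN conjunct1] by (elim allE)

lemma f_swap23: "f a c b = - f a b c"
  using simple[unfolded simple_lie_algebra_def, THEN conjunct2, THEN conjunct1] by (elim allE)

lemma f_cyclic: "f b c a = f a b c"
  by (metis f_swap12 f_swap23 minus_minus)

text \<open>Component \<open>d\<close> of the Jacobi identity evaluated on the basis vectors
  \<open>axis a 1\<close>, \<open>axis b 1\<close>, \<open>axis c 1\<close>; the common factor
  \<open>\<i> * \<i>\<close> drops out.\<close>

lemma f_jacobi: "(\<Sum>e\<in>UNIV. f a e d * f b c e + f b e d * f c a e + f c e d * f a b e) = 0"
proof -
  have br: "lie_bracket f (axis a 1) Y = (\<chi> c. \<Sum>b\<in>UNIV. \<i> * of_real (f a b c) * Y$b)" for a Y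
  proof (unfold lie_bracket_def, rule vec_lambda_unique[THEN iffD1, THEN sym], intro allI)
    fix c
    show "(\<chi> c. \<Sum>a'\<in>UNIV. \<Sum>b\<in>UNIV. \<i> * of_real (f a' b c) * axis a 1 $ a' * Y$b) $ c =
      (\<Sum>b\<in>UNIV. \<i> * of_real (f a b c) * Y$b)"
      by (simp, rule trans, rule sum_eq_single[of a]) (auto simp: axis_def)
  qed
  have br2: "lie_bracket f (axis b 1) (axis c 1) $ e = \<i> * of_real (f b c e)" for b c e
    by (simp add: br, rule trans, rule sum_eq_single[of c]) (auto simp: axis_def)
  have br3: "lie_bracket f (axis a 1) (lie_bracket f (axis b 1) (axis c 1)) $ d =
    - of_real (\<Sum>e\<in>UNIV. f a e d * f b c e)" for a b c
  proof -
    have "\<i> * of_real (f a e d) * (\<i> * of_real (f b c e)) = - (of_real (f a e d * f b c e) :: complex)" for e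
    proof -
      have "\<i> * of_real (f a e d) * (\<i> * of_real (f b c e)) = (\<i> * \<i>) * (of_real (f a e d) * of_real (f b c e) :: complex)"
        by (simp only: mult_ac)
      then show ?thesis
        by (simp only: i_squared of_real_mult mult_minus_left mult_1_left)
    qed
    then show ?thesis
      by (simp only: br[of a "lie_bracket f (axis b 1) (axis c 1)"] vec_lambda_beta br2 of_real_sum sum_negf)
  qed
  have "lie_bracket f (axis a 1) (lie_bracket f (axis b 1) (axis c 1))
    + lie_bracket f (axis b 1) (lie_bracket f (axis c 1) (axis a 1))
    + lie_bracket f (axis c 1) (lie_bracket f (axis a 1) (axis b 1)) = 0"
    using simple[unfolded simple_lie_algebra_def, THEN conjunct2, THEN conjunct2, THEN conjunct1]
    by (elim allE)
  then have "(lie_bracket f (axis a 1) (lie_bracket f (axis b 1) (axis c 1))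
    + lie_bracket f (axis b 1) (lie_bracket f (axis c 1) (axis a 1))
    + lie_bracket f (axis c 1) (lie_bracket f (axis a 1) (axis b 1))) $ d = 0"
    by simp
  then have "of_real (- (\<Sum>e\<in>UNIV. f a e d * f b c e) + - (\<Sum>e\<in>UNIV. f b e d * f c a e)
      + - (\<Sum>e\<in>UNIV. f c e d * f a b e)) = (0::complex)"
    by (simp only: br3 vector_add_component zero_index of_real_add of_real_minus)
  then show ?thesis
    unfolding of_real_eq_0_iff sum.distrib by linarith
qed

lemma icomm_antisym: "icomm f X Y c = - icomm f Y X c"
proof -
  have "icomm f X Y c = (\<Sum>b\<in>UNIV. \<Sum>a\<in>UNIV. const (- of_real (f a b c)) * (X a * Y b))"
    unfolding icomm_expand by (rule sum.swap)
  also have "\<dots> = - icomm f Y X c"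
  proof -
    have "const (- of_real (f a b c)) * (X a * Y b) = - (const (- of_real (f b a c)) * (Y b * X a))" for a b
      by (subst f_swap12[of a b c]) (simp add: const_minus mult.commute)
    then show ?thesis
      by (simp only: icomm_expand sum_negf)
  qed
  finally show ?thesis .
qed

text \<open>Invariance of the inner product: in components it is the cyclic symmetry of
  \<open>f\<close>.\<close>

lemma inn_icomm: "inn (icomm f X Y) Z = inn X (icomm f Y Z)"
proof -
  have "inn (icomm f X Y) Z = (\<Sum>c\<in>UNIV. \<Sum>a\<in>UNIV. \<Sum>b\<in>UNIV. const (- of_real (f a b c)) * (X a * Y b * Z c))"
    by (simp add: inn_def icomm_expand sum_distrib_right mult.assoc)
  also have "\<dots> = (\<Sum>a\<in>UNIV. \<Sum>c\<in>UNIV. \<Sum>b\<in>UNIV. const (- of_real (f a b c)) * (X a * Y b * Z c))"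
    by (rule sum.swap)
  also have "\<dots> = (\<Sum>a\<in>UNIV. \<Sum>b\<in>UNIV. \<Sum>c\<in>UNIV. const (- of_real (f b c a)) * (X a * Y b * Z c))"
  proof -
    have "const (- of_real (f a b c)) * (X a * Y b * Z c) = const (- of_real (f b c a)) * (X a * Y b * Z c)" for a b c
      by (subst f_cyclic) (rule refl)
    then have "(\<Sum>a\<in>UNIV. \<Sum>b\<in>UNIV. \<Sum>c\<in>UNIV. const (- of_real (f a b c)) * (X a * Y b * Z c)) =
      (\<Sum>a\<in>UNIV. \<Sum>b\<in>UNIV. \<Sum>c\<in>UNIV. const (- of_real (f b c a)) * (X a * Y b * Z c))"
      by (intro sum.cong refl)
    moreover have "(\<Sum>a\<in>UNIV. \<Sum>c\<in>UNIV. \<Sum>b\<in>UNIV. const (- of_real (f a b c)) * (X a * Y b * Z c)) =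
      (\<Sum>a\<in>UNIV. \<Sum>b\<in>UNIV. \<Sum>c\<in>UNIV. const (- of_real (f a b c)) * (X a * Y b * Z c))"
      by (intro sum.cong refl sum.swap)
    ultimately show ?thesis by simp
  qed
  also have "\<dots> = inn X (icomm f Y Z)"
    by (simp add: inn_def icomm_expand sum_distrib_left mult_ac)
  finally show ?thesis .
qed

text \<open>A normal form in which all Lie algebra data sit in one scalar and the fields appear as
  an ordinary product, so that nested brackets of the same fields become comparable.\<close>

lemma icomm_icomm:
  "icomm f X (icomm f Y Z) d =
    (\<Sum>a\<in>UNIV. \<Sum>b\<in>UNIV. \<Sum>c\<in>UNIV. const (of_real (\<Sum>e\<in>UNIV. f a e d * f b c e)) * (X a * Y b * Z c))"
proof -
  have "icomm f X (icomm f Y Z) d = (\<Sum>a\<in>UNIV. \<Sum>e\<in>UNIV. \<Sum>b\<in>UNIV. \<Sum>c\<in>UNIV.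
      const (of_real (f a e d * f b c e)) * (X a * Y b * Z c))"
    unfolding icomm_expand[of f X] icomm_expand[of f Y]
    by (simp add: sum_distrib_left const_mult const_minus mult_ac)
  also have "\<dots> = (\<Sum>a\<in>UNIV. \<Sum>b\<in>UNIV. \<Sum>c\<in>UNIV. \<Sum>e\<in>UNIV.
      const (of_real (f a e d * f b c e)) * (X a * Y b * Z c))"
    by (intro sum.cong refl sum_rotate[symmetric])
  finally show ?thesis
    by (simp add: const_sum sum_distrib_right)
qed

text \<open>Wick components commute, so the three normal forms can be relabelled to the same product
  \<open>X a * Y b * Z c\<close>, with coefficients that add up to zero by
  \<open>f_jacobi\<close>.\<close>

lemma icomm_jacobi:
  "icomm f X (icomm f Y Z) d + icomm f Y (icomm f Z X) d + icomm f Z (icomm f X Y) d = 0"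
proof -
  have Y: "icomm f Y (icomm f Z X) d = (\<Sum>a\<in>UNIV. \<Sum>b\<in>UNIV. \<Sum>c\<in>UNIV.
      const (of_real (\<Sum>e\<in>UNIV. f b e d * f c a e)) * (X a * Y b * Z c))"
    unfolding icomm_icomm
    by (subst sum_rotate) (simp add: mult_ac)
  have Z: "icomm f Z (icomm f X Y) d = (\<Sum>a\<in>UNIV. \<Sum>b\<in>UNIV. \<Sum>c\<in>UNIV.
      const (of_real (\<Sum>e\<in>UNIV. f c e d * f a b e)) * (X a * Y b * Z c))"
    unfolding icomm_icomm
    by (subst sum_rotate, subst sum_rotate) (simp add: mult_ac)
  have zero: "const (of_real (\<Sum>e\<in>UNIV. f a e d * f b c e)) * T + const (of_real (\<Sum>e\<in>UNIV. f b e d * f c a e)) * T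
      + const (of_real (\<Sum>e\<in>UNIV. f c e d * f a b e)) * T = 0" for a b c and T :: "'a wick"
    using f_jacobi[of a d b c]
    by (simp only: distrib_right[symmetric] const_add[symmetric] of_real_add[symmetric] sum.distrib) simp
  show ?thesis
    by (subst icomm_icomm[of X Y Z d], subst Y, subst Z) (simp only: sum.distrib[symmetric] zero sum.neutral_const)
qed

end

section \<open>Wick polynomials modulo the field relations\<close>

text \<open>The metric is diagonal with entries 1 and -1, so lowering an index is multiplication by
  a sign that squares to 1. All later computations use upper-index fields with explicit
  signs.\<close>

abbreviation metric_sign :: "4 \<Rightarrow> 'm multiset \<Rightarrow>\<^sub>0 complex" where
  "metric_sign \<mu> \<equiv> const (of_real (\<eta> \<mu> \<mu>))"

lemma mink_diag_square: "\<eta> \<mu> \<mu> * \<eta> \<mu> \<mu> = 1"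
  by (simp add: mink_def)

lemma metric_sign_square: "metric_sign \<mu> * metric_sign \<mu> = 1"
  by (simp flip: const_mult of_real_mult add: mink_diag_square)

lemma metric_sign_cancel: "metric_sign \<mu> * (metric_sign \<mu> * P) = P"
  by (simp add: metric_sign_square flip: mult.assoc)

lemma A_dn_eq: "A_dn \<mu> a = metric_sign \<mu> * A_up \<mu> a"
  unfolding A_dn_def by (rule sum_eq_single) (simp add: mink_off_diagonal)

lemma A_up_eq: "A_up \<mu> a = metric_sign \<mu> * A_dn \<mu> a"
  by (simp add: A_dn_eq metric_sign_cancel)

lemma F_dn_eq: "F_dn \<mu> \<nu> a = metric_sign \<mu> * (metric_sign \<nu> * F_up \<mu> \<nu> a)"
proof -
  have "F_dn \<mu> \<nu> a = (\<Sum>\<tau>\<in>UNIV. const (of_real (\<eta> \<mu> \<mu> * \<eta> \<nu> \<tau>)) * F_up \<mu> \<tau> a)"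
    unfolding F_dn_def by (rule sum_eq_single) (simp add: mink_off_diagonal)
  also have "\<dots> = const (of_real (\<eta> \<mu> \<mu> * \<eta> \<nu> \<nu>)) * F_up \<mu> \<nu> a"
    by (rule sum_eq_single) (simp add: mink_off_diagonal)
  finally show ?thesis
    by (simp add: const_mult mult.assoc)
qed

text \<open>Covers both \<open>wick_deriv\<close> and the string variation, so that the Leibniz
  rules for brackets and inner products are proved once.\<close>

definition wick_derivation :: "('a wick \<Rightarrow> 'a wick) \<Rightarrow> bool" where
  "wick_derivation D \<longleftrightarrow> (\<forall>P Q. D (P + Q) = D P + D Q) \<and> (\<forall>z. D (const z) = 0) \<and>
     (\<forall>P Q. D (P * Q) = D P * Q + P * D Q)"

lemma wick_derivation_wick_deriv: "wick_derivation (wick_deriv \<mu>)"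
  by (simp add: wick_derivation_def wick_deriv_add wick_deriv_mult)

text \<open>The Leibniz rule on \<open>1 * 1\<close> forces \<open>D 1 = 0\<close>; homogeneity then
  annihilates all constants.\<close>

lemma wick_derivation_string_variation:
  assumes "string_variation D" shows "wick_derivation D"
proof -
  have "D 1 = D (1 * 1)" by simp
  also have "\<dots> = D 1 * 1 + 1 * D 1"
    using assms unfolding string_variation_def by blast
  finally have "D 1 = 0" by simp
  moreover have "D (const z * 1) = const z * D 1" for z
    using assms unfolding string_variation_def by blast
  ultimately have "D (const z) = 0" for z by simp
  then show ?thesis
    using assms unfolding string_variation_def wick_derivation_def by blast
qed

context
  fixes D :: "'a::finite wick \<Rightarrow> 'a wick"
  assumes D: "wick_derivation D"
begin

lemma derivation_add: "D (P + Q) = D P + D Q"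
  and derivation_const: "D (const z) = 0"
  and derivation_mult: "D (P * Q) = D P * Q + P * D Q"
  using D by (simp_all add: wick_derivation_def)

lemma derivation_const_mult: "D (const z * P) = const z * D P"
  by (simp add: derivation_mult derivation_const)

lemma derivation_sum: "D (\<Sum>i\<in>J. h i) = (\<Sum>i\<in>J. D (h i))"
  using derivation_const[of 0]
  by (induction J rule: infinite_finite_induct) (simp_all add: derivation_add)

lemma derivation_icomm:
  "D (icomm f X Y c) = icomm f (\<lambda>a. D (X a)) Y c + icomm f X (\<lambda>a. D (Y a)) c"
  by (simp add: icomm_expand derivation_sum derivation_const derivation_mult distrib_left sum.distrib)

lemma derivation_inn:
  "D (inn X Y) = inn (\<lambda>a. D (X a)) Y + inn X (\<lambda>a. D (Y a))"
  by (simp add: inn_def derivation_sum derivation_mult sum.distrib)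

end

lemmas wick_deriv_const_mult = derivation_const_mult[OF wick_derivation_wick_deriv]
  and wick_deriv_sum = derivation_sum[OF wick_derivation_wick_deriv]
  and wick_deriv_icomm = derivation_icomm[OF wick_derivation_wick_deriv]
  and wick_deriv_inn = derivation_inn[OF wick_derivation_wick_deriv]

text \<open>The local identities hold modulo any ideal containing the relations. Closure under
  \<open>wick_deriv\<close> is not assumed, so derivatives are always expanded by Leibniz before a
  relation is applied.\<close>

locale field_ideal = lie_structure f for f :: "'a::finite \<Rightarrow> 'a \<Rightarrow> 'a \<Rightarrow> real" +
  fixes I :: "'a wick set"
  assumes I_0: "0 \<in> I" and I_add: "P \<in> I \<Longrightarrow> Q \<in> I \<Longrightarrow> P + Q \<in> I" and I_mult: "P \<in> I \<Longrightarrow> R * P \<in> I"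
    and relations: "field_relations \<subseteq> I"
begin

definition equiv_mod :: "'a wick \<Rightarrow> 'a wick \<Rightarrow> bool" (infix "\<doteq>" 50) where
  "P \<doteq> Q \<longleftrightarrow> P - Q \<in> I"

lemma equiv_refl [simp]: "P \<doteq> P"
  by (simp add: equiv_mod_def I_0)

lemma equiv_sym: "P \<doteq> Q \<Longrightarrow> Q \<doteq> P"
  using I_mult[of "P - Q" "- 1"] by (simp add: equiv_mod_def)

lemma equiv_trans [trans]: "P \<doteq> Q \<Longrightarrow> Q \<doteq> R \<Longrightarrow> P \<doteq> R"
  using I_add[of "P - Q" "Q - R"] by (simp add: equiv_mod_def)

lemma equiv_add: "P \<doteq> P' \<Longrightarrow> Q \<doteq> Q' \<Longrightarrow> P + Q \<doteq> P' + Q'"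
  using I_add[of "P - P'" "Q - Q'"] by (simp add: equiv_mod_def algebra_simps)

lemma equiv_mult: "P \<doteq> P' \<Longrightarrow> R * P \<doteq> R * P'"
  using I_mult[of "P - P'" R] by (simp add: equiv_mod_def algebra_simps)

lemma equiv_mult_right: "P \<doteq> P' \<Longrightarrow> P * R \<doteq> P' * R"
  using equiv_mult by (simp add: mult.commute)

lemma equiv_minus: "P \<doteq> P' \<Longrightarrow> - P \<doteq> - P'"
  using equiv_mult[of P P' "- 1"] by simp

lemma equiv_diff: "P \<doteq> P' \<Longrightarrow> Q \<doteq> Q' \<Longrightarrow> P - Q \<doteq> P' - Q'"
  using equiv_add[OF _ equiv_minus] by simp

lemma equiv_sum: "(\<And>i. i \<in> J \<Longrightarrow> h i \<doteq> k i) \<Longrightarrow> (\<Sum>i\<in>J. h i) \<doteq> (\<Sum>i\<in>J. k i)"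
  by (induction J rule: infinite_finite_induct) (auto intro: equiv_add)

lemma equiv_icomm_left: "(\<And>a. X a \<doteq> X' a) \<Longrightarrow> icomm f X Y c \<doteq> icomm f X' Y c"
  unfolding icomm_expand by (intro equiv_sum equiv_mult equiv_mult_right)

lemma equiv_icomm_right: "(\<And>a. Y a \<doteq> Y' a) \<Longrightarrow> icomm f X Y c \<doteq> icomm f X Y' c"
  unfolding icomm_expand by (intro equiv_sum equiv_mult)

lemma equiv_inn_right: "(\<And>a. Y a \<doteq> Y' a) \<Longrightarrow> inn X Y \<doteq> inn X Y'"
  unfolding inn_def by (intro equiv_sum equiv_mult)

lemma equiv_inn_left: "(\<And>a. X a \<doteq> X' a) \<Longrightarrow> inn X Y \<doteq> inn X' Y"
  unfolding inn_def by (intro equiv_sum equiv_mult_right)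

lemma equiv_half: "P + P \<doteq> Q + Q \<Longrightarrow> P \<doteq> Q"
proof -
  have half: "const (1/2) * (R + R) = R" for R :: "'a wick"
  proof -
    have "const (1/2) * (R + R) = (const (1/2) + const (1/2)) * R"
      by (simp only: distrib_left distrib_right)
    also have "\<dots> = const (1/2 + 1/2) * R"
      by (simp only: const_add)
    finally show ?thesis by simp
  qed
  show "P + P \<doteq> Q + Q \<Longrightarrow> P \<doteq> Q"
    using equiv_mult[of "P + P" "Q + Q" "const (1/2)"] by (simp only: half)
qed

text \<open>The relations are stated for lower indices; multiplying by the two signs, which stays in
  the ideal, raises them.\<close>

lemma F_up_antisym: "F_up \<mu> \<nu> a \<doteq> - F_up \<nu> \<mu> a"
proof -
  have "F_dn \<mu> \<nu> a + F_dn \<nu> \<mu> a \<in> field_relations"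
    unfolding field_relations_def by (rule UnI1, rule UnI1, rule UnI1, rule CollectI, (rule exI)+, rule conjI, rule refl, rule TrueI)
  then have "F_dn \<mu> \<nu> a + F_dn \<nu> \<mu> a \<in> I"
    using relations by (rule subsetD[rotated])
  then have "metric_sign \<mu> * (metric_sign \<nu> * (F_dn \<mu> \<nu> a + F_dn \<nu> \<mu> a)) \<in> I"
    by (intro I_mult)
  moreover have "metric_sign \<mu> * (metric_sign \<nu> * (F_dn \<mu> \<nu> a + F_dn \<nu> \<mu> a)) = F_up \<mu> \<nu> a + F_up \<nu> \<mu> a"
    by (simp add: F_dn_eq distrib_left mult.left_commute[of "metric_sign \<nu>" "metric_sign \<mu>"] metric_sign_cancel)
  ultimately show ?thesis
    by (simp add: equiv_mod_def)
qed

lemma F_up_div: "(\<Sum>\<mu>\<in>UNIV. wick_deriv \<mu> (F_up \<mu> \<nu> a)) \<doteq> 0"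
proof -
  have "(\<Sum>\<mu>\<in>UNIV. \<Sum>\<rho>\<in>UNIV. const (of_real (\<eta> \<mu> \<rho>)) * wick_deriv \<rho> (F_dn \<mu> \<nu> a)) \<in> I"
    using relations unfolding field_relations_def by blast
  moreover have "(\<Sum>\<rho>\<in>UNIV. const (of_real (\<eta> \<mu> \<rho>)) * wick_deriv \<rho> (F_dn \<mu> \<nu> a)) =
    metric_sign \<nu> * wick_deriv \<mu> (F_up \<mu> \<nu> a)" for \<mu>
    by (subst sum_eq_single[of \<mu>])
      (simp_all add: mink_off_diagonal F_dn_eq wick_deriv_const_mult metric_sign_cancel)
  ultimately have "metric_sign \<nu> * ((\<Sum>\<mu>\<in>UNIV. metric_sign \<nu> * wick_deriv \<mu> (F_up \<mu> \<nu> a))) \<in> I"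
    by (intro I_mult) simp
  then show ?thesis
    by (simp add: equiv_mod_def metric_sign_cancel flip: sum_distrib_left)
qed

lemma A_up_div: "(\<Sum>\<mu>\<in>UNIV. wick_deriv \<mu> (A_up \<mu> a)) \<doteq> 0"
proof -
  have "(\<Sum>\<mu>\<in>UNIV. \<Sum>\<rho>\<in>UNIV. const (of_real (\<eta> \<mu> \<rho>)) * wick_deriv \<rho> (A_dn \<mu> a)) \<in> I"
    using relations unfolding field_relations_def by blast
  moreover have "(\<Sum>\<rho>\<in>UNIV. const (of_real (\<eta> \<mu> \<rho>)) * wick_deriv \<rho> (A_dn \<mu> a)) = wick_deriv \<mu> (A_up \<mu> a)" for \<mu>
    by (subst sum_eq_single[of \<mu>])
      (simp_all add: mink_off_diagonal A_dn_eq wick_deriv_const_mult metric_sign_cancel)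
  ultimately show ?thesis
    by (simp add: equiv_mod_def)
qed

lemma curl_A_up:
  "metric_sign \<mu> * wick_deriv \<mu> (A_up \<nu> a) - metric_sign \<nu> * wick_deriv \<nu> (A_up \<mu> a) \<doteq> F_up \<mu> \<nu> a"
proof -
  have "wick_deriv \<mu> (A_dn \<nu> a) - wick_deriv \<nu> (A_dn \<mu> a) - F_dn \<mu> \<nu> a \<in> I"
    using relations unfolding field_relations_def by blast
  then have "metric_sign \<mu> * (metric_sign \<nu> * (wick_deriv \<mu> (A_dn \<nu> a) - wick_deriv \<nu> (A_dn \<mu> a) - F_dn \<mu> \<nu> a)) \<in> I"
    by (intro I_mult)
  then show ?thesis
    by (simp add: equiv_mod_def F_dn_eq A_dn_eq wick_deriv_const_mult right_diff_distrib
        mult.left_commute[of "metric_sign \<nu>" "metric_sign \<mu>"] metric_sign_cancel)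
qed

lemma double_sum_symmetrize:
  "(\<Sum>\<kappa>\<in>S. \<Sum>\<rho>\<in>S. h \<kappa> \<rho>) + (\<Sum>\<kappa>\<in>S. \<Sum>\<rho>\<in>S. h \<kappa> \<rho>) = (\<Sum>\<kappa>\<in>S. \<Sum>\<rho>\<in>S. h \<kappa> \<rho> + h \<rho> \<kappa> :: 'a wick)"
  using sum.swap[of h S S] by (simp add: sum.distrib)

lemma icomm_antisym_fun: "icomm f X Y = (\<lambda>c. - icomm f Y X c)"
  by (rule ext) (rule icomm_antisym)

lemma inn_antisym_left: "inn (icomm f X Y) Z = - inn (icomm f Y X) Z"
  by (simp only: icomm_antisym_fun[of X Y] inn_minus_left)

lemma inn_antisym_right: "inn Z (icomm f X Y) = - inn Z (icomm f Y X)"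
  by (simp only: icomm_antisym_fun[of X Y] inn_minus_right)

text \<open>Adding the terms for (\<kappa>, \<rho>) and (\<rho>, \<kappa>) and using the
  antisymmetry of F gives two of the three double brackets of the Jacobi identity for
  \<open>A_up \<kappa>\<close>, \<open>A_up \<rho>\<close> and \<open>F_up \<kappa> \<rho>\<close>.
  The third, with a minus sign, is the right-hand side after invariance.\<close>

lemma commutator_F_sum:
  fixes X :: "'a \<Rightarrow> 'a wick"
  defines "N \<equiv> \<Sum>\<kappa>\<in>UNIV. \<Sum>\<rho>\<in>UNIV. metric_sign \<kappa> * (metric_sign \<rho> *
      inn (icomm f X (A_up \<kappa>)) (icomm f (A_up \<rho>) (F_up \<kappa> \<rho>)))"
  shows "N + N \<doteq> - (\<Sum>\<kappa>\<in>UNIV. \<Sum>\<rho>\<in>UNIV. metric_sign \<kappa> * (metric_sign \<rho> *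
      inn (icomm f X (F_up \<kappa> \<rho>)) (icomm f (A_up \<kappa>) (A_up \<rho>))))"
proof -
  let ?n = "\<lambda>\<kappa> \<rho>. inn X (icomm f (A_up \<kappa>) (icomm f (A_up \<rho>) (F_up \<kappa> \<rho>)))"
  have pair: "?n \<kappa> \<rho> + ?n \<rho> \<kappa> \<doteq> - inn (icomm f X (F_up \<kappa> \<rho>)) (icomm f (A_up \<kappa>) (A_up \<rho>))" for \<kappa> \<rho>
  proof -
    have "?n \<rho> \<kappa> \<doteq> inn X (icomm f (A_up \<rho>) (icomm f (A_up \<kappa>) (\<lambda>a. - F_up \<kappa> \<rho> a)))"
      by (intro equiv_inn_right equiv_icomm_right F_up_antisym)
    also have "icomm f (A_up \<rho>) (icomm f (A_up \<kappa>) (\<lambda>a. - F_up \<kappa> \<rho> a)) =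
        (\<lambda>c. icomm f (A_up \<rho>) (icomm f (F_up \<kappa> \<rho>) (A_up \<kappa>)) c)"
    proof -
      have "icomm f (A_up \<kappa>) (\<lambda>a. - F_up \<kappa> \<rho> a) = icomm f (F_up \<kappa> \<rho>) (A_up \<kappa>)"
        by (rule ext) (simp only: icomm_minus_right icomm_antisym[of "F_up \<kappa> \<rho>" "A_up \<kappa>"])
      then show ?thesis by simp
    qed
    finally have "?n \<kappa> \<rho> + ?n \<rho> \<kappa> \<doteq> ?n \<kappa> \<rho> + inn X (icomm f (A_up \<rho>) (icomm f (F_up \<kappa> \<rho>) (A_up \<kappa>)))"
      by (intro equiv_add equiv_refl)
    also have "\<dots> = - inn X (icomm f (F_up \<kappa> \<rho>) (icomm f (A_up \<kappa>) (A_up \<rho>)))"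
    proof -
      have "?n \<kappa> \<rho> + inn X (icomm f (A_up \<rho>) (icomm f (F_up \<kappa> \<rho>) (A_up \<kappa>)))
        + inn X (icomm f (F_up \<kappa> \<rho>) (icomm f (A_up \<kappa>) (A_up \<rho>))) = inn X (\<lambda>a. 0)"
        by (simp only: inn_add_right[symmetric] icomm_jacobi)
      then show ?thesis
        by (simp only: eq_neg_iff_add_eq_0) (simp add: inn_def)
    qed
    finally show ?thesis
      by (simp only: inn_icomm)
  qed
  have "N = (\<Sum>\<kappa>\<in>UNIV. \<Sum>\<rho>\<in>UNIV. metric_sign \<kappa> * (metric_sign \<rho> * ?n \<kappa> \<rho>))"
    unfolding N_def by (simp only: inn_icomm)
  then have "N + N = (\<Sum>\<kappa>\<in>UNIV. \<Sum>\<rho>\<in>UNIV. metric_sign \<kappa> * (metric_sign \<rho> * (?n \<kappa> \<rho> + ?n \<rho> \<kappa>)))"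
    by (simp only: double_sum_symmetrize distrib_left mult.left_commute[of "metric_sign _" "metric_sign _"])
  also have "\<dots> \<doteq> (\<Sum>\<kappa>\<in>UNIV. \<Sum>\<rho>\<in>UNIV. metric_sign \<kappa> * (metric_sign \<rho> *
      - inn (icomm f X (F_up \<kappa> \<rho>)) (icomm f (A_up \<kappa>) (A_up \<rho>))))"
    by (intro equiv_sum equiv_mult pair)
  finally show ?thesis
    by (simp only: mult_minus_right sum_negf)
qed

text \<open>The bracket of \<open>A_up \<kappa>\<close> and \<open>A_up \<rho>\<close> is
  antisymmetric, so only the curl of A contributes. With the derivative carrying \<rho> and the
  potential carrying \<kappa>, the curl is F with indices \<rho>, \<kappa>, whence the minus
  sign.\<close>

lemma curl_sum:
  fixes X :: "'a \<Rightarrow> 'a wick"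
  defines "S \<equiv> \<Sum>\<kappa>\<in>UNIV. \<Sum>\<rho>\<in>UNIV. metric_sign \<kappa> *
      inn (icomm f X (\<lambda>a. wick_deriv \<rho> (A_up \<kappa> a))) (icomm f (A_up \<kappa>) (A_up \<rho>))"
  shows "S + S \<doteq> - (\<Sum>\<kappa>\<in>UNIV. \<Sum>\<rho>\<in>UNIV. metric_sign \<kappa> * (metric_sign \<rho> *
      inn (icomm f X (F_up \<kappa> \<rho>)) (icomm f (A_up \<kappa>) (A_up \<rho>))))"
proof -
  let ?B = "\<lambda>\<kappa> \<rho>. icomm f (A_up \<kappa>) (A_up \<rho>)"
  let ?d = "\<lambda>\<rho> \<kappa> a. metric_sign \<rho> * wick_deriv \<rho> (A_up \<kappa> a)"
  have pair: "inn (icomm f X (?d \<rho> \<kappa>)) (?B \<kappa> \<rho>) + inn (icomm f X (?d \<kappa> \<rho>)) (?B \<rho> \<kappa>)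
    \<doteq> - inn (icomm f X (F_up \<kappa> \<rho>)) (?B \<kappa> \<rho>)" for \<kappa> \<rho>
  proof -
    have "inn (icomm f X (?d \<rho> \<kappa>)) (?B \<kappa> \<rho>) + inn (icomm f X (?d \<kappa> \<rho>)) (?B \<rho> \<kappa>) =
      inn (icomm f X (\<lambda>a. ?d \<rho> \<kappa> a - ?d \<kappa> \<rho> a)) (?B \<kappa> \<rho>)"
      unfolding inn_antisym_right[of _ "A_up \<rho>" "A_up \<kappa>"] icomm_diff_right[abs_def] inn_diff_left by simp
    also have "\<dots> \<doteq> inn (icomm f X (\<lambda>a. - F_up \<kappa> \<rho> a)) (?B \<kappa> \<rho>)"
      by (intro equiv_inn_left equiv_icomm_right equiv_trans[OF curl_A_up F_up_antisym])
    finally show ?thesis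
      by (simp add: icomm_minus_right[abs_def] inn_minus_left)
  qed
  have "S = (\<Sum>\<kappa>\<in>UNIV. \<Sum>\<rho>\<in>UNIV. metric_sign \<kappa> * (metric_sign \<rho> * inn (icomm f X (?d \<rho> \<kappa>)) (?B \<kappa> \<rho>)))"
    unfolding S_def by (simp only: icomm_mult_right[abs_def] inn_mult_left metric_sign_cancel)
  then have sym: "S + S = (\<Sum>\<kappa>\<in>UNIV. \<Sum>\<rho>\<in>UNIV. metric_sign \<kappa> * (metric_sign \<rho> *
      (inn (icomm f X (?d \<rho> \<kappa>)) (?B \<kappa> \<rho>) + inn (icomm f X (?d \<kappa> \<rho>)) (?B \<rho> \<kappa>))))"
    by (simp only: double_sum_symmetrize distrib_left mult.left_commute[of "metric_sign _" "metric_sign _"])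
  show ?thesis
    unfolding sym sum_negf[symmetric] mult_minus_right[symmetric]
    by (intro equiv_sum equiv_mult pair)
qed

text \<open>Hence only the derivative of \<open>I\<^sup>\<nu>\<delta>\<close> survives in the string term.\<close>

lemma current_conserved:
  "(\<Sum>\<mu>\<in>UNIV. wick_deriv \<mu> (\<Sum>\<nu>\<in>UNIV. metric_sign \<nu> * icomm f (F_up \<mu> \<nu>) (A_up \<nu>) c)) \<doteq> 0"
proof -
  let ?d = "\<lambda>\<mu> \<nu> a. metric_sign \<mu> * wick_deriv \<mu> (A_up \<nu> a)"
  \<comment> \<open>\<open>T\<close> collects the derivatives that fall on A. Antisymmetry of F
    turns them into the curl, so each pair of index orders contributes the bracket of F with itself,
    which vanishes; the derivatives on F vanish by the field equation.\<close>
  define T where "T = (\<Sum>\<mu>\<in>UNIV. \<Sum>\<nu>\<in>UNIV. metric_sign \<mu> * (metric_sign \<nu> * icomm f (F_up \<mu> \<nu>) (?d \<mu> \<nu>) c))"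
  have T: "T \<doteq> 0"
  proof (rule equiv_half)
    have pair: "icomm f (F_up \<mu> \<nu>) (?d \<mu> \<nu>) c + icomm f (F_up \<nu> \<mu>) (?d \<nu> \<mu>) c \<doteq> 0" for \<mu> \<nu>
    proof -
      have "icomm f (F_up \<mu> \<nu>) (?d \<mu> \<nu>) c + icomm f (F_up \<nu> \<mu>) (?d \<nu> \<mu>) c \<doteq>
        icomm f (F_up \<mu> \<nu>) (?d \<mu> \<nu>) c + icomm f (\<lambda>a. - F_up \<mu> \<nu> a) (?d \<nu> \<mu>) c"
        by (intro equiv_add equiv_refl equiv_icomm_left F_up_antisym)
      also have "\<dots> = icomm f (F_up \<mu> \<nu>) (\<lambda>a. ?d \<mu> \<nu> a - ?d \<nu> \<mu> a) c"
        by (simp add: icomm_minus_left icomm_diff_right)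
      also have "\<dots> \<doteq> icomm f (F_up \<mu> \<nu>) (F_up \<mu> \<nu>) c"
        by (intro equiv_icomm_right curl_A_up)
      also have "\<dots> \<doteq> 0"
        by (rule equiv_half)
          (simp only: icomm_antisym[of "F_up \<mu> \<nu>" "F_up \<mu> \<nu>" c, unfolded eq_neg_iff_add_eq_0] add_0 equiv_refl)
      finally show ?thesis .
    qed
    have "T + T = (\<Sum>\<mu>\<in>UNIV. \<Sum>\<nu>\<in>UNIV. metric_sign \<mu> * (metric_sign \<nu> *
        (icomm f (F_up \<mu> \<nu>) (?d \<mu> \<nu>) c + icomm f (F_up \<nu> \<mu>) (?d \<nu> \<mu>) c)))"
      unfolding T_def
      by (simp only: double_sum_symmetrize distrib_left mult.left_commute[of "metric_sign _" "metric_sign _"])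
    also have "\<dots> \<doteq> (\<Sum>\<mu>\<in>UNIV. \<Sum>\<nu>\<in>UNIV. metric_sign \<mu> * (metric_sign \<nu> * 0))"
      by (intro equiv_sum equiv_mult pair)
    finally show "T + T \<doteq> 0 + 0" by simp
  qed
  have "(\<Sum>\<mu>\<in>UNIV. wick_deriv \<mu> (\<Sum>\<nu>\<in>UNIV. metric_sign \<nu> * icomm f (F_up \<mu> \<nu>) (A_up \<nu>) c)) =
    (\<Sum>\<mu>\<in>UNIV. \<Sum>\<nu>\<in>UNIV. metric_sign \<nu> * icomm f (\<lambda>a. wick_deriv \<mu> (F_up \<mu> \<nu> a)) (A_up \<nu>) c) + T"
    unfolding T_def icomm_mult_right
    by (simp add: wick_deriv_sum wick_deriv_const_mult wick_deriv_icomm distrib_left sum.distrib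
        mult.left_commute[of "metric_sign _" "metric_sign _"] metric_sign_cancel)
  also have "(\<Sum>\<mu>\<in>UNIV. \<Sum>\<nu>\<in>UNIV. metric_sign \<nu> * icomm f (\<lambda>a. wick_deriv \<mu> (F_up \<mu> \<nu> a)) (A_up \<nu>) c) =
    (\<Sum>\<nu>\<in>UNIV. metric_sign \<nu> * icomm f (\<lambda>a. \<Sum>\<mu>\<in>UNIV. wick_deriv \<mu> (F_up \<mu> \<nu> a)) (A_up \<nu>) c)"
    by (subst sum.swap) (simp add: icomm_sum_left sum_distrib_left)
  also have "\<dots> + T \<doteq> (\<Sum>\<nu>\<in>UNIV. metric_sign \<nu> * icomm f (\<lambda>a. 0) (A_up \<nu>) c) + 0"
    by (intro equiv_add equiv_sum equiv_mult equiv_icomm_left F_up_div T)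
  finally show ?thesis
    by (simp add: icomm_expand)
qed

lemma A_up_div_term:
  fixes X :: "'a \<Rightarrow> 'a wick"
  shows "(\<Sum>\<kappa>\<in>UNIV. \<Sum>\<rho>\<in>UNIV. metric_sign \<kappa> *
      inn (icomm f X (A_up \<kappa>)) (icomm f (A_up \<kappa>) (\<lambda>a. wick_deriv \<rho> (A_up \<rho> a)))) \<doteq> 0"
proof -
  have "(\<Sum>\<kappa>\<in>UNIV. metric_sign \<kappa> *
      inn (icomm f X (A_up \<kappa>)) (icomm f (A_up \<kappa>) (\<lambda>a. \<Sum>\<rho>\<in>UNIV. wick_deriv \<rho> (A_up \<rho> a))))
    \<doteq> (\<Sum>\<kappa>\<in>UNIV. metric_sign \<kappa> * inn (icomm f X (A_up \<kappa>)) (icomm f (A_up \<kappa>) (\<lambda>a. 0)))"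
    by (intro equiv_sum equiv_mult equiv_inn_right equiv_icomm_right A_up_div)
  then show ?thesis
    by (simp add: icomm_sum_right[abs_def] inn_sum_right sum_distrib_left) (simp add: icomm_expand inn_def)
qed

text \<open>Expanding a derivative of the inner product of i[w, A] with i[A, A] by Leibniz gives
  four terms. This and the next two definitions name those that survive the divergence condition on
  A.\<close>

definition dw_term :: "'a wick" where
  "dw_term = (\<Sum>\<kappa>\<in>UNIV. \<Sum>\<rho>\<in>UNIV. metric_sign \<kappa> *
     inn (icomm f (\<lambda>a. wick_deriv \<rho> (w_field a)) (A_up \<kappa>)) (icomm f (A_up \<kappa>) (A_up \<rho>)))"

definition dA_term :: "'a wick" where
  "dA_term = (\<Sum>\<kappa>\<in>UNIV. \<Sum>\<rho>\<in>UNIV. metric_sign \<kappa> *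
     inn (icomm f w_field (\<lambda>a. wick_deriv \<rho> (A_up \<kappa> a))) (icomm f (A_up \<kappa>) (A_up \<rho>)))"

definition dA_term2 :: "'a wick" where
  "dA_term2 = (\<Sum>\<kappa>\<in>UNIV. \<Sum>\<rho>\<in>UNIV. metric_sign \<kappa> *
     inn (icomm f w_field (A_up \<kappa>)) (icomm f (\<lambda>a. wick_deriv \<rho> (A_up \<kappa> a)) (A_up \<rho>)))"

text \<open>The difference of derivatives is what symmetrization leaves of the derivative of
  \<delta>; it is why \<open>dA_term2\<close> enters with the sign opposite to
  \<open>dA_term\<close>.\<close>

lemma FF_local_term:
  "(\<Sum>\<kappa>\<in>UNIV. \<Sum>\<rho>\<in>UNIV. metric_sign \<kappa> *
     (inn (\<lambda>a. wick_deriv \<rho> (icomm f w_field (A_up \<kappa>) a)) (icomm f (A_up \<kappa>) (A_up \<rho>))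
      - inn (icomm f w_field (A_up \<kappa>)) (\<lambda>a. wick_deriv \<rho> (icomm f (A_up \<kappa>) (A_up \<rho>) a))))
   \<doteq> dw_term + dA_term - dA_term2"
proof -
  have "(\<Sum>\<kappa>\<in>UNIV. \<Sum>\<rho>\<in>UNIV. metric_sign \<kappa> *
     (inn (\<lambda>a. wick_deriv \<rho> (icomm f w_field (A_up \<kappa>) a)) (icomm f (A_up \<kappa>) (A_up \<rho>))
      - inn (icomm f w_field (A_up \<kappa>)) (\<lambda>a. wick_deriv \<rho> (icomm f (A_up \<kappa>) (A_up \<rho>) a))))
    = dw_term + dA_term - dA_term2 - (\<Sum>\<kappa>\<in>UNIV. \<Sum>\<rho>\<in>UNIV. metric_sign \<kappa> *
      inn (icomm f w_field (A_up \<kappa>)) (icomm f (A_up \<kappa>) (\<lambda>a. wick_deriv \<rho> (A_up \<rho> a))))"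
    unfolding dw_term_def dA_term_def dA_term2_def wick_deriv_icomm inn_add_left inn_add_right
    by (simp add: distrib_left right_diff_distrib sum.distrib sum_subtractf)
  also have "\<dots> \<doteq> dw_term + dA_term - dA_term2 - 0"
    by (intro equiv_diff equiv_refl A_up_div_term)
  finally show ?thesis by simp
qed

text \<open>Here the derivative is a full Leibniz sum, so all three terms have the same sign. The
  overall minus comes from reversing the bracket of \<open>A_up \<mu>\<close> and
  \<open>A_up \<nu>\<close> to match the named terms.\<close>

lemma divergence_local_term:
  "(\<Sum>\<mu>\<in>UNIV. wick_deriv \<mu> (\<Sum>\<nu>\<in>UNIV. inn (icomm f (A_up \<mu>) (A_up \<nu>)) (icomm f w_field (A_dn \<nu>))))
    \<doteq> - dw_term - dA_term - dA_term2"
proof -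
  have "(\<Sum>\<mu>\<in>UNIV. wick_deriv \<mu> (\<Sum>\<nu>\<in>UNIV. inn (icomm f (A_up \<mu>) (A_up \<nu>)) (icomm f w_field (A_dn \<nu>)))) =
    (\<Sum>\<mu>\<in>UNIV. \<Sum>\<nu>\<in>UNIV. metric_sign \<nu> * wick_deriv \<mu> (inn (icomm f w_field (A_up \<nu>)) (icomm f (A_up \<mu>) (A_up \<nu>))))"
    by (simp add: A_dn_eq[abs_def] icomm_mult_right[abs_def] inn_mult_right inn_mult_left wick_deriv_sum
        wick_deriv_const_mult inn_commute[of "icomm f (A_up _) (A_up _)"])
  also have "\<dots> = (\<Sum>\<nu>\<in>UNIV. \<Sum>\<mu>\<in>UNIV. metric_sign \<nu> * wick_deriv \<mu> (inn (icomm f w_field (A_up \<nu>)) (icomm f (A_up \<mu>) (A_up \<nu>))))"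
    by (rule sum.swap)
  also have "\<dots> = - dw_term - dA_term - dA_term2 - (\<Sum>\<kappa>\<in>UNIV. \<Sum>\<rho>\<in>UNIV. metric_sign \<kappa> *
      inn (icomm f w_field (A_up \<kappa>)) (icomm f (A_up \<kappa>) (\<lambda>a. wick_deriv \<rho> (A_up \<rho> a))))"
  proof -
    have "wick_deriv \<mu> (inn (icomm f w_field (A_up \<nu>)) (icomm f (A_up \<mu>) (A_up \<nu>))) =
      - inn (icomm f (\<lambda>a. wick_deriv \<mu> (w_field a)) (A_up \<nu>)) (icomm f (A_up \<nu>) (A_up \<mu>))
      - inn (icomm f w_field (\<lambda>a. wick_deriv \<mu> (A_up \<nu> a))) (icomm f (A_up \<nu>) (A_up \<mu>))
      - inn (icomm f w_field (A_up \<nu>)) (icomm f (\<lambda>a. wick_deriv \<mu> (A_up \<nu> a)) (A_up \<mu>))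
      - inn (icomm f w_field (A_up \<nu>)) (icomm f (A_up \<nu>) (\<lambda>a. wick_deriv \<mu> (A_up \<mu> a)))" for \<mu> \<nu>
      unfolding wick_deriv_inn wick_deriv_icomm inn_add_left inn_add_right
      unfolding inn_antisym_right[of _ "A_up \<mu>"] inn_antisym_right[of _ "\<lambda>a. wick_deriv \<mu> (A_up \<mu> a)"]
      by simp
    then show ?thesis
      unfolding dw_term_def dA_term_def dA_term2_def
      by (simp add: right_diff_distrib sum.distrib sum_subtractf sum_negf)
  qed
  also have "\<dots> \<doteq> - dw_term - dA_term - dA_term2 - 0"
    by (intro equiv_diff equiv_refl A_up_div_term)
  finally show ?thesis by simp
qed

text \<open>The variation hits four potentials, and after relabelling each contributes minus
  \<open>dw_term\<close>. The factor -1/2 of \<open>L2\<close> turns the four copies into plus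
  two.\<close>

lemma string_variation_L2:
  assumes "string_variation D"
  shows "D (L2 f c_F) = const (1 + of_real c_F) * (dw_term + dw_term)"
proof -
  note D = wick_derivation_string_variation[OF assms]
  have DA: "D (A_up \<mu> a) = metric_sign \<mu> * wick_deriv \<mu> (w_field a)" for \<mu> a
  proof -
    have "D (A_dn \<mu> a) = wick_deriv \<mu> (w_field a)"
      using assms unfolding string_variation_def by blast
    then show ?thesis
      by (simp only: A_up_eq derivation_const_mult[OF D])
  qed
  define k where "k = 1 + complex_of_real c_F"
  let ?B = "\<lambda>\<mu> \<nu>. icomm f (A_up \<mu>) (A_up \<nu>)"
  let ?t = "\<lambda>\<mu> \<nu>. metric_sign \<mu> * inn (icomm f (\<lambda>a. wick_deriv \<nu> (w_field a)) (A_up \<mu>)) (?B \<mu> \<nu>)"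
  have "metric_sign \<mu> * (metric_sign \<nu> * D (inn (?B \<mu> \<nu>) (?B \<mu> \<nu>))) = - (?t \<nu> \<mu> + ?t \<mu> \<nu>) - (?t \<nu> \<mu> + ?t \<mu> \<nu>)" for \<mu> \<nu>
  proof -
    have 1: "metric_sign \<mu> * (metric_sign \<nu> * inn (icomm f (\<lambda>a. D (A_up \<mu> a)) (A_up \<nu>)) (?B \<mu> \<nu>)) = - ?t \<nu> \<mu>"
      unfolding DA icomm_mult_left[abs_def] inn_mult_left inn_antisym_right[of _ "A_up \<mu>"]
      by (simp add: mult.left_commute[of "metric_sign \<nu>" "metric_sign \<mu>"] metric_sign_cancel)
    have 2: "metric_sign \<mu> * (metric_sign \<nu> * inn (icomm f (A_up \<mu>) (\<lambda>a. D (A_up \<nu> a))) (?B \<mu> \<nu>)) = - ?t \<mu> \<nu>"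
      unfolding DA icomm_mult_right[abs_def] inn_mult_left inn_antisym_left[of "A_up \<mu>"]
      by (simp add: metric_sign_cancel)
    have "D (inn (?B \<mu> \<nu>) (?B \<mu> \<nu>)) =
      (inn (icomm f (\<lambda>a. D (A_up \<mu> a)) (A_up \<nu>)) (?B \<mu> \<nu>) + inn (icomm f (A_up \<mu>) (\<lambda>a. D (A_up \<nu> a))) (?B \<mu> \<nu>)) +
      (inn (icomm f (\<lambda>a. D (A_up \<mu> a)) (A_up \<nu>)) (?B \<mu> \<nu>) + inn (icomm f (A_up \<mu>) (\<lambda>a. D (A_up \<nu> a))) (?B \<mu> \<nu>))"
      unfolding derivation_inn[OF D] derivation_icomm[OF D] inn_add_left inn_add_right
      unfolding inn_commute[of "?B \<mu> \<nu>"] ..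
    then show ?thesis
      by (simp only: distrib_left 1 2) simp
  qed
  then have "(\<Sum>\<mu>\<in>UNIV. \<Sum>\<nu>\<in>UNIV. metric_sign \<mu> * (metric_sign \<nu> * D (inn (?B \<mu> \<nu>) (?B \<mu> \<nu>)))) = - (dw_term + dw_term) - (dw_term + dw_term)"
    unfolding dw_term_def double_sum_symmetrize
    by (simp only: sum_negf[symmetric] sum_subtractf[symmetric]) (simp only: add.commute)
  moreover have "D (L2 f c_F) = const (- (1/2) * k) *
      (\<Sum>\<mu>\<in>UNIV. \<Sum>\<nu>\<in>UNIV. metric_sign \<mu> * (metric_sign \<nu> * D (inn (?B \<mu> \<nu>) (?B \<mu> \<nu>))))"
    unfolding L2_def A_dn_eq[abs_def] icomm_mult_left[abs_def] icomm_mult_right[abs_def] inn_mult_right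
      derivation_const_mult[OF D] derivation_sum[OF D] k_def ..
  moreover have "const (- (1/2) * k) * (- P - P) = const k * P" for P :: "'a wick"
  proof -
    have "const (- (1/2) * k) * (- P - P) = const (- (- (1/2) * k) - (- (1/2) * k)) * P"
      unfolding const_diff const_minus by (simp add: algebra_simps)
    then show ?thesis by simp
  qed
  ultimately show ?thesis
    by (simp only: k_def)
qed

text \<open>The left side is the sum of the local FF, FA and AF contributions in both orders of the
  points, with a common factor \<open>\<i>\<close> removed. Terms with an underived \<delta> are the
  same in both orders, hence the 2 in front of the FA term.\<close>

lemma local_identity:
  assumes "string_variation D"
  shows "const (1 + of_real c_F) * (\<Sum>\<kappa>\<in>UNIV. \<Sum>\<rho>\<in>UNIV. metric_sign \<kappa> *
      (inn (\<lambda>a. wick_deriv \<rho> (icomm f w_field (A_up \<kappa>) a)) (icomm f (A_up \<kappa>) (A_up \<rho>))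
      - inn (icomm f w_field (A_up \<kappa>)) (\<lambda>a. wick_deriv \<rho> (icomm f (A_up \<kappa>) (A_up \<rho>) a))))
    - const 2 * (\<Sum>\<kappa>\<in>UNIV. \<Sum>\<rho>\<in>UNIV. metric_sign \<kappa> * (metric_sign \<rho> *
      inn (icomm f w_field (A_up \<kappa>)) (icomm f (A_up \<rho>) (F_up \<kappa> \<rho>))))
    - const (of_real c_F) * (\<Sum>\<kappa>\<in>UNIV. \<Sum>\<rho>\<in>UNIV. metric_sign \<kappa> * (metric_sign \<rho> *
      inn (icomm f (F_up \<kappa> \<rho>) w_field) (icomm f (A_up \<kappa>) (A_up \<rho>))))
    \<doteq> D (L2 f c_F) + const (1 + of_real c_F) *
      (\<Sum>\<mu>\<in>UNIV. wick_deriv \<mu> (\<Sum>\<nu>\<in>UNIV. inn (icomm f (A_up \<mu>) (A_up \<nu>)) (icomm f w_field (A_dn \<nu>))))"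
    (is "const ?k * ?FF - const 2 * ?N - const (of_real c_F) * ?M' \<doteq> _ + _ * ?G")
proof -
  define M where "M = (\<Sum>\<kappa>\<in>UNIV. \<Sum>\<rho>\<in>UNIV. metric_sign \<kappa> * (metric_sign \<rho> *
      inn (icomm f w_field (F_up \<kappa> \<rho>)) (icomm f (A_up \<kappa>) (A_up \<rho>))))"
  have k: "const ?k = 1 + const (of_real c_F)"
    by (simp add: const_add)
  have M': "?M' = - M"
    unfolding M_def inn_antisym_left[of "F_up _ _" w_field] by (simp add: sum_negf)
  have "const ?k * ?FF - const 2 * ?N - const (of_real c_F) * ?M' =
      const ?k * ?FF - (?N + ?N) + const (of_real c_F) * M"
    by (simp add: M' const_numeral)
  \<comment> \<open>By Jacobi the doubled FA term is minus \<open>M\<close>; together with the AF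
    term it has coefficient \<open>1 + c_F\<close>, like the FF part.\<close>
  also have "\<dots> \<doteq> const ?k * (dw_term + dA_term - dA_term2) - (- M) + const (of_real c_F) * M"
    by (intro equiv_add equiv_diff equiv_mult equiv_refl FF_local_term commutator_F_sum[of w_field, folded M_def])
  also have "\<dots> = const ?k * (dw_term - dA_term2 + dA_term + M)"
    unfolding k by (simp add: algebra_simps)
  \<comment> \<open>Trading \<open>M\<close> for minus two copies of \<open>dA_term\<close> flips
    the sign of \<open>dA_term\<close> to the one in the divergence. The surplus of
    \<open>dw_term\<close> is then exactly the variation of \<open>L2\<close>.\<close>
  also have "\<dots> \<doteq> const ?k * (dw_term - dA_term2 + dA_term + - (dA_term + dA_term))"
    using equiv_sym[OF equiv_minus[OF curl_sum[of w_field, folded M_def dA_term_def]]]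
    by (intro equiv_mult equiv_add equiv_refl) (simp only: minus_minus)
  also have "\<dots> = const ?k * (dw_term + dw_term) + const ?k * (- dw_term - dA_term - dA_term2)"
    by (simp add: algebra_simps)
  also have "\<dots> \<doteq> const ?k * (dw_term + dw_term) + const ?k * ?G"
    by (intro equiv_add equiv_refl equiv_mult equiv_sym[OF divergence_local_term])
  finally show ?thesis
    by (simp add: string_variation_L2[OF assms])
qed

end

section \<open>Matrix elements and contractions\<close>

text \<open>Common ground of the two-point obstructions, \<delta> and its string integrals: the
  property by which brackets and sums are pulled out of correlations.\<close>

definition test_linear :: "bidist \<Rightarrow> bool" where
  "test_linear V \<longleftrightarrow> (\<forall>\<phi> \<psi>. test_fun \<phi> \<longrightarrow> test_fun \<psi> \<longrightarrow> V (\<lambda>p. \<phi> p + \<psi> p) = V \<phi> + V \<psi>) \<and>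
     (\<forall>z \<phi>. test_fun \<phi> \<longrightarrow> V (\<lambda>p. z * \<phi> p) = z * V \<phi>)"

lemma test_linear_distribution: "distribution V \<Longrightarrow> test_linear V"
  by (simp add: distribution_def test_linear_def)

lemma test_linear_delta: "test_linear delta"
  by (simp add: test_linear_def delta_add delta_cmult)

lemma dderiv1_cmult:
  fixes \<phi> :: "'a::real_normed_vector \<Rightarrow> complex"
  assumes "smooth_fun \<phi>" shows "dderiv [v] (\<lambda>p. z * \<phi> p) = (\<lambda>p. z * dderiv [v] \<phi> p)"
  using dderiv1_mult[OF smooth_fun_const[of z] assms, of v] by simp

lemma test_linear_dderiv:
  assumes "test_linear V" shows "test_linear (\<lambda>\<phi>. V (dderiv [v] \<phi>))"
  using assms
  by (simp add: test_linear_def dderiv1_add dderiv1_cmult test_fun_smooth test_fun_dderiv del: dderiv.simps)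

lemma test_linear_swap:
  assumes "test_linear V" shows "test_linear (\<lambda>\<phi>. V (\<lambda>p. \<phi> (prod.swap p)))"
  using assms by (simp add: test_linear_def test_fun_swap)

lemma test_linear_dist_deriv:
  assumes "test_linear V" shows "test_linear (dist_deriv \<mu> V)"
  using test_linear_dderiv[OF assms, of "(axis \<mu> 1, 0)"]
  by (simp add: test_linear_def dist_deriv_def del: dderiv.simps)

lemma test_linear_string_dist: "smearing \<sigma> c \<Longrightarrow> test_linear (string_dist \<sigma> c \<nu> delta)"
  by (simp add: test_linear_def string_dist_delta_add string_dist_delta_cmult)

definition wick_linear :: "(('m multiset \<Rightarrow>\<^sub>0 complex) \<Rightarrow> complex) \<Rightarrow> bool" where
  "wick_linear h \<longleftrightarrow> (\<forall>P Q. h (P + Q) = h P + h Q) \<and> (\<forall>z P. h (const z * P) = z * h P)"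

lemma wick_linear_0: "wick_linear h \<Longrightarrow> h 0 = 0"
  unfolding wick_linear_def by (metis const_0 mult_zero_left)

lemma wick_linear_add: "wick_linear h \<Longrightarrow> h (P + Q) = h P + h Q"
  and wick_linear_const_mult: "wick_linear h \<Longrightarrow> h (const z * P) = z * h P"
  by (simp_all add: wick_linear_def)

lemma wick_linear_sum: "wick_linear h \<Longrightarrow> h (\<Sum>i\<in>J. P i) = (\<Sum>i\<in>J. h (P i))"
  by (induction J rule: infinite_finite_induct) (simp_all add: wick_linear_0 wick_linear_add)

lemma wick_linear_diff: "wick_linear h \<Longrightarrow> h (P - Q) = h P - h Q"
  using wick_linear_add[of h P "const (- 1) * Q"] wick_linear_const_mult[of h "- 1" Q]
  by (simp add: const_minus)

lemma wick_linear_minus: "wick_linear h \<Longrightarrow> h (- P) = - h P"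
  using wick_linear_diff[of h 0 P] by (simp add: wick_linear_0)

lemma wick_linear_icomm:
  "wick_linear h \<Longrightarrow> h (icomm f X Y c) = (\<Sum>a\<in>UNIV. \<Sum>b\<in>UNIV. - of_real (f a b c) * h (X a * Y b))"
  by (simp add: icomm_expand wick_linear_sum wick_linear_const_mult)

text \<open>If \<open>h\<close> acts by removing one factor of a triple product, then by the cyclic
  symmetry of \<open>f\<close> the remaining two factors reassemble into their bracket, in cyclic
  order, with the index of the removed factor.\<close>

lemma (in lie_structure) wick_linear_trilinear:
  assumes "wick_linear h" "\<And>a. wick_linear (h1 a)" "\<And>a. wick_linear (h2 a)" "\<And>a. wick_linear (h3 a)"
    and h: "\<And>a b c. h (X a * (Y b * Z c)) = h1 a (Y b * Z c) + h2 b (X a * Z c) + h3 c (X a * Y b)"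
  shows "h (inn X (icomm f Y Z)) =
    (\<Sum>a\<in>UNIV. h1 a (icomm f Y Z a) + h2 a (icomm f Z X a) + h3 a (icomm f X Y a))"
proof -
  have "h (inn X (icomm f Y Z)) =
    (\<Sum>a\<in>UNIV. \<Sum>b\<in>UNIV. \<Sum>c\<in>UNIV. - of_real (f b c a) * h (X a * (Y b * Z c)))"
    by (simp add: inn_def icomm_expand wick_linear_sum[OF assms(1)] wick_linear_const_mult[OF assms(1)]
        sum_distrib_left mult.left_commute[of _ "const _"])
  also have "\<dots> = (\<Sum>a\<in>UNIV. \<Sum>b\<in>UNIV. \<Sum>c\<in>UNIV. - of_real (f b c a) * h1 a (Y b * Z c))
    + (\<Sum>a\<in>UNIV. \<Sum>b\<in>UNIV. \<Sum>c\<in>UNIV. - of_real (f b c a) * h2 b (X a * Z c))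
    + (\<Sum>a\<in>UNIV. \<Sum>b\<in>UNIV. \<Sum>c\<in>UNIV. - of_real (f b c a) * h3 c (X a * Y b))"
    by (simp only: h distrib_left sum.distrib)
  also have "(\<Sum>a\<in>UNIV. \<Sum>b\<in>UNIV. \<Sum>c\<in>UNIV. - of_real (f b c a) * h2 b (X a * Z c)) =
      (\<Sum>b\<in>UNIV. h2 b (icomm f Z X b))"
  proof -
    have "- of_real (f b c a) * h2 b (X a * Z c) = - of_real (f c a b) * h2 b (Z c * X a)" for a b c
      by (simp only: f_cyclic[of c a b] mult.commute[of "X a"])
    then have "(\<Sum>a\<in>UNIV. \<Sum>b\<in>UNIV. \<Sum>c\<in>UNIV. - of_real (f b c a) * h2 b (X a * Z c)) =
      (\<Sum>a\<in>UNIV. \<Sum>b\<in>UNIV. \<Sum>c\<in>UNIV. - of_real (f c a b) * h2 b (Z c * X a))"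
      by (intro sum.cong refl)
    also have "\<dots> = (\<Sum>b\<in>UNIV. h2 b (icomm f Z X b))"
      unfolding wick_linear_icomm[OF assms(3)] by (rule sum_rotate[symmetric])
    finally show ?thesis .
  qed
  also have "(\<Sum>a\<in>UNIV. \<Sum>b\<in>UNIV. \<Sum>c\<in>UNIV. - of_real (f b c a) * h3 c (X a * Y b)) =
      (\<Sum>c\<in>UNIV. h3 c (icomm f X Y c))"
  proof -
    have "- of_real (f b c a) * h3 c (X a * Y b) = - of_real (f a b c) * h3 c (X a * Y b)" for a b c
      by (simp only: f_cyclic[of b c a])
    then have "(\<Sum>a\<in>UNIV. \<Sum>b\<in>UNIV. \<Sum>c\<in>UNIV. - of_real (f b c a) * h3 c (X a * Y b)) =
      (\<Sum>a\<in>UNIV. \<Sum>b\<in>UNIV. \<Sum>c\<in>UNIV. - of_real (f a b c) * h3 c (X a * Y b))"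
      by (intro sum.cong refl)
    also have "\<dots> = (\<Sum>c\<in>UNIV. h3 c (icomm f X Y c))"
      unfolding wick_linear_icomm[OF assms(4)] by (rule sum_rotate)
    finally show ?thesis .
  qed
  finally show ?thesis
    by (simp only: wick_linear_icomm[OF assms(2)] sum.distrib)
qed

section \<open>Correlations of a fixed matrix element and contractions as bilinear maps\<close>

locale wick_matrix_element = lie_structure f
  for f :: "'a::finite \<Rightarrow> 'a \<Rightarrow> 'a \<Rightarrow> real" +
  fixes \<sigma> :: "pt measure" and c :: "pt \<Rightarrow> real" and \<omega> :: "'a nwick \<Rightarrow> complex"
  assumes smearing: "smearing \<sigma> c" and functional: "wick_functional \<sigma> c \<omega>"
begin

lemma linear: "wick_linear \<omega>"
  using functional unfolding wick_functional_def wick_linear_def by blast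

definition corr :: "'a wick \<Rightarrow> 'a wick \<Rightarrow> pt \<times> pt \<Rightarrow> complex" where
  "corr P Q p = \<omega> (wick_at P (fst p) * wick_at Q (snd p))"

lemma corr_linear_left: "wick_linear (\<lambda>P. corr P Q p)"
  by (simp add: wick_linear_def corr_def wick_at_add wick_at_mult wick_at_const distrib_right mult.assoc
      wick_linear_add[OF linear] wick_linear_const_mult[OF linear])

lemma corr_linear_right: "wick_linear (\<lambda>Q. corr P Q p)"
  by (simp add: wick_linear_def corr_def wick_at_add wick_at_mult wick_at_const distrib_left
      mult.left_commute[of _ "const _"] wick_linear_add[OF linear] wick_linear_const_mult[OF linear])

lemma corr_diagonal: "corr P Q (x, x) = corr (P * Q) 1 (x, x)"
  by (simp add: corr_def wick_at_mult)

lemma smooth_corr: "smooth_fun (corr P Q)"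
proof -
  have "smooth_fun (\<lambda>(x, x'). \<omega> (1 * wick_at P x * wick_at Q x'))"
    using functional unfolding wick_functional_def by blast
  then show ?thesis
    by (simp add: corr_def[abs_def] case_prod_unfold)
qed

text \<open>The derivative rule for \<omega> allows arbitrary spectators, and the field at the other
  point serves as one.\<close>

lemma dderiv_corr_left: "dderiv [(axis \<mu> 1, 0)] (corr P Q) = corr (wick_deriv \<mu> P) Q"
proof
  fix p :: "pt \<times> pt"
  obtain x y where p: "p = (x, y)" by (cases p)
  have "((\<lambda>x. (x, y)) has_derivative (\<lambda>h. (h, 0))) (at x)"
    by (auto intro!: derivative_eq_intros)
  from has_derivative_compose[OF this smooth_fun_has_derivative[OF smooth_corr[of P Q]]]
  have "((\<lambda>x. corr P Q (x, y)) has_derivative (\<lambda>h. frechet_derivative (corr P Q) (at (x, y)) (h, 0))) (at x)" .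
  from dderiv1[OF this, of "axis \<mu> 1"]
  have "dderiv [(axis \<mu> 1, 0)] (corr P Q) p = dderiv [axis \<mu> 1] (\<lambda>x. \<omega> (wick_at Q y * wick_at P x)) x"
    by (simp add: corr_def p mult.commute)
  also have "\<dots> = \<omega> (wick_at Q y * wick_at (wick_deriv \<mu> P) x)"
    using functional unfolding wick_functional_def by metis
  finally show "dderiv [(axis \<mu> 1, 0)] (corr P Q) p = corr (wick_deriv \<mu> P) Q p"
    by (simp add: corr_def p mult.commute)
qed

lemma dderiv_corr_right: "dderiv [(0, axis \<mu> 1)] (corr P Q) = corr P (wick_deriv \<mu> Q)"
proof
  fix p :: "pt \<times> pt"
  obtain x y where p: "p = (x, y)" by (cases p)
  have "((\<lambda>y. (x, y)) has_derivative (\<lambda>h. (0, h))) (at y)"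
    by (auto intro!: derivative_eq_intros)
  from has_derivative_compose[OF this smooth_fun_has_derivative[OF smooth_corr[of P Q]]]
  have "((\<lambda>y. corr P Q (x, y)) has_derivative (\<lambda>h. frechet_derivative (corr P Q) (at (x, y)) (0, h))) (at y)" .
  from dderiv1[OF this, of "axis \<mu> 1"]
  have "dderiv [(0, axis \<mu> 1)] (corr P Q) p = dderiv [axis \<mu> 1] (\<lambda>y. \<omega> (wick_at P x * wick_at Q y)) y"
    by (simp add: corr_def p)
  also have "\<dots> = \<omega> (wick_at P x * wick_at (wick_deriv \<mu> Q) y)"
    using functional unfolding wick_functional_def by metis
  finally show "dderiv [(0, axis \<mu> 1)] (corr P Q) p = corr P (wick_deriv \<mu> Q) p"
    by (simp add: corr_def p)
qed

text \<open>Quantifying over all spectators \<open>R\<close> makes this an ideal without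
  multiplicativity of \<omega>: a factor at \<open>x\<close> is absorbed into
  \<open>R\<close>.\<close>

definition null_polys :: "'a wick set" where
  "null_polys = {P. \<forall>R x. \<omega> (R * wick_at P x) = 0}"

sublocale field_ideal f null_polys
proof
  show "0 \<in> null_polys"
    by (simp add: null_polys_def wick_linear_0[OF linear])
  show "P + Q \<in> null_polys" if "P \<in> null_polys" "Q \<in> null_polys" for P Q
    using that by (simp add: null_polys_def wick_at_add distrib_left wick_linear_add[OF linear])
  show "R * P \<in> null_polys" if "P \<in> null_polys" for P R
    using that by (simp add: null_polys_def wick_at_mult flip: mult.assoc)
  show "field_relations \<subseteq> null_polys"
    using functional unfolding wick_functional_def null_polys_def by blast
qed

notation equiv_mod (infix "\<doteq>" 50)

lemma corr_equiv_left: "P \<doteq> P' \<Longrightarrow> corr P Q = corr P' Q"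
proof
  fix p assume "P \<doteq> P'"
  then have "P - P' \<in> null_polys" by (simp only: equiv_mod_def)
  then have "\<omega> (wick_at Q (snd p) * wick_at (P - P') (fst p)) = 0"
    unfolding null_polys_def by blast
  then have "corr (P - P') Q p = 0"
    by (simp add: corr_def mult.commute)
  then show "corr P Q p = corr P' Q p"
    by (simp add: wick_linear_diff[OF corr_linear_left])
qed

lemma corr_equiv_right: "Q \<doteq> Q' \<Longrightarrow> corr P Q = corr P Q'"
proof
  fix p assume "Q \<doteq> Q'"
  then have "Q - Q' \<in> null_polys" by (simp only: equiv_mod_def)
  then have "corr P (Q - Q') p = 0"
    unfolding corr_def null_polys_def by blast
  then show "corr P Q p = corr P Q' p"
    by (simp add: wick_linear_diff[OF corr_linear_right])
qed

text \<open>A smooth correlation cut off by a test function is again a test function, so the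
  two-point obstructions, \<delta> and its string integrals can be applied to it.\<close>

definition wcorr :: "(pt \<times> pt \<Rightarrow> complex) \<Rightarrow> 'a wick \<Rightarrow> 'a wick \<Rightarrow> pt \<times> pt \<Rightarrow> complex" where
  "wcorr \<phi> P Q = (\<lambda>p. \<phi> p * corr P Q p)"

lemma test_fun_wcorr: "test_fun \<phi> \<Longrightarrow> test_fun (wcorr \<phi> P Q)"
  unfolding wcorr_def by (intro test_fun_mult smooth_corr)

lemma wcorr_linear_left:
  assumes "test_linear V" "test_fun \<phi>" shows "wick_linear (\<lambda>P. V (wcorr \<phi> P Q))"
proof -
  have "wcorr \<phi> (P + P') Q = (\<lambda>p. wcorr \<phi> P Q p + wcorr \<phi> P' Q p)" "wcorr \<phi> (const z * P) Q = (\<lambda>p. z * wcorr \<phi> P Q p)" for P P' z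
    by (auto simp: wcorr_def wick_linear_add[OF corr_linear_left] wick_linear_const_mult[OF corr_linear_left] distrib_left)
  then show ?thesis
    using assms by (simp add: wick_linear_def test_linear_def test_fun_wcorr)
qed

lemma wcorr_linear_right:
  assumes "test_linear V" "test_fun \<phi>" shows "wick_linear (\<lambda>Q. V (wcorr \<phi> P Q))"
proof -
  have "wcorr \<phi> P (Q + Q') = (\<lambda>p. wcorr \<phi> P Q p + wcorr \<phi> P Q' p)" "wcorr \<phi> P (const z * Q) = (\<lambda>p. z * wcorr \<phi> P Q p)" for Q Q' z
    by (auto simp: wcorr_def wick_linear_add[OF corr_linear_right] wick_linear_const_mult[OF corr_linear_right] distrib_left)
  then show ?thesis
    using assms by (simp add: wick_linear_def test_linear_def test_fun_wcorr)
qed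

lemma wcorr_equiv_left: "P \<doteq> P' \<Longrightarrow> wcorr \<phi> P Q = wcorr \<phi> P' Q"
  and wcorr_equiv_right: "Q \<doteq> Q' \<Longrightarrow> wcorr \<phi> P Q = wcorr \<phi> P Q'"
  by (simp_all add: wcorr_def corr_equiv_left corr_equiv_right)

text \<open>The smeared obstruction at fixed \<mu>, written as a function of two polynomials so that
  its bilinearity can be used.\<close>

definition contraction ::
  "(4 \<Rightarrow> 'a fld \<Rightarrow> 'a fld \<Rightarrow> bidist) \<Rightarrow> (pt \<times> pt \<Rightarrow> complex) \<Rightarrow> 4 \<Rightarrow> 'a wick \<Rightarrow> 'a wick \<Rightarrow> complex" where
  "contraction Ob \<phi> \<mu> P Q = (\<Sum>M\<in>Poly_Mapping.keys P. \<Sum>N\<in>Poly_Mapping.keys Q.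
     Poly_Mapping.lookup P M * Poly_Mapping.lookup Q N *
     (\<Sum>\<psi>\<in>#M. \<Sum>\<theta>\<in>#N. Ob \<mu> \<psi> \<theta> (wcorr \<phi> (wick_mono (M - {#\<psi>#})) (wick_mono (N - {#\<theta>#})))))"

lemma smear_obstruction: "smear (obstruction \<omega> Ob Y X) \<phi> = (\<Sum>\<mu>\<in>UNIV. contraction Ob \<phi> \<mu> (Y \<mu>) X)"
proof -
  have "\<omega> (P * const z) = z * \<omega> P" for P z
    using wick_linear_const_mult[OF linear] by (simp add: mult.commute)
  then show ?thesis
    by (simp add: smear_def obstruction_def contraction_def wmul_def wlift_def wcorr_def corr_def[abs_def] case_prod_unfold)
qed

lemma contraction_linear_left: "wick_linear (\<lambda>P. contraction Ob \<phi> \<mu> P Q)"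
proof -
  let ?s = "\<lambda>z M. \<Sum>N\<in>Poly_Mapping.keys Q. z * Poly_Mapping.lookup Q N *
     (\<Sum>\<psi>\<in>#M. \<Sum>\<theta>\<in>#N. Ob \<mu> \<psi> \<theta> (wcorr \<phi> (wick_mono (M - {#\<psi>#})) (wick_mono (N - {#\<theta>#}))))"
  have add: "contraction Ob \<phi> \<mu> (P + P') Q = contraction Ob \<phi> \<mu> P Q + contraction Ob \<phi> \<mu> P' Q" for P P'
    unfolding contraction_def by (rule keys_sum_add[of ?s]) (auto simp: distrib_right sum.distrib)
  have on_mono: "contraction Ob \<phi> \<mu> (const z * wick_mono M) Q = ?s z M" for z M
    unfolding contraction_def by (rule keys_sum_mono[of ?s]) simp
  have "contraction Ob \<phi> \<mu> (const z * P) Q = z * contraction Ob \<phi> \<mu> P Q" for z P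
  proof (induction P rule: wick_induct)
    case (mono y M)
    have "const z * (const y * wick_mono M) = const (z * y) * wick_mono M"
      by (simp add: const_mult mult.assoc)
    then show ?case
      by (simp only: on_mono) (simp add: sum_distrib_left mult.assoc)
  qed (simp add: distrib_left add)
  with add show ?thesis
    by (simp add: wick_linear_def)
qed

lemma contraction_linear_right: "wick_linear (contraction Ob \<phi> \<mu> P)"
proof -
  let ?s = "\<lambda>z N. \<Sum>M\<in>Poly_Mapping.keys P. Poly_Mapping.lookup P M * z *
     (\<Sum>\<psi>\<in>#M. \<Sum>\<theta>\<in>#N. Ob \<mu> \<psi> \<theta> (wcorr \<phi> (wick_mono (M - {#\<psi>#})) (wick_mono (N - {#\<theta>#}))))"
  have swap: "contraction Ob \<phi> \<mu> P Q = (\<Sum>N\<in>Poly_Mapping.keys Q. ?s (Poly_Mapping.lookup Q N) N)" for Q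
    unfolding contraction_def by (rule sum.swap)
  have add: "contraction Ob \<phi> \<mu> P (Q + Q') = contraction Ob \<phi> \<mu> P Q + contraction Ob \<phi> \<mu> P Q'" for Q Q'
    unfolding swap by (rule keys_sum_add[of ?s]) (auto simp: distrib_left distrib_right sum.distrib)
  have on_mono: "contraction Ob \<phi> \<mu> P (const z * wick_mono N) = ?s z N" for z N
    unfolding swap by (rule keys_sum_mono[of ?s]) simp
  have "contraction Ob \<phi> \<mu> P (const z * Q) = z * contraction Ob \<phi> \<mu> P Q" for z Q
  proof (induction Q rule: wick_induct)
    case (mono y N)
    have "const z * (const y * wick_mono N) = const (z * y) * wick_mono N"
      by (simp add: const_mult mult.assoc)
    then show ?case
      by (simp only: on_mono) (simp add: sum_distrib_left mult_ac)
  qed (simp add: distrib_left add)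
  with add show ?thesis
    by (simp add: wick_linear_def)
qed

lemma contraction_mono:
  "contraction Ob \<phi> \<mu> (wick_mono M) (wick_mono N) =
    (\<Sum>\<psi>\<in>#M. \<Sum>\<theta>\<in>#N. Ob \<mu> \<psi> \<theta> (wcorr \<phi> (wick_mono (M - {#\<psi>#})) (wick_mono (N - {#\<theta>#}))))"
  by (simp add: contraction_def wick_mono_def)

lemma var_triple: "var x * (var y * var z) = wick_mono {#x, y, z#}"
  by (simp add: wick_mono_add_mset)

lemma contraction_triple:
  fixes x y z x' y' z' :: "'a fld" and Ob \<phi> \<mu>
  defines "row_sum \<equiv> \<lambda>\<psi> P. Ob \<mu> \<psi> x' (wcorr \<phi> P (var y' * var z')) + Ob \<mu> \<psi> y' (wcorr \<phi> P (var x' * var z')) +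
    Ob \<mu> \<psi> z' (wcorr \<phi> P (var x' * var y'))"
  shows "contraction Ob \<phi> \<mu> (var x * (var y * var z)) (var x' * (var y' * var z')) =
    row_sum x (var y * var z) + row_sum y (var x * var z) + row_sum z (var x * var y)"
proof -
  \<comment> \<open>Multiset difference removes a single occurrence, so these equations hold even
    when some of the three factors coincide.\<close>
  have *: "wick_mono ({#u, v, w#} - {#v#}) = var u * var w" "wick_mono ({#u, v, w#} - {#w#}) = var u * var v"
    "wick_mono ({#u, v, w#} - {#u#}) = var v * var w" for u v w :: "'a fld"
  proof -
    have "{#u, v, w#} - {#v#} = {#u, w#}" "{#u, v, w#} - {#w#} = {#u, v#}" "{#u, v, w#} - {#u#} = {#v, w#}"
      by (simp_all add: multiset_eq_iff)
    then show "wick_mono ({#u, v, w#} - {#v#}) = var u * var w" "wick_mono ({#u, v, w#} - {#w#}) = var u * var v"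
      "wick_mono ({#u, v, w#} - {#u#}) = var v * var w"
      by (simp_all add: wick_mono_add_mset)
  qed
  have sum3: "(\<Sum>\<psi>\<in>#{#u, v, w#}. g \<psi>) = g u + g v + g w" for u v w :: "'a fld" and g :: "'a fld \<Rightarrow> complex"
    by (simp add: add.assoc)
  show ?thesis
    unfolding var_triple contraction_mono sum3 * row_sum_def by (rule refl)
qed

end

section \<open>The obstruction of the Yang-Mills pair\<close>

abbreviation sgn_mink :: "4 \<Rightarrow> complex" where
  "sgn_mink \<mu> \<equiv> of_real (\<eta> \<mu> \<mu>)"

lemma sgn_mink_square: "sgn_mink \<mu> * sgn_mink \<mu> = 1"
  by (simp flip: of_real_mult add: mink_diag_square)

lemma sgn_mink_cancel: "sgn_mink \<mu> * (sgn_mink \<mu> * z) = z"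
  by (simp add: sgn_mink_square flip: mult.assoc)

lemma sum_sgn_mink: "(\<Sum>\<nu>\<in>UNIV. sgn_mink \<nu> * (of_real (\<eta> \<nu> \<kappa>) * X \<nu>)) = X \<kappa>"
  by (subst sum_eq_single[of \<kappa>]) (auto simp: mink_off_diagonal sgn_mink_cancel)

lemma wick_linear_plus: "wick_linear g \<Longrightarrow> wick_linear h \<Longrightarrow> wick_linear (\<lambda>P. g P + h P)"
  by (simp add: wick_linear_def distrib_left)

lemma wick_linear_sum_fun: "(\<And>i. i \<in> J \<Longrightarrow> wick_linear (h i)) \<Longrightarrow> wick_linear (\<lambda>P. \<Sum>i\<in>J. h i P)"
  by (simp add: wick_linear_def sum.distrib sum_distrib_left)

lemma dist_deriv_up_eq: "dist_deriv_up \<mu> V \<phi> = sgn_mink \<mu> * dist_deriv \<mu> V \<phi>"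
  unfolding dist_deriv_up_def by (rule sum_eq_single) (simp add: mink_off_diagonal)

lemma L1_eq: "L1 f = const (1/2) * (\<Sum>\<kappa>\<in>UNIV. \<Sum>\<rho>\<in>UNIV. metric_sign \<kappa> * (metric_sign \<rho> *
    inn (F_up \<kappa> \<rho>) (icomm f (A_up \<kappa>) (A_up \<rho>))))"
  unfolding L1_def A_dn_eq[abs_def] icomm_mult_left[abs_def] icomm_mult_right[abs_def] inn_mult_right ..

lemma Q1_eq: "Q1 f \<mu> = (\<Sum>\<nu>\<in>UNIV. metric_sign \<nu> * inn (F_up \<mu> \<nu>) (icomm f w_field (A_up \<nu>)))"
  unfolding Q1_def A_dn_eq[abs_def] icomm_mult_left[abs_def] icomm_mult_right[abs_def] inn_mult_right ..

locale yang_mills_obstruction = wick_matrix_element f \<sigma> c \<omega>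
  for f :: "'a::finite \<Rightarrow> 'a \<Rightarrow> 'a \<Rightarrow> real" and \<sigma> c and \<omega> :: "'a nwick \<Rightarrow> complex" +
  fixes c_F :: real and Ob :: "4 \<Rightarrow> 'a fld \<Rightarrow> 'a fld \<Rightarrow> bidist" and \<phi> :: "pt \<times> pt \<Rightarrow> complex"
  assumes two_point: "two_point_obstruction \<sigma> c c_F Ob" and \<phi>: "test_fun \<phi>"
begin

notation equiv_mod (infix "\<doteq>" 50)

lemma test_linear_Ob: "test_linear (Ob \<mu> \<psi> \<theta>)"
  using two_point[unfolded two_point_obstruction_def, THEN conjunct1] by (intro test_linear_distribution) blast

lemmas Ob_linear_left = wcorr_linear_left[OF test_linear_Ob \<phi>]
  and Ob_linear_right = wcorr_linear_right[OF test_linear_Ob \<phi>]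

text \<open>Two applications of \<open>wick_linear_trilinear\<close>, one in each polynomial,
  organize the nine contractions of two cubic terms into three rows.\<close>

lemma contraction_inn_icomm:
  fixes x y z x' y' z' :: "'a \<Rightarrow> 'a fld" and \<mu>
  defines "X \<equiv> \<lambda>a. var (x a)" and "Y \<equiv> \<lambda>a. var (y a)" and "Z \<equiv> \<lambda>a. var (z a)"
    and "X' \<equiv> \<lambda>a. var (x' a)" and "Y' \<equiv> \<lambda>a. var (y' a)" and "Z' \<equiv> \<lambda>a. var (z' a)"
  defines "row_sum \<equiv> \<lambda>\<psi> P. \<Sum>a'\<in>UNIV. Ob \<mu> \<psi> (x' a') (wcorr \<phi> P (icomm f Y' Z' a')) +
    Ob \<mu> \<psi> (y' a') (wcorr \<phi> P (icomm f Z' X' a')) + Ob \<mu> \<psi> (z' a') (wcorr \<phi> P (icomm f X' Y' a'))"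
  shows "contraction Ob \<phi> \<mu> (inn X (icomm f Y Z)) (inn X' (icomm f Y' Z')) =
    (\<Sum>a\<in>UNIV. row_sum (x a) (icomm f Y Z a) + row_sum (y a) (icomm f Z X a) + row_sum (z a) (icomm f X Y a))"
proof (rule wick_linear_trilinear[OF contraction_linear_left])
  show "wick_linear (row_sum (x a))" "wick_linear (row_sum (y a))" "wick_linear (row_sum (z a))" for a
    unfolding row_sum_def by (intro wick_linear_sum_fun wick_linear_plus Ob_linear_left)+
  fix a b c
  let ?h = "\<lambda>\<theta> Q. Ob \<mu> (x a) \<theta> (wcorr \<phi> (Y b * Z c) Q) + Ob \<mu> (y b) \<theta> (wcorr \<phi> (X a * Z c) Q) + Ob \<mu> (z c) \<theta> (wcorr \<phi> (X a * Y b) Q)"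
  have "contraction Ob \<phi> \<mu> (X a * (Y b * Z c)) (inn X' (icomm f Y' Z')) =
    (\<Sum>a'\<in>UNIV. ?h (x' a') (icomm f Y' Z' a') + ?h (y' a') (icomm f Z' X' a') + ?h (z' a') (icomm f X' Y' a'))"
  proof (rule wick_linear_trilinear[OF contraction_linear_right])
    show "wick_linear (?h (x' a'))" "wick_linear (?h (y' a'))" "wick_linear (?h (z' a'))" for a'
      by (intro wick_linear_plus Ob_linear_right)+
    show "contraction Ob \<phi> \<mu> (X a * (Y b * Z c)) (X' a' * (Y' b' * Z' c')) =
      ?h (x' a') (Y' b' * Z' c') + ?h (y' b') (X' a' * Z' c') + ?h (z' c') (X' a' * Y' b')" for a' b' c'
      unfolding X_def Y_def Z_def X'_def Y'_def Z'_def contraction_triple by (simp only: add_ac)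
  qed
  then show "contraction Ob \<phi> \<mu> (X a * (Y b * Z c)) (inn X' (icomm f Y' Z')) =
    row_sum (x a) (Y b * Z c) + row_sum (y b) (X a * Z c) + row_sum (z c) (X a * Y b)"
    unfolding row_sum_def by (simp only: sum.distrib[symmetric] add_ac)
qed

text \<open>The inner product of fields at two different points, paired with \<open>V\<close>;
  \<open>inn\<close> covers a single point only.\<close>

definition corr_sum :: "bidist \<Rightarrow> ('a \<Rightarrow> 'a wick) \<Rightarrow> ('a \<Rightarrow> 'a wick) \<Rightarrow> complex" where
  "corr_sum V X Y = (\<Sum>a\<in>UNIV. V (wcorr \<phi> (X a) (Y a)))"

lemma corr_sum_minus_right: "test_linear V \<Longrightarrow> corr_sum V X (\<lambda>a. - Y a) = - corr_sum V X Y"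
  by (simp add: corr_sum_def sum_negf wick_linear_minus[OF wcorr_linear_right[OF _ \<phi>]])

lemma corr_sum_minus_left: "test_linear V \<Longrightarrow> corr_sum V (\<lambda>a. - X a) Y = - corr_sum V X Y"
  by (simp add: corr_sum_def sum_negf wick_linear_minus[OF wcorr_linear_left[OF _ \<phi>]])

lemma corr_sum_equiv_right:
  assumes "\<And>a. Y a \<doteq> Y' a" shows "corr_sum V X Y = corr_sum V X Y'"
  by (simp only: corr_sum_def wcorr_equiv_right[OF assms])

lemma corr_sum_equiv_left:
  assumes "\<And>a. X a \<doteq> X' a" shows "corr_sum V X Y = corr_sum V X' Y"
  by (simp only: corr_sum_def wcorr_equiv_left[OF assms])

text \<open>On test functions this is the string integral in x' of the derivative of \<delta>, by
  \<open>string_dist'_deriv_delta\<close>. It is written with the string on the first argument, as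
  in \<open>Q2\<close>, at the price of exchanging the points.\<close>

definition string_delta :: "4 \<Rightarrow> 4 \<Rightarrow> bidist" where
  "string_delta \<nu> \<kappa> \<psi> = string_dist \<sigma> c \<nu> delta (dderiv [(axis \<kappa> 1, 0)] (\<lambda>p. \<psi> (prod.swap p)))"

lemma test_linear_string_delta: "test_linear (string_delta \<nu> \<kappa>)"
  unfolding string_delta_def[abs_def]
  by (rule test_linear_swap[OF test_linear_dderiv[OF test_linear_string_dist[OF smearing]]])

lemmas two_point_relations =
  two_point[unfolded two_point_obstruction_def, THEN conjunct2, THEN spec, THEN mp]

lemma Ob_FF:
  assumes "test_fun \<psi>"
  shows "(\<Sum>\<mu>\<in>UNIV. Ob \<mu> (FieldF \<mu> \<nu> a) (FieldF \<kappa> \<rho> b) \<psi>) = of_bool (a = b) * (- (1 + of_real c_F) * \<i> *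
    (of_real (\<eta> \<nu> \<kappa>) * (sgn_mink \<rho> * dist_deriv \<rho> delta \<psi>) - of_real (\<eta> \<nu> \<rho>) * (sgn_mink \<kappa> * dist_deriv \<kappa> delta \<psi>)))"
proof -
  have "(\<Sum>\<mu>\<in>UNIV. Ob \<mu> (FieldF \<mu> \<nu> a) (FieldF \<kappa> \<rho> b) \<psi>) = of_bool (a = b) * (- (1 + of_real c_F)) *
    (of_real (\<eta> \<nu> \<kappa>) * \<i> * dist_deriv_up \<rho> delta \<psi> - of_real (\<eta> \<nu> \<rho>) * \<i> * dist_deriv_up \<kappa> delta \<psi>)"
    by (rule two_point_relations[OF assms, THEN conjunct1, rule_format])
  then show ?thesis
    unfolding dist_deriv_up_eq by (simp add: algebra_simps)
qed

lemma Ob_FA: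
  assumes "test_fun \<psi>"
  shows "(\<Sum>\<mu>\<in>UNIV. Ob \<mu> (FieldF \<mu> \<nu> a) (FieldA \<kappa> b) \<psi>) =
    of_bool (a = b) * (- \<i> * (of_real (\<eta> \<nu> \<kappa>) * delta \<psi> - sgn_mink \<kappa> * string_delta \<nu> \<kappa> \<psi>))"
proof -
  have "(\<Sum>\<mu>\<in>UNIV. Ob \<mu> (FieldF \<mu> \<nu> a) (FieldA \<kappa> b) \<psi>) =
    - of_bool (a = b) * (of_real (\<eta> \<nu> \<kappa>) * \<i> * delta \<psi> - \<i> * string_dist' \<sigma> c \<nu> (dist_deriv_up \<kappa> delta) \<psi>)"
    by (rule two_point_relations[OF assms, THEN conjunct2, THEN conjunct1, rule_format])
  then show ?thesis
    unfolding string_dist'_deriv_up string_dist'_deriv_delta[OF assms] string_delta_def by (simp add: algebra_simps)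
qed

lemma Ob_AF:
  assumes "test_fun \<psi>"
  shows "sgn_mink \<nu> * Ob \<mu> (FieldA \<nu> a) (FieldF \<kappa> \<rho> b) \<psi> - sgn_mink \<mu> * Ob \<nu> (FieldA \<mu> a) (FieldF \<kappa> \<rho> b) \<psi> =
    of_bool (a = b) * (of_bool (\<mu> = \<kappa> \<and> \<nu> = \<rho>) * (- of_real c_F * \<i> * delta \<psi>) -
      of_bool (\<mu> = \<rho> \<and> \<nu> = \<kappa>) * (- of_real c_F * \<i> * delta \<psi>))"
proof -
  have "(\<Sum>\<tau>\<in>UNIV. of_real (\<eta> \<nu> \<tau>) * Ob \<mu> (FieldA \<tau> a) (FieldF \<kappa> \<rho> b) \<psi>)
    - (\<Sum>\<tau>\<in>UNIV. of_real (\<eta> \<mu> \<tau>) * Ob \<nu> (FieldA \<tau> a) (FieldF \<kappa> \<rho> b) \<psi>) =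
    of_bool (a = b) * (- of_real c_F) *
      (of_bool (\<mu> = \<kappa>) * of_bool (\<nu> = \<rho>) - of_bool (\<mu> = \<rho>) * of_bool (\<nu> = \<kappa>)) * \<i> * delta \<psi>"
    by (rule two_point_relations[OF assms, THEN conjunct2, THEN conjunct2, THEN conjunct1, rule_format])
  moreover have "(\<Sum>\<tau>\<in>UNIV. of_real (\<eta> \<nu> \<tau>) * Ob \<mu> (FieldA \<tau> a) (FieldF \<kappa> \<rho> b) \<psi>) = sgn_mink \<nu> * Ob \<mu> (FieldA \<nu> a) (FieldF \<kappa> \<rho> b) \<psi>" for \<mu> \<nu>
    by (rule sum_eq_single) (simp add: mink_off_diagonal)
  ultimately show ?thesis
    by (simp add: of_bool_conj algebra_simps)
qed

lemma Ob_AA: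
  assumes "test_fun \<psi>"
  shows "sgn_mink \<nu> * Ob \<mu> (FieldA \<nu> a) (FieldA \<kappa> b) \<psi> - sgn_mink \<mu> * Ob \<nu> (FieldA \<mu> a) (FieldA \<kappa> b) \<psi> = 0"
proof -
  have "(\<Sum>\<tau>\<in>UNIV. of_real (\<eta> \<nu> \<tau>) * Ob \<mu> (FieldA \<tau> a) (FieldA \<kappa> b) \<psi>)
    - (\<Sum>\<tau>\<in>UNIV. of_real (\<eta> \<mu> \<tau>) * Ob \<nu> (FieldA \<tau> a) (FieldA \<kappa> b) \<psi>) = 0"
    by (rule two_point_relations[OF assms, THEN conjunct2, THEN conjunct2, THEN conjunct2, THEN conjunct1, rule_format])
  moreover have "(\<Sum>\<tau>\<in>UNIV. of_real (\<eta> \<nu> \<tau>) * Ob \<mu> (FieldA \<tau> a) (FieldA \<kappa> b) \<psi>) = sgn_mink \<nu> * Ob \<mu> (FieldA \<nu> a) (FieldA \<kappa> b) \<psi>" for \<mu> \<nu>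
    by (rule sum_eq_single) (simp add: mink_off_diagonal)
  ultimately show ?thesis
    by simp
qed

lemma Ob_W: "test_fun \<psi> \<Longrightarrow> Ob \<mu> (FieldW a) \<theta> \<psi> = 0"
  by (rule two_point_relations[THEN conjunct2, THEN conjunct2, THEN conjunct2, THEN conjunct2, rule_format])

text \<open>Half of the F row after summing over \<nu>: the full row is this term plus the one with
  \<kappa> and \<rho> exchanged.\<close>

definition pair_term :: "4 \<Rightarrow> 4 \<Rightarrow> complex" where
  "pair_term \<kappa> \<rho> =
    - (1 + of_real c_F) * \<i> * (sgn_mink \<rho> * corr_sum (dist_deriv \<rho> delta) (icomm f w_field (A_up \<kappa>)) (icomm f (A_up \<kappa>) (A_up \<rho>)))
    - \<i> * corr_sum delta (icomm f w_field (A_up \<kappa>)) (icomm f (A_up \<rho>) (F_up \<kappa> \<rho>))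
    + \<i> * (\<Sum>\<nu>\<in>UNIV. sgn_mink \<nu> * (sgn_mink \<kappa> * corr_sum (string_delta \<nu> \<kappa>) (icomm f w_field (A_up \<nu>)) (icomm f (A_up \<rho>) (F_up \<kappa> \<rho>))))"

text \<open>The contraction of one linear factor \<psi>, with remaining cofactor \<open>P\<close>,
  against each of the three factors of the cubic term of \<open>L1\<close> with indices \<kappa>,
  \<rho>.\<close>

definition row_sum :: "4 \<Rightarrow> 4 \<Rightarrow> 4 \<Rightarrow> 'a fld \<Rightarrow> 'a wick \<Rightarrow> complex" where
  "row_sum \<kappa> \<rho> \<mu> \<psi> P = (\<Sum>b\<in>UNIV. Ob \<mu> \<psi> (FieldF \<kappa> \<rho> b) (wcorr \<phi> P (icomm f (A_up \<kappa>) (A_up \<rho>) b)) +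
     Ob \<mu> \<psi> (FieldA \<kappa> b) (wcorr \<phi> P (icomm f (A_up \<rho>) (F_up \<kappa> \<rho>) b)) +
     Ob \<mu> \<psi> (FieldA \<rho> b) (wcorr \<phi> P (icomm f (F_up \<kappa> \<rho>) (A_up \<kappa>) b)))"

lemma contraction_Q1_L1:
  "contraction Ob \<phi> \<mu> (inn (F_up \<mu> \<nu>) (icomm f w_field (A_up \<nu>))) (inn (F_up \<kappa> \<rho>) (icomm f (A_up \<kappa>) (A_up \<rho>))) =
    (\<Sum>a\<in>UNIV. row_sum \<kappa> \<rho> \<mu> (FieldF \<mu> \<nu> a) (icomm f w_field (A_up \<nu>) a)) +
    (\<Sum>a\<in>UNIV. row_sum \<kappa> \<rho> \<mu> (FieldA \<nu> a) (icomm f (F_up \<mu> \<nu>) w_field a))"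
proof -
  have "row_sum \<kappa> \<rho> \<mu> (FieldW a) P = 0" for a P
    by (simp add: row_sum_def Ob_W test_fun_wcorr \<phi>)
  moreover have "contraction Ob \<phi> \<mu> (inn (F_up \<mu> \<nu>) (icomm f w_field (A_up \<nu>))) (inn (F_up \<kappa> \<rho>) (icomm f (A_up \<kappa>) (A_up \<rho>))) =
    (\<Sum>a\<in>UNIV. row_sum \<kappa> \<rho> \<mu> (FieldF \<mu> \<nu> a) (icomm f w_field (A_up \<nu>) a)
      + row_sum \<kappa> \<rho> \<mu> (FieldW a) (icomm f (A_up \<nu>) (F_up \<mu> \<nu>) a)
      + row_sum \<kappa> \<rho> \<mu> (FieldA \<nu> a) (icomm f (F_up \<mu> \<nu>) w_field a))"
    using contraction_inn_icomm[of \<mu> "FieldF \<mu> \<nu>" FieldW "FieldA \<nu>" "FieldF \<kappa> \<rho>" "FieldA \<kappa>" "FieldA \<rho>"]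
    unfolding row_sum_def F_up_def[abs_def] A_up_def[abs_def] w_field_def[abs_def] .
  ultimately show ?thesis
    by (simp only: add_0_right sum.distrib)
qed

text \<open>The order of summation follows what is known of the two-point obstructions: those of F
  only after summing over \<mu>, those of A only after antisymmetrizing in \<mu> and \<nu>. The row
  of w is absent because its obstructions vanish.\<close>

lemma smear_obstruction_Q1_L1:
  "smear (obstruction \<omega> Ob (Q1 f) (L1 f)) \<phi> = 1/2 * (\<Sum>\<kappa>\<in>UNIV. \<Sum>\<rho>\<in>UNIV. sgn_mink \<kappa> * (sgn_mink \<rho> *
    ((\<Sum>\<nu>\<in>UNIV. sgn_mink \<nu> * (\<Sum>\<mu>\<in>UNIV. \<Sum>a\<in>UNIV. row_sum \<kappa> \<rho> \<mu> (FieldF \<mu> \<nu> a) (icomm f w_field (A_up \<nu>) a)))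
    + (\<Sum>\<mu>\<in>UNIV. \<Sum>\<nu>\<in>UNIV. sgn_mink \<nu> * (\<Sum>a\<in>UNIV. row_sum \<kappa> \<rho> \<mu> (FieldA \<nu> a) (icomm f (F_up \<mu> \<nu>) w_field a))))))"
proof -
  define K where "K \<mu> \<nu> \<kappa> \<rho> = contraction Ob \<phi> \<mu> (inn (F_up \<mu> \<nu>) (icomm f w_field (A_up \<nu>)))
    (inn (F_up \<kappa> \<rho>) (icomm f (A_up \<kappa>) (A_up \<rho>)))" for \<mu> \<nu> \<kappa> \<rho>
  have split: "(\<Sum>\<mu>\<in>UNIV. \<Sum>\<nu>\<in>UNIV. sgn_mink \<nu> * K \<mu> \<nu> \<kappa> \<rho>) =
    (\<Sum>\<nu>\<in>UNIV. sgn_mink \<nu> * (\<Sum>\<mu>\<in>UNIV. \<Sum>a\<in>UNIV. row_sum \<kappa> \<rho> \<mu> (FieldF \<mu> \<nu> a) (icomm f w_field (A_up \<nu>) a)))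
    + (\<Sum>\<mu>\<in>UNIV. \<Sum>\<nu>\<in>UNIV. sgn_mink \<nu> * (\<Sum>a\<in>UNIV. row_sum \<kappa> \<rho> \<mu> (FieldA \<nu> a) (icomm f (F_up \<mu> \<nu>) w_field a)))" for \<kappa> \<rho>
    unfolding K_def contraction_Q1_L1 distrib_left sum.distrib sum_distrib_left[of "sgn_mink _" _ UNIV]
    by (intro arg_cong2[of _ _ _ _ "(+)"] sum.swap refl)
  have "smear (obstruction \<omega> Ob (Q1 f) (L1 f)) \<phi> = (\<Sum>\<mu>\<in>UNIV. \<Sum>\<nu>\<in>UNIV. sgn_mink \<nu> * (1/2 * (\<Sum>\<kappa>\<in>UNIV. \<Sum>\<rho>\<in>UNIV.
      sgn_mink \<kappa> * (sgn_mink \<rho> * K \<mu> \<nu> \<kappa> \<rho>))))"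
    unfolding smear_obstruction Q1_eq L1_eq K_def
    by (simp only: wick_linear_sum[OF contraction_linear_left] wick_linear_const_mult[OF contraction_linear_left])
      (simp only: wick_linear_sum[OF contraction_linear_right] wick_linear_const_mult[OF contraction_linear_right])
  also have "\<dots> = 1/2 * (\<Sum>\<mu>\<in>UNIV. \<Sum>\<nu>\<in>UNIV. \<Sum>\<kappa>\<in>UNIV. \<Sum>\<rho>\<in>UNIV. sgn_mink \<kappa> * (sgn_mink \<rho> * (sgn_mink \<nu> * K \<mu> \<nu> \<kappa> \<rho>)))"
    by (simp add: sum_distrib_left mult_ac)
  also have "(\<Sum>\<mu>\<in>UNIV. \<Sum>\<nu>\<in>UNIV. \<Sum>\<kappa>\<in>UNIV. \<Sum>\<rho>\<in>UNIV. sgn_mink \<kappa> * (sgn_mink \<rho> * (sgn_mink \<nu> * K \<mu> \<nu> \<kappa> \<rho>))) =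
    (\<Sum>\<kappa>\<in>UNIV. \<Sum>\<mu>\<in>UNIV. \<Sum>\<nu>\<in>UNIV. \<Sum>\<rho>\<in>UNIV. sgn_mink \<kappa> * (sgn_mink \<rho> * (sgn_mink \<nu> * K \<mu> \<nu> \<kappa> \<rho>)))"
    by (rule sum_rotate)
  also have "\<dots> = (\<Sum>\<kappa>\<in>UNIV. \<Sum>\<rho>\<in>UNIV. \<Sum>\<mu>\<in>UNIV. \<Sum>\<nu>\<in>UNIV. sgn_mink \<kappa> * (sgn_mink \<rho> * (sgn_mink \<nu> * K \<mu> \<nu> \<kappa> \<rho>)))"
    by (intro sum.cong refl sum_rotate)
  also have "\<dots> = (\<Sum>\<kappa>\<in>UNIV. \<Sum>\<rho>\<in>UNIV. sgn_mink \<kappa> * (sgn_mink \<rho> * (\<Sum>\<mu>\<in>UNIV. \<Sum>\<nu>\<in>UNIV. sgn_mink \<nu> * K \<mu> \<nu> \<kappa> \<rho>)))"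
    by (simp only: sum_distrib_left)
  finally show ?thesis
    by (simp only: split)
qed

lemma sum_of_bool_eq: "(\<Sum>b\<in>UNIV. of_bool (a = b) * (X b :: complex)) = X (a :: 'a)"
  by (rule trans[OF sum_eq_single[of a]]) auto

lemma F_row:
  "(\<Sum>\<mu>\<in>UNIV. \<Sum>a\<in>UNIV. row_sum \<kappa> \<rho> \<mu> (FieldF \<mu> \<nu> a) (X a)) =
    - (1 + of_real c_F) * \<i> *
      (of_real (\<eta> \<nu> \<kappa>) * (sgn_mink \<rho> * corr_sum (dist_deriv \<rho> delta) X (icomm f (A_up \<kappa>) (A_up \<rho>)))
       - of_real (\<eta> \<nu> \<rho>) * (sgn_mink \<kappa> * corr_sum (dist_deriv \<kappa> delta) X (icomm f (A_up \<kappa>) (A_up \<rho>))))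
    - \<i> * (of_real (\<eta> \<nu> \<kappa>) * corr_sum delta X (icomm f (A_up \<rho>) (F_up \<kappa> \<rho>))
       - sgn_mink \<kappa> * corr_sum (string_delta \<nu> \<kappa>) X (icomm f (A_up \<rho>) (F_up \<kappa> \<rho>)))
    - \<i> * (of_real (\<eta> \<nu> \<rho>) * corr_sum delta X (icomm f (F_up \<kappa> \<rho>) (A_up \<kappa>))
       - sgn_mink \<rho> * corr_sum (string_delta \<nu> \<rho>) X (icomm f (F_up \<kappa> \<rho>) (A_up \<kappa>)))"
proof -
  have "(\<Sum>\<mu>\<in>UNIV. \<Sum>a\<in>UNIV. row_sum \<kappa> \<rho> \<mu> (FieldF \<mu> \<nu> a) (X a)) =
    (\<Sum>a\<in>UNIV. \<Sum>b\<in>UNIV.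
      (\<Sum>\<mu>\<in>UNIV. Ob \<mu> (FieldF \<mu> \<nu> a) (FieldF \<kappa> \<rho> b) (wcorr \<phi> (X a) (icomm f (A_up \<kappa>) (A_up \<rho>) b))) +
      (\<Sum>\<mu>\<in>UNIV. Ob \<mu> (FieldF \<mu> \<nu> a) (FieldA \<kappa> b) (wcorr \<phi> (X a) (icomm f (A_up \<rho>) (F_up \<kappa> \<rho>) b))) +
      (\<Sum>\<mu>\<in>UNIV. Ob \<mu> (FieldF \<mu> \<nu> a) (FieldA \<rho> b) (wcorr \<phi> (X a) (icomm f (F_up \<kappa> \<rho>) (A_up \<kappa>) b))))"
    unfolding row_sum_def sum.distrib[symmetric]
    by (subst sum_rotate[symmetric]) (rule refl)
  also have "\<dots> = (\<Sum>a\<in>UNIV.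
    - (1 + of_real c_F) * \<i> *
      (of_real (\<eta> \<nu> \<kappa>) * (sgn_mink \<rho> * dist_deriv \<rho> delta (wcorr \<phi> (X a) (icomm f (A_up \<kappa>) (A_up \<rho>) a)))
       - of_real (\<eta> \<nu> \<rho>) * (sgn_mink \<kappa> * dist_deriv \<kappa> delta (wcorr \<phi> (X a) (icomm f (A_up \<kappa>) (A_up \<rho>) a))))
    + - \<i> * (of_real (\<eta> \<nu> \<kappa>) * delta (wcorr \<phi> (X a) (icomm f (A_up \<rho>) (F_up \<kappa> \<rho>) a))
       - sgn_mink \<kappa> * string_delta \<nu> \<kappa> (wcorr \<phi> (X a) (icomm f (A_up \<rho>) (F_up \<kappa> \<rho>) a)))
    + - \<i> * (of_real (\<eta> \<nu> \<rho>) * delta (wcorr \<phi> (X a) (icomm f (F_up \<kappa> \<rho>) (A_up \<kappa>) a))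
       - sgn_mink \<rho> * string_delta \<nu> \<rho> (wcorr \<phi> (X a) (icomm f (F_up \<kappa> \<rho>) (A_up \<kappa>) a))))"
    unfolding Ob_FF[OF test_fun_wcorr[OF \<phi>]] Ob_FA[OF test_fun_wcorr[OF \<phi>]] distrib_left[symmetric]
    unfolding sum_of_bool_eq ..
  also have "\<dots> = - (1 + of_real c_F) * \<i> *
      (of_real (\<eta> \<nu> \<kappa>) * (sgn_mink \<rho> * corr_sum (dist_deriv \<rho> delta) X (icomm f (A_up \<kappa>) (A_up \<rho>)))
       - of_real (\<eta> \<nu> \<rho>) * (sgn_mink \<kappa> * corr_sum (dist_deriv \<kappa> delta) X (icomm f (A_up \<kappa>) (A_up \<rho>))))
    + - \<i> * (of_real (\<eta> \<nu> \<kappa>) * corr_sum delta X (icomm f (A_up \<rho>) (F_up \<kappa> \<rho>))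
       - sgn_mink \<kappa> * corr_sum (string_delta \<nu> \<kappa>) X (icomm f (A_up \<rho>) (F_up \<kappa> \<rho>)))
    + - \<i> * (of_real (\<eta> \<nu> \<rho>) * corr_sum delta X (icomm f (F_up \<kappa> \<rho>) (A_up \<kappa>))
       - sgn_mink \<rho> * corr_sum (string_delta \<nu> \<rho>) X (icomm f (F_up \<kappa> \<rho>) (A_up \<kappa>)))"
    by (simp only: sum.distrib sum_subtractf sum_distrib_left[symmetric] corr_sum_def)
  finally show ?thesis
    by simp
qed

text \<open>The cofactor i[F, w] is antisymmetric in \<mu>, \<nu> modulo the relations, so only the
  antisymmetrized obstructions enter: the AA part vanishes and the AF part fixes both
  indices.\<close>

lemma A_row:
  "(\<Sum>\<mu>\<in>UNIV. \<Sum>\<nu>\<in>UNIV. sgn_mink \<nu> * (\<Sum>a\<in>UNIV. row_sum \<kappa> \<rho> \<mu> (FieldA \<nu> a) (icomm f (F_up \<mu> \<nu>) w_field a))) =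
    - of_real c_F * \<i> * corr_sum delta (icomm f (F_up \<kappa> \<rho>) w_field) (icomm f (A_up \<kappa>) (A_up \<rho>))"
proof -
  let ?G = "\<lambda>\<mu> \<nu>. icomm f (F_up \<mu> \<nu>) w_field"
  let ?B = "icomm f (A_up \<kappa>) (A_up \<rho>)"
  define R where "R \<mu> \<nu> P = (\<Sum>a\<in>UNIV. sgn_mink \<nu> * row_sum \<kappa> \<rho> \<mu> (FieldA \<nu> a) (P a))" for \<mu> \<nu> and P :: "'a \<Rightarrow> 'a wick"
  have G_antisym: "icomm f (F_up \<nu> \<mu>) w_field a \<doteq> - ?G \<mu> \<nu> a" for \<mu> \<nu> a
  proof -
    have "icomm f (F_up \<nu> \<mu>) w_field a \<doteq> icomm f (\<lambda>a. - F_up \<mu> \<nu> a) w_field a"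
      by (intro equiv_icomm_left F_up_antisym)
    then show ?thesis
      by (simp only: icomm_minus_left)
  qed
  have row_linear: "wick_linear (row_sum \<kappa> \<rho> \<mu> \<psi>)" for \<mu> \<psi>
    unfolding row_sum_def[abs_def] by (intro wick_linear_sum_fun wick_linear_plus Ob_linear_left)
  have row_antisym: "row_sum \<kappa> \<rho> \<nu> \<psi> (?G \<nu> \<mu> a) = - row_sum \<kappa> \<rho> \<nu> \<psi> (?G \<mu> \<nu> a)" for \<mu> \<nu> \<psi> a
  proof -
    have "row_sum \<kappa> \<rho> \<nu> \<psi> (?G \<nu> \<mu> a) = row_sum \<kappa> \<rho> \<nu> \<psi> (- ?G \<mu> \<nu> a)"
      unfolding row_sum_def wcorr_equiv_left[OF G_antisym] ..
    then show ?thesis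
      by (simp only: wick_linear_minus[OF row_linear])
  qed
  have pair: "R \<mu> \<nu> (?G \<mu> \<nu>) + R \<nu> \<mu> (?G \<nu> \<mu>) =
      of_bool (\<mu> = \<kappa> \<and> \<nu> = \<rho>) * (- of_real c_F * \<i> * corr_sum delta (?G \<mu> \<nu>) ?B)
      - of_bool (\<mu> = \<rho> \<and> \<nu> = \<kappa>) * (- of_real c_F * \<i> * corr_sum delta (?G \<mu> \<nu>) ?B)" for \<mu> \<nu>
  proof -
    have "R \<mu> \<nu> (?G \<mu> \<nu>) + R \<nu> \<mu> (?G \<nu> \<mu>) = (\<Sum>a\<in>UNIV.
        sgn_mink \<nu> * row_sum \<kappa> \<rho> \<mu> (FieldA \<nu> a) (?G \<mu> \<nu> a) - sgn_mink \<mu> * row_sum \<kappa> \<rho> \<nu> (FieldA \<mu> a) (?G \<mu> \<nu> a))"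
      unfolding R_def row_antisym by (simp add: sum_negf sum_subtractf)
    also have "\<dots> = (\<Sum>a\<in>UNIV. \<Sum>b\<in>UNIV. of_bool (a = b) *
      (of_bool (\<mu> = \<kappa> \<and> \<nu> = \<rho>) * (- of_real c_F * \<i> * delta (wcorr \<phi> (?G \<mu> \<nu> a) (?B b)))
      - of_bool (\<mu> = \<rho> \<and> \<nu> = \<kappa>) * (- of_real c_F * \<i> * delta (wcorr \<phi> (?G \<mu> \<nu> a) (?B b)))))"
    proof (rule sum.cong[OF refl])
      fix a
      have "sgn_mink \<nu> * row_sum \<kappa> \<rho> \<mu> (FieldA \<nu> a) P - sgn_mink \<mu> * row_sum \<kappa> \<rho> \<nu> (FieldA \<mu> a) P = (\<Sum>b\<in>UNIV.
        (sgn_mink \<nu> * Ob \<mu> (FieldA \<nu> a) (FieldF \<kappa> \<rho> b) (wcorr \<phi> P (?B b)) - sgn_mink \<mu> * Ob \<nu> (FieldA \<mu> a) (FieldF \<kappa> \<rho> b) (wcorr \<phi> P (?B b)))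
        + (sgn_mink \<nu> * Ob \<mu> (FieldA \<nu> a) (FieldA \<kappa> b) (wcorr \<phi> P (icomm f (A_up \<rho>) (F_up \<kappa> \<rho>) b))
          - sgn_mink \<mu> * Ob \<nu> (FieldA \<mu> a) (FieldA \<kappa> b) (wcorr \<phi> P (icomm f (A_up \<rho>) (F_up \<kappa> \<rho>) b)))
        + (sgn_mink \<nu> * Ob \<mu> (FieldA \<nu> a) (FieldA \<rho> b) (wcorr \<phi> P (icomm f (F_up \<kappa> \<rho>) (A_up \<kappa>) b))
          - sgn_mink \<mu> * Ob \<nu> (FieldA \<mu> a) (FieldA \<rho> b) (wcorr \<phi> P (icomm f (F_up \<kappa> \<rho>) (A_up \<kappa>) b))))" for P
        unfolding row_sum_def by (simp add: sum_distrib_left sum.distrib sum_subtractf distrib_left)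
      then show "sgn_mink \<nu> * row_sum \<kappa> \<rho> \<mu> (FieldA \<nu> a) (?G \<mu> \<nu> a) - sgn_mink \<mu> * row_sum \<kappa> \<rho> \<nu> (FieldA \<mu> a) (?G \<mu> \<nu> a) =
        (\<Sum>b\<in>UNIV. of_bool (a = b) *
          (of_bool (\<mu> = \<kappa> \<and> \<nu> = \<rho>) * (- of_real c_F * \<i> * delta (wcorr \<phi> (?G \<mu> \<nu> a) (?B b)))
          - of_bool (\<mu> = \<rho> \<and> \<nu> = \<kappa>) * (- of_real c_F * \<i> * delta (wcorr \<phi> (?G \<mu> \<nu> a) (?B b)))))"
        by (simp only: Ob_AF[OF test_fun_wcorr[OF \<phi>]] Ob_AA[OF test_fun_wcorr[OF \<phi>]] add_0_right)
    qed
    also have "\<dots> = of_bool (\<mu> = \<kappa> \<and> \<nu> = \<rho>) * (- of_real c_F * \<i> * corr_sum delta (?G \<mu> \<nu>) ?B)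
      - of_bool (\<mu> = \<rho> \<and> \<nu> = \<kappa>) * (- of_real c_F * \<i> * corr_sum delta (?G \<mu> \<nu>) ?B)"
      unfolding sum_of_bool_eq sum_subtractf sum_distrib_left[symmetric] corr_sum_def[symmetric] ..
    finally show ?thesis .
  qed
  \<comment> \<open>Doubling produces the antisymmetrized obstruction for each index pair. Its two
    Kronecker terms contribute equally, since exchanging \<kappa> and \<rho> flips the sign of the
    cofactor, so the doubling cancels.\<close>
  define E where "E = (\<Sum>\<mu>\<in>UNIV. \<Sum>\<nu>\<in>UNIV. R \<mu> \<nu> (?G \<mu> \<nu>))"
  have "E + E = (\<Sum>\<mu>\<in>UNIV. \<Sum>\<nu>\<in>UNIV. R \<mu> \<nu> (?G \<mu> \<nu>) + R \<nu> \<mu> (?G \<nu> \<mu>))"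
    unfolding E_def sum.distrib using sum.swap[of "\<lambda>\<mu> \<nu>. R \<mu> \<nu> (?G \<mu> \<nu>)" UNIV UNIV] by simp
  also have "\<dots> = - of_real c_F * \<i> * corr_sum delta (?G \<kappa> \<rho>) ?B - - of_real c_F * \<i> * corr_sum delta (?G \<rho> \<kappa>) ?B"
  proof -
    have single: "(\<Sum>\<mu>\<in>UNIV. \<Sum>\<nu>\<in>UNIV. of_bool (\<mu> = \<kappa> \<and> \<nu> = \<rho>) * X \<mu> \<nu>) = X \<kappa> \<rho>" for \<kappa> \<rho> :: 4 and X :: "4 \<Rightarrow> 4 \<Rightarrow> complex"
      by (rule trans[OF sum_eq_single[of \<kappa>]], simp, rule trans[OF sum_eq_single[of \<rho>]]) auto
    show ?thesis
      unfolding pair sum_subtractf single ..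
  qed
  also have "corr_sum delta (?G \<rho> \<kappa>) ?B = - corr_sum delta (?G \<kappa> \<rho>) ?B"
    by (rule trans[OF corr_sum_equiv_left[OF G_antisym] corr_sum_minus_left[OF test_linear_delta]])
  finally have "E = - of_real c_F * \<i> * corr_sum delta (?G \<kappa> \<rho>) ?B"
    by algebra
  then show ?thesis
    by (simp only: E_def R_def sum_distrib_left)
qed

end

section \<open>Diagonal integrals, symmetrization, and the divergence of \<open>Q2\<close>\<close>

context wick_matrix_element
begin

text \<open>The local functional: at coincident points a bilocal product is one polynomial, so the
  second slot can be filled with 1.\<close>

definition diag_int :: "(pt \<times> pt \<Rightarrow> complex) \<Rightarrow> 'a wick \<Rightarrow> complex" where
  "diag_int \<phi> P = delta (wcorr \<phi> P 1)"

definition string_current :: "4 \<Rightarrow> 'a \<Rightarrow> 'a wick" where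
  "string_current \<mu> a = (\<Sum>\<nu>\<in>UNIV. metric_sign \<nu> * icomm f (F_up \<mu> \<nu>) (A_up \<nu>) a)"

text \<open>Half of the string part of the divergence of \<open>Q2\<close>: the derivative sits on
  \<phi>, and the sign of this transposition cancels the minus sign in \<open>Q2\<close>.\<close>

definition string_term :: "(pt \<times> pt \<Rightarrow> complex) \<Rightarrow> complex" where
  "string_term \<phi> = (\<Sum>\<mu>\<in>UNIV. \<Sum>a\<in>UNIV. \<Sum>\<nu>\<in>UNIV. sgn_mink \<nu> *
     string_dist \<sigma> c \<nu> delta (wcorr (dderiv [(axis \<mu> 1, 0)] \<phi>) (string_current \<mu> a) (icomm f w_field (A_up \<nu>) a)))"

lemma diag_int_linear: "test_fun \<phi> \<Longrightarrow> wick_linear (diag_int \<phi>)"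
  unfolding diag_int_def[abs_def] by (rule wcorr_linear_left[OF test_linear_delta])

lemma diag_int_equiv: "P \<doteq> Q \<Longrightarrow> diag_int \<phi> P = diag_int \<phi> Q"
  by (simp add: diag_int_def wcorr_equiv_left)

lemma delta_wcorr: "delta (wcorr \<phi> P Q) = diag_int \<phi> (P * Q)"
  unfolding diag_int_def delta_def wcorr_def corr_diagonal[of P Q] ..

lemma delta_wcorr_swap: "delta (wcorr (\<lambda>p. \<phi> (prod.swap p)) P Q) = delta (wcorr \<phi> P Q)"
  by (simp add: delta_def wcorr_def)

lemma diag_int_swap: "diag_int (\<lambda>p. \<phi> (prod.swap p)) P = diag_int \<phi> P"
  by (simp add: diag_int_def delta_wcorr_swap)

lemma wcorr_swap: "wcorr \<phi> P Q (prod.swap p) = wcorr (\<lambda>p. \<phi> (prod.swap p)) Q P p"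
  by (simp add: wcorr_def corr_def mult.commute)

lemma dderiv_wcorr_left:
  assumes "test_fun \<phi>"
  shows "dderiv [(axis \<mu> 1, 0)] (wcorr \<phi> P Q) = (\<lambda>p. wcorr (dderiv [(axis \<mu> 1, 0)] \<phi>) P Q p + wcorr \<phi> (wick_deriv \<mu> P) Q p)"
  unfolding wcorr_def dderiv1_mult[OF test_fun_smooth[OF assms] smooth_corr] dderiv_corr_left ..

lemma dderiv_wcorr_right:
  assumes "test_fun \<phi>"
  shows "dderiv [(0, axis \<mu> 1)] (wcorr \<phi> P Q) = (\<lambda>p. wcorr (dderiv [(0, axis \<mu> 1)] \<phi>) P Q p + wcorr \<phi> P (wick_deriv \<mu> Q) p)"
  unfolding wcorr_def dderiv1_mult[OF test_fun_smooth[OF assms] smooth_corr] dderiv_corr_right ..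

lemma delta_wcorr_deriv_swap:
  assumes "test_fun \<phi>"
  shows "delta (wcorr (dderiv [(axis \<mu> 1, 0)] (\<lambda>p. \<phi> (prod.swap p))) P Q) = delta (wcorr (dderiv [(0, axis \<mu> 1)] \<phi>) P Q)"
  unfolding dderiv1_swap[OF test_fun_smooth[OF assms]] by (simp add: delta_wcorr_swap del: dderiv.simps)

text \<open>On the diagonal, the first-slot derivative of the swapped \<phi> is the second-slot
  derivative of \<phi>. The left side is thus a total derivative along the diagonal, up to the terms
  in which the derivative hits the fields.\<close>

lemma delta_wcorr_deriv_sum:
  assumes "test_fun \<phi>"
  shows "delta (wcorr (dderiv [(axis \<mu> 1, 0)] \<phi>) P Q) + delta (wcorr (dderiv [(axis \<mu> 1, 0)] (\<lambda>p. \<phi> (prod.swap p))) P Q)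
    = - (diag_int \<phi> (wick_deriv \<mu> P * Q) + diag_int \<phi> (P * wick_deriv \<mu> Q))"
proof -
  have "delta (dderiv [(axis \<mu> 1, 0)] (wcorr \<phi> P Q)) + delta (dderiv [(0, axis \<mu> 1)] (wcorr \<phi> P Q)) = 0"
    using integral_diagonal_deriv_swap[OF test_fun_wcorr[OF assms], where v = "axis \<mu> 1" and z = 0]
    by (simp add: delta_def del: dderiv.simps)
  moreover have "delta (dderiv [(axis \<mu> 1, 0)] (wcorr \<phi> P Q)) =
      delta (wcorr (dderiv [(axis \<mu> 1, 0)] \<phi>) P Q) + diag_int \<phi> (wick_deriv \<mu> P * Q)"
    unfolding dderiv_wcorr_left[OF assms]
    by (simp add: delta_add[OF test_fun_wcorr[OF test_fun_dderiv[OF assms]] test_fun_wcorr[OF assms]] delta_wcorr[of \<phi>] del: dderiv.simps)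
  moreover have "delta (dderiv [(0, axis \<mu> 1)] (wcorr \<phi> P Q)) =
      delta (wcorr (dderiv [(0, axis \<mu> 1)] \<phi>) P Q) + diag_int \<phi> (P * wick_deriv \<mu> Q)"
    unfolding dderiv_wcorr_right[OF assms]
    by (simp add: delta_add[OF test_fun_wcorr[OF test_fun_dderiv[OF assms]] test_fun_wcorr[OF assms]] delta_wcorr[of \<phi>] del: dderiv.simps)
  ultimately show ?thesis
    unfolding delta_wcorr_deriv_swap[OF assms] by algebra
qed

text \<open>Each order contributes the derivative of \<open>P\<close> once, and integrating the
  derivatives of \<phi> by parts takes back one derivative of \<open>P\<close> and one of
  \<open>Q\<close>. What remains is a difference.\<close>

lemma dist_deriv_delta_wcorr_sum:
  assumes "test_fun \<phi>"
  shows "dist_deriv \<mu> delta (wcorr \<phi> P Q) + dist_deriv \<mu> delta (wcorr (\<lambda>p. \<phi> (prod.swap p)) P Q) =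
    - (diag_int \<phi> (wick_deriv \<mu> P * Q) - diag_int \<phi> (P * wick_deriv \<mu> Q))"
proof -
  have "dist_deriv \<mu> delta (wcorr \<phi> P Q) = - (delta (wcorr (dderiv [(axis \<mu> 1, 0)] \<phi>) P Q) + delta (wcorr \<phi> (wick_deriv \<mu> P) Q))"
    if "test_fun \<phi>" for \<phi>
    unfolding dist_deriv_def dderiv_wcorr_left[OF that]
    by (simp add: delta_add[OF test_fun_wcorr[OF test_fun_dderiv[OF that]] test_fun_wcorr[OF that]] del: dderiv.simps)
  from this[OF assms] this[OF test_fun_swap[OF assms]] show ?thesis
    using delta_wcorr_deriv_sum[OF assms, of \<mu> P Q] unfolding delta_wcorr_swap delta_wcorr[of \<phi>] by algebra
qed

lemma smear_wmul_delta:
  "smear (wmul (\<lambda>x x'. wick_at P x) (wlift \<omega> (\<lambda>\<phi>. \<i> * delta \<phi>))) \<phi> = \<i> * diag_int \<phi> P"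
proof -
  have "\<omega> (R * const z) = z * \<omega> R" for R z
    using wick_linear_const_mult[OF linear] by (simp add: mult.commute)
  then show ?thesis
    by (simp add: smear_def wmul_def wlift_def diag_int_def wcorr_def corr_def[abs_def] case_prod_unfold)
qed

definition local_current :: "4 \<Rightarrow> 'a wick" where
  "local_current \<mu> = (\<Sum>\<nu>\<in>UNIV. inn (icomm f (A_up \<mu>) (A_up \<nu>)) (icomm f w_field (A_dn \<nu>)))"

lemma smear_Q2:
  assumes "test_fun \<phi>"
  shows "(\<Sum>\<mu>\<in>UNIV. dist_deriv \<mu> (smear (Q2 \<sigma> c f c_F \<omega> \<mu>)) \<phi>) =
    2 * (1 + of_real c_F) * (\<Sum>\<mu>\<in>UNIV. delta (wcorr (dderiv [(axis \<mu> 1, 0)] \<phi>) (local_current \<mu>) 1)) + 2 * string_term \<phi>"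
proof -
  have \<omega>_const: "\<omega> (R * const z) = z * \<omega> R" for R z
    using wick_linear_const_mult[OF linear] by (simp add: mult.commute)
  have Q2: "smear (Q2 \<sigma> c f c_F \<omega> \<mu>) \<psi> = - 2 * (1 + of_real c_F) * delta (wcorr \<psi> (local_current \<mu>) 1)
    - 2 * (\<Sum>a\<in>UNIV. \<Sum>\<nu>\<in>UNIV. string_dist \<sigma> c \<nu> delta
        (wcorr \<psi> (\<Sum>\<nu>\<in>UNIV. icomm f (F_up \<mu> \<nu>) (A_dn \<nu>) a) (icomm f w_field (A_dn \<nu>) a)))" for \<mu> \<psi>
    unfolding smear_def Q2_def w2_def wmul_def wlift_def
    by (simp add: wcorr_def corr_def[abs_def] case_prod_unfold local_current_def \<omega>_const
        mult.left_commute[of "wick_at _ (snd _)"] flip: mult.assoc)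
      (simp add: mult.commute \<omega>_const)
  have current: "(\<Sum>\<nu>\<in>UNIV. icomm f (F_up \<mu> \<nu>) (A_dn \<nu>) a) = string_current \<mu> a" for \<mu> a
    by (simp add: string_current_def A_dn_eq[abs_def] icomm_mult_right)
  have "string_dist \<sigma> c \<nu> delta (wcorr \<psi> P (icomm f w_field (A_dn \<nu>) a)) =
    sgn_mink \<nu> * string_dist \<sigma> c \<nu> delta (wcorr \<psi> P (icomm f w_field (A_up \<nu>) a))" if "test_fun \<psi>" for \<nu> \<psi> P a
    unfolding A_dn_eq[abs_def] icomm_mult_right
    by (rule wick_linear_const_mult[OF wcorr_linear_right[OF test_linear_string_dist[OF smearing] that]])
  then have "dist_deriv \<mu> (smear (Q2 \<sigma> c f c_F \<omega> \<mu>)) \<phi> =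
    2 * (1 + of_real c_F) * delta (wcorr (dderiv [(axis \<mu> 1, 0)] \<phi>) (local_current \<mu>) 1) +
    2 * (\<Sum>a\<in>UNIV. \<Sum>\<nu>\<in>UNIV. sgn_mink \<nu> * string_dist \<sigma> c \<nu> delta
      (wcorr (dderiv [(axis \<mu> 1, 0)] \<phi>) (string_current \<mu> a) (icomm f w_field (A_up \<nu>) a)))" for \<mu>
    unfolding dist_deriv_def Q2 current
    by (simp add: test_fun_dderiv[OF assms] algebra_simps del: dderiv.simps)
  then show ?thesis
    unfolding string_term_def by (simp only: sum.distrib sum_distrib_left)
qed

text \<open>The 1/2 of symmetrization cancels the factor 2 in both parts of \<open>Q2\<close>. In
  the local part the derivatives of \<phi> combine into the divergence of the current; the string
  terms are merely added in both orders.\<close>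

lemma symm_Q2:
  assumes "test_fun \<phi>"
  shows "symm (\<lambda>\<phi>. \<Sum>\<mu>\<in>UNIV. dist_deriv \<mu> (smear (Q2 \<sigma> c f c_F \<omega> \<mu>)) \<phi>) \<phi> =
    - (1 + of_real c_F) * diag_int \<phi> (\<Sum>\<mu>\<in>UNIV. wick_deriv \<mu> (local_current \<mu>))
    + (string_term \<phi> + string_term (\<lambda>p. \<phi> (prod.swap p)))"
proof -
  have deriv_1: "wick_deriv \<mu> (1 :: 'a wick) = 0" for \<mu>
    using wick_deriv_const[of \<mu> 1] by simp
  have "delta (wcorr (dderiv [(axis \<mu> 1, 0)] \<phi>) (local_current \<mu>) 1)
      + delta (wcorr (dderiv [(axis \<mu> 1, 0)] (\<lambda>p. \<phi> (prod.swap p))) (local_current \<mu>) 1)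
    = - diag_int \<phi> (wick_deriv \<mu> (local_current \<mu>))" for \<mu>
    unfolding delta_wcorr_deriv_sum[OF assms] deriv_1 by (simp add: wick_linear_0[OF diag_int_linear[OF assms]])
  then have "(\<Sum>\<mu>\<in>UNIV. delta (wcorr (dderiv [(axis \<mu> 1, 0)] \<phi>) (local_current \<mu>) 1))
      + (\<Sum>\<mu>\<in>UNIV. delta (wcorr (dderiv [(axis \<mu> 1, 0)] (\<lambda>p. \<phi> (prod.swap p))) (local_current \<mu>) 1))
    = - diag_int \<phi> (\<Sum>\<mu>\<in>UNIV. wick_deriv \<mu> (local_current \<mu>))"
    unfolding sum.distrib[symmetric] wick_linear_sum[OF diag_int_linear[OF assms]] by (simp only: sum_negf)
  then show ?thesis
    unfolding symm_def o_def smear_Q2[OF assms] smear_Q2[OF test_fun_swap[OF assms]] by algebra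
qed

end

section \<open>Evaluation of the obstruction on a test function\<close>

context yang_mills_obstruction
begin

lemma corr_sum_delta: "corr_sum delta X Y = diag_int \<phi> (inn X Y)"
  by (simp add: corr_sum_def delta_wcorr inn_def wick_linear_sum[OF diag_int_linear[OF \<phi>]])

text \<open>By Leibniz the derivative falls on the swapped \<phi>, giving
  \<open>string_term\<close>, or on the current, giving zero by conservation. The minus sign comes
  from reversing the bracket of A and F to form the current.\<close>

lemma string_part:
  "(\<Sum>\<kappa>\<in>UNIV. \<Sum>\<rho>\<in>UNIV. sgn_mink \<rho> * (\<Sum>\<nu>\<in>UNIV. sgn_mink \<nu> *
      corr_sum (string_delta \<nu> \<kappa>) (icomm f w_field (A_up \<nu>)) (icomm f (A_up \<rho>) (F_up \<kappa> \<rho>)))) =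
    - string_term (\<lambda>p. \<phi> (prod.swap p))"
proof -
  let ?\<phi> = "\<lambda>p. \<phi> (prod.swap p)"
  let ?w = "\<lambda>\<nu>. icomm f w_field (A_up \<nu>)"
  let ?S = "\<lambda>\<nu>. string_dist \<sigma> c \<nu> delta"
  have test: "test_fun ?\<phi>" by (rule test_fun_swap[OF \<phi>])
  have current: "(\<Sum>\<rho>\<in>UNIV. sgn_mink \<rho> * corr_sum (string_delta \<nu> \<kappa>) (?w \<nu>) (icomm f (A_up \<rho>) (F_up \<kappa> \<rho>))) =
      - corr_sum (string_delta \<nu> \<kappa>) (?w \<nu>) (string_current \<kappa>)" for \<nu> \<kappa>
  proof -
    note V = wcorr_linear_right[OF test_linear_string_delta \<phi>]
    have "corr_sum (string_delta \<nu> \<kappa>) (?w \<nu>) (icomm f (A_up \<rho>) (F_up \<kappa> \<rho>)) =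
      - corr_sum (string_delta \<nu> \<kappa>) (?w \<nu>) (icomm f (F_up \<kappa> \<rho>) (A_up \<rho>))" for \<rho>
      by (subst icomm_antisym_fun) (rule corr_sum_minus_right[OF test_linear_string_delta])
    moreover have "corr_sum (string_delta \<nu> \<kappa>) (?w \<nu>) (string_current \<kappa>) =
      (\<Sum>\<rho>\<in>UNIV. sgn_mink \<rho> * corr_sum (string_delta \<nu> \<kappa>) (?w \<nu>) (icomm f (F_up \<kappa> \<rho>) (A_up \<rho>)))"
      unfolding corr_sum_def string_current_def wick_linear_sum[OF V] wick_linear_const_mult[OF V] sum_distrib_left
      by (rule sum.swap)
    ultimately show ?thesis
      by (simp add: sum_negf)
  qed
  have leibniz: "string_delta \<nu> \<kappa> (wcorr \<phi> P Q) =
      ?S \<nu> (wcorr (dderiv [(axis \<kappa> 1, 0)] ?\<phi>) Q P) + ?S \<nu> (wcorr ?\<phi> (wick_deriv \<kappa> Q) P)" for \<nu> \<kappa> P Q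
    unfolding string_delta_def wcorr_swap dderiv_wcorr_left[OF test]
    by (intro string_dist_delta_add[OF smearing] test_fun_wcorr test test_fun_dderiv)
  have conserved: "(\<Sum>\<kappa>\<in>UNIV. ?S \<nu> (wcorr ?\<phi> (wick_deriv \<kappa> (string_current \<kappa> a)) P)) = 0" for \<nu> a P
  proof -
    note V = wcorr_linear_left[OF test_linear_string_dist[OF smearing] test]
    have "(\<Sum>\<kappa>\<in>UNIV. ?S \<nu> (wcorr ?\<phi> (wick_deriv \<kappa> (string_current \<kappa> a)) P)) =
      ?S \<nu> (wcorr ?\<phi> (\<Sum>\<kappa>\<in>UNIV. wick_deriv \<kappa> (string_current \<kappa> a)) P)"
      by (rule wick_linear_sum[OF V, symmetric])
    also have "\<dots> = ?S \<nu> (wcorr ?\<phi> 0 P)"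
      by (simp only: string_current_def wcorr_equiv_left[OF current_conserved])
    also have "\<dots> = 0"
      by (rule wick_linear_0[OF V])
    finally show ?thesis .
  qed
  have "(\<Sum>\<kappa>\<in>UNIV. \<Sum>\<rho>\<in>UNIV. sgn_mink \<rho> * (\<Sum>\<nu>\<in>UNIV. sgn_mink \<nu> * corr_sum (string_delta \<nu> \<kappa>) (?w \<nu>) (icomm f (A_up \<rho>) (F_up \<kappa> \<rho>)))) =
    (\<Sum>\<kappa>\<in>UNIV. \<Sum>\<nu>\<in>UNIV. sgn_mink \<nu> * (\<Sum>\<rho>\<in>UNIV. sgn_mink \<rho> * corr_sum (string_delta \<nu> \<kappa>) (?w \<nu>) (icomm f (A_up \<rho>) (F_up \<kappa> \<rho>))))"
    unfolding sum_distrib_left by (subst sum.swap) (simp only: mult.left_commute)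
  also have "\<dots> = - (\<Sum>\<kappa>\<in>UNIV. \<Sum>\<nu>\<in>UNIV. \<Sum>a\<in>UNIV. sgn_mink \<nu> * string_delta \<nu> \<kappa> (wcorr \<phi> (?w \<nu> a) (string_current \<kappa> a)))"
    unfolding current by (simp add: corr_sum_def sum_negf sum_distrib_left)
  also have "(\<Sum>\<kappa>\<in>UNIV. \<Sum>\<nu>\<in>UNIV. \<Sum>a\<in>UNIV. sgn_mink \<nu> * string_delta \<nu> \<kappa> (wcorr \<phi> (?w \<nu> a) (string_current \<kappa> a))) =
    (\<Sum>\<kappa>\<in>UNIV. \<Sum>\<nu>\<in>UNIV. \<Sum>a\<in>UNIV. sgn_mink \<nu> * ?S \<nu> (wcorr (dderiv [(axis \<kappa> 1, 0)] ?\<phi>) (string_current \<kappa> a) (?w \<nu> a))) +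
    (\<Sum>\<kappa>\<in>UNIV. \<Sum>\<nu>\<in>UNIV. \<Sum>a\<in>UNIV. sgn_mink \<nu> * ?S \<nu> (wcorr ?\<phi> (wick_deriv \<kappa> (string_current \<kappa> a)) (?w \<nu> a)))"
    unfolding leibniz by (simp only: distrib_left sum.distrib)
  also have "(\<Sum>\<kappa>\<in>UNIV. \<Sum>\<nu>\<in>UNIV. \<Sum>a\<in>UNIV. sgn_mink \<nu> * ?S \<nu> (wcorr ?\<phi> (wick_deriv \<kappa> (string_current \<kappa> a)) (?w \<nu> a))) =
    (\<Sum>\<nu>\<in>UNIV. \<Sum>a\<in>UNIV. sgn_mink \<nu> * (\<Sum>\<kappa>\<in>UNIV. ?S \<nu> (wcorr ?\<phi> (wick_deriv \<kappa> (string_current \<kappa> a)) (?w \<nu> a))))"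
    unfolding sum_distrib_left by (rule sum_rotate[symmetric])
  also have "\<dots> = 0"
    by (simp only: conserved mult_zero_right sum.neutral_const)
  also have "(\<Sum>\<kappa>\<in>UNIV. \<Sum>\<nu>\<in>UNIV. \<Sum>a\<in>UNIV. sgn_mink \<nu> * ?S \<nu> (wcorr (dderiv [(axis \<kappa> 1, 0)] ?\<phi>) (string_current \<kappa> a) (?w \<nu> a))) =
    string_term ?\<phi>"
    unfolding string_term_def by (intro sum.cong refl sum.swap)
  finally show ?thesis by simp
qed

text \<open>The 1/2 of \<open>L1\<close> is used up in the FF and FA terms, where \<kappa> and
  \<rho> occur in both orders, but it survives in the AF term, where \<open>A_row\<close> gives a
  single contribution.\<close>

lemma obstruction_eval:
  "smear (obstruction \<omega> Ob (Q1 f) (L1 f)) \<phi> =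
    - (1 + of_real c_F) * \<i> * (\<Sum>\<kappa>\<in>UNIV. \<Sum>\<rho>\<in>UNIV. sgn_mink \<kappa> *
        (\<Sum>a\<in>UNIV. dist_deriv \<rho> delta (wcorr \<phi> (icomm f w_field (A_up \<kappa>) a) (icomm f (A_up \<kappa>) (A_up \<rho>) a))))
    - \<i> * (\<Sum>\<kappa>\<in>UNIV. \<Sum>\<rho>\<in>UNIV. sgn_mink \<kappa> * (sgn_mink \<rho> * diag_int \<phi> (inn (icomm f w_field (A_up \<kappa>)) (icomm f (A_up \<rho>) (F_up \<kappa> \<rho>)))))
    - of_real c_F * \<i> / 2 * (\<Sum>\<kappa>\<in>UNIV. \<Sum>\<rho>\<in>UNIV. sgn_mink \<kappa> * (sgn_mink \<rho> * diag_int \<phi> (inn (icomm f (F_up \<kappa> \<rho>) w_field) (icomm f (A_up \<kappa>) (A_up \<rho>)))))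
    - \<i> * string_term (\<lambda>p. \<phi> (prod.swap p))"
proof -
  let ?w = "\<lambda>\<nu>. icomm f w_field (A_up \<nu>)" and ?B = "\<lambda>\<kappa> \<rho>. icomm f (A_up \<kappa>) (A_up \<rho>)"
  let ?AF = "\<lambda>\<kappa> \<rho>. icomm f (A_up \<rho>) (F_up \<kappa> \<rho>)"
  let ?M = "\<lambda>\<kappa> \<rho>. - of_real c_F * \<i> * corr_sum delta (icomm f (F_up \<kappa> \<rho>) w_field) (?B \<kappa> \<rho>)"
  \<comment> \<open>Antisymmetry of F turns the contraction with the second potential into the one
    with the first, with \<kappa> and \<rho> exchanged.\<close>
  have AF: "corr_sum V X (icomm f (F_up \<kappa> \<rho>) (A_up \<kappa>)) = corr_sum V X (?AF \<rho> \<kappa>)" for V X \<kappa> \<rho>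
  proof (rule corr_sum_equiv_right)
    fix a
    have "icomm f (A_up \<kappa>) (F_up \<rho> \<kappa>) a \<doteq> icomm f (A_up \<kappa>) (\<lambda>a. - F_up \<kappa> \<rho> a) a"
      by (intro equiv_icomm_right F_up_antisym)
    then show "icomm f (F_up \<kappa> \<rho>) (A_up \<kappa>) a \<doteq> icomm f (A_up \<kappa>) (F_up \<rho> \<kappa>) a"
      by (simp only: icomm_minus_right icomm_antisym[of "A_up \<kappa>" "F_up \<kappa> \<rho>"] minus_minus equiv_sym)
  qed
  have B: "corr_sum (dist_deriv \<kappa> delta) X (?B \<kappa> \<rho>) = - corr_sum (dist_deriv \<kappa> delta) X (?B \<rho> \<kappa>)" for X \<kappa> \<rho>
    by (subst icomm_antisym_fun) (rule corr_sum_minus_right[OF test_linear_dist_deriv[OF test_linear_delta]])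
  \<comment> \<open>A metric entry times its sign is a Kronecker delta, so the sum over \<nu>
    replaces \<nu> by \<kappa> or \<rho>; only in the string terms does \<nu> remain a summation
    index.\<close>
  have pair: "(\<Sum>\<nu>\<in>UNIV. sgn_mink \<nu> * (\<Sum>\<mu>\<in>UNIV. \<Sum>a\<in>UNIV. row_sum \<kappa> \<rho> \<mu> (FieldF \<mu> \<nu> a) (?w \<nu> a))) =
    pair_term \<kappa> \<rho> + pair_term \<rho> \<kappa>" for \<kappa> \<rho>
    unfolding F_row AF pair_term_def B[of \<kappa> _ \<rho>]
    by (simp only: right_diff_distrib distrib_left sum_subtractf sum.distrib
        mult.left_commute[of "sgn_mink _" "- (1 + complex_of_real c_F) * \<i>"] mult.left_commute[of "sgn_mink _" \<i>]
        sum_distrib_left[symmetric] sum_sgn_mink) (simp add: algebra_simps)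
  have "smear (obstruction \<omega> Ob (Q1 f) (L1 f)) \<phi> = 1/2 * (\<Sum>\<kappa>\<in>UNIV. \<Sum>\<rho>\<in>UNIV. sgn_mink \<kappa> * (sgn_mink \<rho> *
      (pair_term \<kappa> \<rho> + pair_term \<rho> \<kappa> + ?M \<kappa> \<rho>)))"
    unfolding smear_obstruction_Q1_L1 pair A_row ..
  also have "\<dots> = (\<Sum>\<kappa>\<in>UNIV. \<Sum>\<rho>\<in>UNIV. sgn_mink \<kappa> * (sgn_mink \<rho> * pair_term \<kappa> \<rho>)) +
      1/2 * (\<Sum>\<kappa>\<in>UNIV. \<Sum>\<rho>\<in>UNIV. sgn_mink \<kappa> * (sgn_mink \<rho> * ?M \<kappa> \<rho>))"
  proof -
    have "(\<Sum>\<kappa>\<in>UNIV. \<Sum>\<rho>\<in>UNIV. sgn_mink \<kappa> * (sgn_mink \<rho> * pair_term \<rho> \<kappa>)) = (\<Sum>\<kappa>\<in>UNIV. \<Sum>\<rho>\<in>UNIV. sgn_mink \<kappa> * (sgn_mink \<rho> * pair_term \<kappa> \<rho>))"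
      by (subst sum.swap) (simp only: mult.left_commute)
    then show ?thesis
      by (simp only: distrib_left sum.distrib) simp
  qed
  also have "(\<Sum>\<kappa>\<in>UNIV. \<Sum>\<rho>\<in>UNIV. sgn_mink \<kappa> * (sgn_mink \<rho> * pair_term \<kappa> \<rho>)) =
    - (1 + of_real c_F) * \<i> * (\<Sum>\<kappa>\<in>UNIV. \<Sum>\<rho>\<in>UNIV. sgn_mink \<kappa> * corr_sum (dist_deriv \<rho> delta) (?w \<kappa>) (?B \<kappa> \<rho>))
    - \<i> * (\<Sum>\<kappa>\<in>UNIV. \<Sum>\<rho>\<in>UNIV. sgn_mink \<kappa> * (sgn_mink \<rho> * corr_sum delta (?w \<kappa>) (?AF \<kappa> \<rho>)))
    + \<i> * (\<Sum>\<kappa>\<in>UNIV. \<Sum>\<rho>\<in>UNIV. sgn_mink \<rho> * (\<Sum>\<nu>\<in>UNIV. sgn_mink \<nu> * corr_sum (string_delta \<nu> \<kappa>) (?w \<nu>) (?AF \<kappa> \<rho>)))"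
  proof -
    have "sgn_mink \<kappa> * (sgn_mink \<rho> * pair_term \<kappa> \<rho>) =
      - (1 + of_real c_F) * \<i> * (sgn_mink \<kappa> * corr_sum (dist_deriv \<rho> delta) (?w \<kappa>) (?B \<kappa> \<rho>))
      - \<i> * (sgn_mink \<kappa> * (sgn_mink \<rho> * corr_sum delta (?w \<kappa>) (?AF \<kappa> \<rho>)))
      + \<i> * (sgn_mink \<rho> * (\<Sum>\<nu>\<in>UNIV. sgn_mink \<nu> * corr_sum (string_delta \<nu> \<kappa>) (?w \<nu>) (?AF \<kappa> \<rho>)))" for \<kappa> \<rho>
    proof -
      have pull: "(\<Sum>\<nu>\<in>UNIV. sgn_mink \<nu> * (sgn_mink \<kappa> * X \<nu>)) = sgn_mink \<kappa> * (\<Sum>\<nu>\<in>UNIV. sgn_mink \<nu> * X \<nu>)" for X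
        by (simp add: sum_distrib_left mult.left_commute)
      have "sgn_mink \<kappa> * (sgn_mink \<rho> * (- u * \<i> * (sgn_mink \<rho> * x) - \<i> * y + \<i> * (sgn_mink \<kappa> * z))) =
        - u * \<i> * (sgn_mink \<kappa> * x) - \<i> * (sgn_mink \<kappa> * (sgn_mink \<rho> * y)) + \<i> * (sgn_mink \<rho> * z)" for u x y z
        using sgn_mink_square[of \<kappa>] sgn_mink_square[of \<rho>] by algebra
      then show ?thesis
        unfolding pair_term_def pull .
    qed
    then show ?thesis
      by (simp only: sum.distrib sum_subtractf sum_distrib_left)
  qed
  also have "(\<Sum>\<kappa>\<in>UNIV. \<Sum>\<rho>\<in>UNIV. sgn_mink \<kappa> * (sgn_mink \<rho> * ?M \<kappa> \<rho>)) = - of_real c_F * \<i> *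
      (\<Sum>\<kappa>\<in>UNIV. \<Sum>\<rho>\<in>UNIV. sgn_mink \<kappa> * (sgn_mink \<rho> * corr_sum delta (icomm f (F_up \<kappa> \<rho>) w_field) (?B \<kappa> \<rho>)))"
    by (simp add: sum_distrib_left mult_ac)
  finally show ?thesis
    unfolding string_part corr_sum_delta by (simp add: corr_sum_def)
qed

end

theorem proposition3p3:
  fixes f :: "'a::finite \<Rightarrow> 'a \<Rightarrow> 'a \<Rightarrow> real"
    and \<sigma> :: "pt measure" and c :: "pt \<Rightarrow> real" and c_F :: real
    and \<delta>\<^sub>c :: "'a wick \<Rightarrow> 'a wick"
    and Ob :: "4 \<Rightarrow> 'a fld \<Rightarrow> 'a fld \<Rightarrow> bidist"
    and \<omega> :: "'a nwick \<Rightarrow> complex" and \<phi> :: "pt \<times> pt \<Rightarrow> complex"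
  assumes "simple_lie_algebra f"
    and "smearing \<sigma> c"
    and "string_variation \<delta>\<^sub>c"
    and "two_point_obstruction \<sigma> c c_F Ob"
    and "wick_functional \<sigma> c \<omega>"
    and "test_fun \<phi>"
  shows "2 * symm (smear (obstruction \<omega> Ob (Q1 f) (L1 f))) \<phi> =
    smear (wmul (\<lambda>x x'. wick_at (\<delta>\<^sub>c (L2 f c_F)) x) (wlift \<omega> (\<lambda>\<phi>. \<i> * delta \<phi>))) \<phi>
    - \<i> * symm (\<lambda>\<phi>. \<Sum>\<mu>\<in>UNIV. dist_deriv \<mu> (smear (Q2 \<sigma> c f c_F \<omega> \<mu>)) \<phi>) \<phi>"
proof -
  interpret wick_matrix_element f \<sigma> c \<omega>
    using assms by unfold_locales
  let ?\<phi> = "\<lambda>p. \<phi> (prod.swap p)"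
  \<comment> \<open>\<open>symm\<close> evaluates the obstruction on \<phi> and on its swap, so the
    evaluation is instantiated for both.\<close>
  interpret O1: yang_mills_obstruction f \<sigma> c \<omega> c_F Ob \<phi>
    using assms by unfold_locales
  interpret O2: yang_mills_obstruction f \<sigma> c \<omega> c_F Ob ?\<phi>
    using assms test_fun_swap by unfold_locales
  note J_lin = diag_int_linear[OF \<open>test_fun \<phi>\<close>]
  let ?w = "\<lambda>\<kappa>. icomm f w_field (A_up \<kappa>)" and ?B = "\<lambda>\<kappa> \<rho>. icomm f (A_up \<kappa>) (A_up \<rho>)"
  let ?N = "\<Sum>\<kappa>\<in>UNIV. \<Sum>\<rho>\<in>UNIV. metric_sign \<kappa> * (metric_sign \<rho> * inn (?w \<kappa>) (icomm f (A_up \<rho>) (F_up \<kappa> \<rho>)))"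
  let ?M = "\<Sum>\<kappa>\<in>UNIV. \<Sum>\<rho>\<in>UNIV. metric_sign \<kappa> * (metric_sign \<rho> * inn (icomm f (F_up \<kappa> \<rho>) w_field) (?B \<kappa> \<rho>))"
  let ?FF = "\<Sum>\<kappa>\<in>UNIV. \<Sum>\<rho>\<in>UNIV. metric_sign \<kappa> *
    (inn (\<lambda>a. wick_deriv \<rho> (?w \<kappa> a)) (?B \<kappa> \<rho>) - inn (?w \<kappa>) (\<lambda>a. wick_deriv \<rho> (?B \<kappa> \<rho> a)))"
  let ?DD = "\<lambda>\<phi>. \<Sum>\<kappa>\<in>UNIV. \<Sum>\<rho>\<in>UNIV. sgn_mink \<kappa> * (\<Sum>a\<in>UNIV. dist_deriv \<rho> delta (wcorr \<phi> (?w \<kappa> a) (?B \<kappa> \<rho> a)))"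
  have DD: "?DD \<phi> + ?DD ?\<phi> = - diag_int \<phi> ?FF"
  proof -
    have "?DD \<phi> + ?DD ?\<phi> = (\<Sum>\<kappa>\<in>UNIV. \<Sum>\<rho>\<in>UNIV. sgn_mink \<kappa> * (\<Sum>a\<in>UNIV.
        - (diag_int \<phi> (wick_deriv \<rho> (?w \<kappa> a) * ?B \<kappa> \<rho> a) - diag_int \<phi> (?w \<kappa> a * wick_deriv \<rho> (?B \<kappa> \<rho> a)))))"
      by (simp only: sum.distrib[symmetric] distrib_left[symmetric] dist_deriv_delta_wcorr_sum[OF \<open>test_fun \<phi>\<close>])
    also have "\<dots> = - diag_int \<phi> ?FF"
      unfolding wick_linear_sum[OF J_lin] wick_linear_const_mult[OF J_lin] wick_linear_diff[OF J_lin] inn_def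
      by (simp only: sum_negf sum_subtractf mult_minus_right)
    finally show ?thesis .
  qed
  have N: "(\<Sum>\<kappa>\<in>UNIV. \<Sum>\<rho>\<in>UNIV. sgn_mink \<kappa> * (sgn_mink \<rho> * diag_int \<phi> (inn (?w \<kappa>) (icomm f (A_up \<rho>) (F_up \<kappa> \<rho>))))) = diag_int \<phi> ?N"
    by (simp only: wick_linear_sum[OF J_lin] wick_linear_const_mult[OF J_lin])
  have M: "(\<Sum>\<kappa>\<in>UNIV. \<Sum>\<rho>\<in>UNIV. sgn_mink \<kappa> * (sgn_mink \<rho> * diag_int \<phi> (inn (icomm f (F_up \<kappa> \<rho>) w_field) (?B \<kappa> \<rho>)))) = diag_int \<phi> ?M"
    by (simp only: wick_linear_sum[OF J_lin] wick_linear_const_mult[OF J_lin])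
  have eval: "smear (obstruction \<omega> Ob (Q1 f) (L1 f)) \<phi> = - (1 + of_real c_F) * \<i> * ?DD \<phi> - \<i> * diag_int \<phi> ?N
      - of_real c_F * \<i> / 2 * diag_int \<phi> ?M - \<i> * string_term ?\<phi>"
    by (simp only: O1.obstruction_eval N M)
  have eval_swap: "smear (obstruction \<omega> Ob (Q1 f) (L1 f)) ?\<phi> = - (1 + of_real c_F) * \<i> * ?DD ?\<phi> - \<i> * diag_int \<phi> ?N
      - of_real c_F * \<i> / 2 * diag_int \<phi> ?M - \<i> * string_term \<phi>"
    by (simp only: O2.obstruction_eval diag_int_swap N M swap_swap)
  \<comment> \<open>Under the matrix element the congruence modulo the relations becomes a numerical
    equality. The string terms need no such step: both orders appear identically on the two
    sides.\<close>
  have "diag_int \<phi> (const (1 + of_real c_F) * ?FF - const 2 * ?N - const (of_real c_F) * ?M) =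
      diag_int \<phi> (\<delta>\<^sub>c (L2 f c_F) + const (1 + of_real c_F) * (\<Sum>\<mu>\<in>UNIV. wick_deriv \<mu> (local_current \<mu>)))"
    unfolding local_current_def by (rule diag_int_equiv[OF local_identity[OF \<open>string_variation \<delta>\<^sub>c\<close>]])
  then have "(1 + of_real c_F) * diag_int \<phi> ?FF - 2 * diag_int \<phi> ?N - of_real c_F * diag_int \<phi> ?M =
      diag_int \<phi> (\<delta>\<^sub>c (L2 f c_F)) + (1 + of_real c_F) * diag_int \<phi> (\<Sum>\<mu>\<in>UNIV. wick_deriv \<mu> (local_current \<mu>))"
    unfolding wick_linear_diff[OF J_lin] wick_linear_add[OF J_lin] wick_linear_const_mult[OF J_lin] .
  moreover have "2 * symm (smear (obstruction \<omega> Ob (Q1 f) (L1 f))) \<phi> =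
      smear (obstruction \<omega> Ob (Q1 f) (L1 f)) \<phi> + smear (obstruction \<omega> Ob (Q1 f) (L1 f)) ?\<phi>"
    by (simp add: symm_def o_def)
  ultimately show ?thesis
    unfolding smear_wmul_delta symm_Q2[OF \<open>test_fun \<phi>\<close>] eval eval_swap
    using DD by algebra
qed

end
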